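(* Let $\mathrm{i}^2=-1$ and define in $\mathbb{C}[x,y,z]$ the degree-nine polynomials $$F=y(y-x)(y+x)(y-x-2z)(y-x+2z)(y+x-2z)(y+x+2z)\,(x^2-y^2+4\mathrm{i}yz-4z^2),$$ $$G=xyz(x-y)(2x-z)(y-z)(2x+y-z)\,\bigl(z^2-yz-2xz+(1-\mathrm{i})xy\bigr),$$ and the curves $\mathcal{C}_F=\{F=0\}$ and $\mathcal{C}_G=\{G=0\}$ in $\mathbb{P}^2_{\mathbb{C}}$. Then $\mathcal{C}_F$ and $\mathcal{C}_G$ have the same weak combinatorics, namely $$W(\mathcal{C}_F)=W(\mathcal{C}_G)=(7,1;\,8A_1+D_4+4X_9).$$ Moreover, $\mathcal{C}_F$ is free with exponents $(4,4)$, whereas $\operatorname{mdr}(G)=3$ and $\mathcal{C}_G$ is nearly free with exponents $(3,6)$. Thus the pair $(\mathcal{C}_F,\mathcal{C}_G)$ is a counterexample to the Numerical Terao Conjecture in the class of conic-line arrangements with ordinary quasi-homogeneous singularities.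
   Context: A conic-line arrangement is a reduced plane curve in $\mathbb{P}^2_{\mathbb{C}}$ all of whose irreducible components are lines or smooth conics. Let $S=\mathbb{C}[x,y,z]$. For a reduced plane curve $\mathcal{C}=\{f=0\}$ of degree $d$, put $$\operatorname{AR}(f)=\{(a,b,c)\in S^{\oplus 3}: a f_x+b f_y+c f_z=0\},$$ a graded $S$-module graded by the common degree of $a,b,c$, and let $\operatorname{mdr}(f)$ be the least degree of a non-zero homogeneous element of $\operatorname{AR}(f)$. The curve $\mathcal{C}$ is free with exponents $(d_1,d_2)$, $d_1\le d_2$, if $\operatorname{AR}(f)\simeq S(-d_1)\oplus S(-d_2)$ as graded modules, where $d_1+d_2=d-1$. The curve $\mathcal{C}$ is nearly free with exponents $(d_1,d_2)$, $d_1\le d_2$, $d_1+d_2=d$, if $\operatorname{AR}(f)$ is minimally generated by three homogeneous elements, of degrees $d_1,d_2,d_2$, with a minimal graded free resolution of the form $0\to S(-d_2-1)\to S(-d_1)\oplus S(-d_2)^{\oplus 2}\to \operatorname{AR}(f)\to 0$. In particular a nearly free curve is not free. A singular point is ordinary if its local branches are smooth and pairwise transverse. $A_1$ denotes an ordinary double point, $D_4$ an ordinary triple point, and $X_9$ an ordinary quadruple point (regardless of its analytic modulus). A singularity is quasi-homogeneous if, after a holomorphic change of local coordinates, its defining equation becomes weighted homogeneous. The weak combinatorics of a curve whose irreducible components are all smooth records the number of irreducible components of each degree and the number of singular points of each type; ordinary quadruple points are only counted, without recording their moduli. The notation $W(\mathcal{C})=(7,1;\,8A_1+D_4+4X_9)$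 means that $\mathcal{C}$ consists of exactly $7$ lines and $1$ smooth conic and its singular points are exactly $8$ of type $A_1$, $1$ of type $D_4$ and $4$ of type $X_9$. Numerical Terao Conjecture: if $\mathcal{C}_1,\mathcal{C}_2\subset\mathbb{P}^2_{\mathbb{C}}$ are reduced curves with only smooth irreducible components and only quasi-homogeneous singularities, they have the same weak combinatorics, and $\mathcal{C}_1$ is free, then $\mathcal{C}_2$ is free. *)

theory Defs
  imports
    "HOL-Analysis.Analysis"
    "HOL-Computational_Algebra.Polynomial_Factorial"
    "HOL-Computational_Algebra.Squarefree"
begin

unbundle no fps_syntax
unbundle vec_syntax

section \<open>The graded ring \<open>S = \<complex>[x,y,z]\<close>\<close>

text \<open>The ring is represented as \<open>\<complex>[z][y][x]\<close>: the outermost polynomial variable is \<open>x\<close>.\<close>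

type_synonym S = "complex poly poly poly"

definition cst :: "complex \<Rightarrow> S" where "cst c = [:[:[:c:]:]:]"
definition varx :: S where "varx = [:0, 1:]"
definition vary :: S where "vary = [:[:0, 1:]:]"
definition varz :: S where "varz = [:[:[:0, 1:]:]:]"

definition coeff3 :: "S \<Rightarrow> nat \<Rightarrow> nat \<Rightarrow> nat \<Rightarrow> complex" where
  "coeff3 f i j k = coeff (coeff (coeff f i) j) k"

definition homogeneous :: "nat \<Rightarrow> S \<Rightarrow> bool" where
  "homogeneous d f \<longleftrightarrow> (\<forall>i j k. coeff3 f i j k \<noteq> 0 \<longrightarrow> i + j + k = d)"

definition eval :: "S \<Rightarrow> complex^3 \<Rightarrow> complex" where
  "eval f v = poly (poly (poly f [:[:v $ 1:]:]) [:v $ 2:]) (v $ 3)"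

definition dx :: "S \<Rightarrow> S" where "dx = pderiv"
definition dy :: "S \<Rightarrow> S" where "dy = map_poly pderiv"
definition dz :: "S \<Rightarrow> S" where "dz = map_poly (map_poly pderiv)"


section \<open>Plane curves, their components and singular points\<close>

text \<open>A point of the projective plane is a one-dimensional subspace of \<open>\<complex>\<^sup>3\<close>; a reduced plane curve
  is given by its square-free homogeneous equation.\<close>

definition reduced_curve :: "S \<Rightarrow> bool" where
  "reduced_curve f \<longleftrightarrow> squarefree f \<and> (\<exists>d>0. homogeneous d f)"

definition locus :: "S \<Rightarrow> (complex^3) set set" where
  "locus f = {vec.span {v} | v. v \<noteq> 0 \<and> eval f v = 0}"

definition sing_points :: "S \<Rightarrow> (complex^3) set set" where
  "sing_points f = {vec.span {v} | v. v \<noteq> 0 \<and> eval f v = 0 \<and>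
     eval (dx f) v = 0 \<and> eval (dy f) v = 0 \<and> eval (dz f) v = 0}"

definition curve_components :: "nat \<Rightarrow> S \<Rightarrow> (complex^3) set set set" where
  "curve_components k f = {locus g | g. irreducible g \<and> g dvd f \<and> homogeneous k g}"

definition smooth_components :: "S \<Rightarrow> bool" where
  "smooth_components f \<longleftrightarrow> (\<forall>g. irreducible g \<and> g dvd f \<longrightarrow> sing_points g = {})"

definition conic_line_arrangement :: "S \<Rightarrow> bool" where
  "conic_line_arrangement f \<longleftrightarrow> reduced_curve f \<and>
     (\<forall>g. irreducible g \<and> g dvd f \<longrightarrow>
        homogeneous 1 g \<or> (homogeneous 2 g \<and> sing_points g = {}))"


section \<open>The module \<open>AR(f)\<close>, free and nearly free curves\<close>

definition AR :: "S \<Rightarrow> (S^3) set" where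
  "AR f = {r. r $ 1 * dx f + r $ 2 * dy f + r $ 3 * dz f = 0}"

definition mdr :: "S \<Rightarrow> nat" where
  "mdr f = (LEAST k. \<exists>r\<in>AR f. r \<noteq> 0 \<and> (\<forall>i. homogeneous k (r $ i)))"

text \<open>A vector \<open>d\<close> of natural numbers turns \<open>S^'n\<close> into the graded module \<open>\<Oplus>\<^sub>i S(-d\<^sub>i)\<close>:
  its elements of degree \<open>k\<close> have \<open>i\<close>-th entry in \<open>S\<close> of degree \<open>k - d\<^sub>i\<close>, hence \<open>0\<close> if \<open>k < d\<^sub>i\<close>.\<close>

definition in_degree :: "nat^'n \<Rightarrow> nat \<Rightarrow> S^'n \<Rightarrow> bool" where
  "in_degree d k u \<longleftrightarrow> (\<forall>i. u $ i = 0 \<or> (d $ i \<le> k \<and> homogeneous (k - d $ i) (u $ i)))"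

definition graded_hom :: "nat^'m \<Rightarrow> nat^'n \<Rightarrow> (S^'m \<Rightarrow> S^'n) \<Rightarrow> bool" where
  "graded_hom d e \<phi> \<longleftrightarrow> module_hom vector_scalar_mult vector_scalar_mult \<phi> \<and>
     (\<forall>k u. in_degree d k u \<longrightarrow> in_degree e k (\<phi> u))"

definition free_with_exponents :: "S \<Rightarrow> nat \<Rightarrow> nat \<Rightarrow> bool" where
  "free_with_exponents f d1 d2 \<longleftrightarrow> reduced_curve f \<and> d1 \<le> d2 \<and> homogeneous (d1 + d2 + 1) f \<and>
     (\<exists>\<phi> :: S^2 \<Rightarrow> S^3. graded_hom (vector [d1, d2]) 0 \<phi> \<and> bij_betw \<phi> UNIV (AR f))"

definition free_curve :: "S \<Rightarrow> bool" where
  "free_curve f \<longleftrightarrow> (\<exists>d1 d2. free_with_exponents f d1 d2)"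

text \<open>The last two conditions say that the resolution
  \<open>0 \<rightarrow> S(-d2-1) \<rightarrow> S(-d1) \<oplus> S(-d2)\<^sup>2 \<rightarrow> AR(f) \<rightarrow> 0\<close> is minimal (the entries of \<open>\<psi>\<close> lie in the ideal
  \<open>(x,y,z)\<close>) and that none of the three generators is redundant.\<close>

definition nearly_free_with_exponents :: "S \<Rightarrow> nat \<Rightarrow> nat \<Rightarrow> bool" where
  "nearly_free_with_exponents f d1 d2 \<longleftrightarrow> reduced_curve f \<and> d1 \<le> d2 \<and> homogeneous (d1 + d2) f \<and>
     (\<exists>(\<phi> :: S^3 \<Rightarrow> S^3) (\<psi> :: S^1 \<Rightarrow> S^3).
        graded_hom (vector [d1, d2, d2]) 0 \<phi> \<and>
        graded_hom (vector [d2 + 1]) (vector [d1, d2, d2]) \<psi> \<and>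
        inj \<psi> \<and> range \<psi> = {u. \<phi> u = 0} \<and> range \<phi> = AR f \<and>
        (\<forall>u i. coeff3 (\<psi> u $ i) 0 0 0 = 0) \<and>
        (\<forall>i. \<phi> (axis i 1) \<notin> module.span vector_scalar_mult {\<phi> (axis j 1) | j. j \<noteq> i}))"


section \<open>Germs of plane curves\<close>

definition holomorphic2_on :: "(complex \<times> complex \<Rightarrow> complex) \<Rightarrow> (complex \<times> complex) set \<Rightarrow> bool" where
  "holomorphic2_on h U \<longleftrightarrow>
     (\<forall>p\<in>U. \<exists>a b. (h has_derivative (\<lambda>(s, t). a * s + b * t)) (at p))"

definition local_biholomorphism ::
  "(complex \<times> complex) set \<Rightarrow> (complex \<times> complex) set \<Rightarrow> (complex \<times> complex \<Rightarrow> complex \<times> complex) \<Rightarrow> bool" where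
  "local_biholomorphism U V \<phi> \<longleftrightarrow> open U \<and> open V \<and> 0 \<in> U \<and> \<phi> 0 = 0 \<and>
     (\<exists>\<psi>. homeomorphism U V \<phi> \<psi> \<and>
        holomorphic2_on (fst \<circ> \<phi>) U \<and> holomorphic2_on (snd \<circ> \<phi>) U \<and>
        holomorphic2_on (fst \<circ> \<psi>) V \<and> holomorphic2_on (snd \<circ> \<psi>) V)"

text \<open>Up to a holomorphic change of coordinates; as the equation of a curve germ is only determined
  up to a unit, a nowhere vanishing holomorphic factor is allowed.\<close>

definition germ_equiv :: "(complex \<times> complex \<Rightarrow> complex) \<Rightarrow> (complex \<times> complex \<Rightarrow> complex) \<Rightarrow> bool" where
  "germ_equiv g h \<longleftrightarrow> (\<exists>U V \<phi> u. local_biholomorphism U V \<phi> \<and> holomorphic2_on u U \<and>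
     (\<forall>w\<in>U. u w \<noteq> 0 \<and> g (\<phi> w) = u w * h w))"

text \<open>The germ of \<open>g\<close> at \<open>0\<close> has \<open>m\<close> smooth, pairwise transverse branches \<open>{h\<^sub>i = 0}\<close>.
  The unit in the factorization of \<open>g\<close> is absorbed into one of the \<open>h\<^sub>i\<close>.\<close>

definition ordinary_germ :: "nat \<Rightarrow> (complex \<times> complex \<Rightarrow> complex) \<Rightarrow> bool" where
  "ordinary_germ m g \<longleftrightarrow> (\<exists>U (h :: nat \<Rightarrow> complex \<times> complex \<Rightarrow> complex) a b. open U \<and> 0 \<in> U \<and>
     (\<forall>w\<in>U. g w = (\<Prod>i<m. h i w)) \<and>
     (\<forall>i<m. holomorphic2_on (h i) U \<and> h i 0 = 0 \<and>
        (h i has_derivative (\<lambda>(s, t). a i * s + b i * t)) (at 0) \<and> (a i \<noteq> 0 \<or> b i \<noteq> 0)) \<and>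
     (\<forall>i<m. \<forall>j<m. i \<noteq> j \<longrightarrow> a i * b j \<noteq> a j * b i))"

definition weighted_homogeneous :: "nat \<Rightarrow> nat \<Rightarrow> nat \<Rightarrow> complex poly poly \<Rightarrow> bool" where
  "weighted_homogeneous a b d P \<longleftrightarrow> (\<forall>i j. coeff (coeff P i) j \<noteq> 0 \<longrightarrow> a * i + b * j = d)"

definition quasi_homogeneous_germ :: "(complex \<times> complex \<Rightarrow> complex) \<Rightarrow> bool" where
  "quasi_homogeneous_germ g \<longleftrightarrow> (\<exists>a b d P. 0 < a \<and> 0 < b \<and> weighted_homogeneous a b d P \<and>
     germ_equiv g (\<lambda>(s, t). poly (poly P [:s:]) t))"

text \<open>\<open>g\<close> is the equation of \<open>{f = 0}\<close> in an affine chart \<open>(s,t) \<mapsto> [v + s a + t b]\<close> centred at \<open>p\<close>.\<close>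

definition local_equation :: "S \<Rightarrow> (complex^3) set \<Rightarrow> (complex \<times> complex \<Rightarrow> complex) \<Rightarrow> bool" where
  "local_equation f p g \<longleftrightarrow> (\<exists>v a b. p = vec.span {v} \<and> vec.span {v, a, b} = UNIV \<and>
     g = (\<lambda>(s, t). eval f (v + s *s a + t *s b)))"

definition ordinary_point :: "nat \<Rightarrow> S \<Rightarrow> (complex^3) set \<Rightarrow> bool" where
  "ordinary_point m f p \<longleftrightarrow> p \<in> sing_points f \<and> (\<exists>g. local_equation f p g \<and> ordinary_germ m g)"

abbreviation A1_point :: "S \<Rightarrow> (complex^3) set \<Rightarrow> bool" where "A1_point \<equiv> ordinary_point 2"
abbreviation D4_point :: "S \<Rightarrow> (complex^3) set \<Rightarrow> bool" where "D4_point \<equiv> ordinary_point 3"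
abbreviation X9_point :: "S \<Rightarrow> (complex^3) set \<Rightarrow> bool" where "X9_point \<equiv> ordinary_point 4"

definition ordinary_singularities :: "S \<Rightarrow> bool" where
  "ordinary_singularities f \<longleftrightarrow> (\<forall>p\<in>sing_points f. \<exists>m. ordinary_point m f p)"

definition quasi_homogeneous_singularities :: "S \<Rightarrow> bool" where
  "quasi_homogeneous_singularities f \<longleftrightarrow>
     (\<forall>p\<in>sing_points f. \<exists>g. local_equation f p g \<and> quasi_homogeneous_germ g)"


section \<open>Weak combinatorics and the Numerical Terao Conjecture\<close>

text \<open>Singularities are classified up to analytic equivalence, except that all ordinary quadruple
  points are of one type.\<close>

definition same_type :: "S \<Rightarrow> (complex^3) set \<Rightarrow> S \<Rightarrow> (complex^3) set \<Rightarrow> bool" where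
  "same_type f p g q \<longleftrightarrow>
     (\<exists>f' g'. local_equation f p f' \<and> local_equation g q g' \<and> germ_equiv f' g') \<or>
     (X9_point f p \<and> X9_point g q)"

text \<open>A singularity type is represented by a singular point \<open>q\<close> of some reduced curve \<open>h\<close>.\<close>

definition same_weak_combinatorics :: "S \<Rightarrow> S \<Rightarrow> bool" where
  "same_weak_combinatorics f g \<longleftrightarrow>
     (\<forall>k. card (curve_components k f) = card (curve_components k g)) \<and>
     (\<forall>h q. reduced_curve h \<and> q \<in> sing_points h \<longrightarrow>
        card {p \<in> sing_points f. same_type f p h q} = card {p \<in> sing_points g. same_type g p h q})"

text \<open>\<open>W(f) = (l, c; n2 A\<^sub>1 + n3 D\<^sub>4 + n4 X\<^sub>9)\<close>.\<close>

definition weak_combinatorics :: "S \<Rightarrow> nat \<Rightarrow> nat \<Rightarrow> nat \<Rightarrow> nat \<Rightarrow> nat \<Rightarrow> bool" where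
  "weak_combinatorics f l c n2 n3 n4 \<longleftrightarrow> conic_line_arrangement f \<and>
     card (curve_components 1 f) = l \<and> card (curve_components 2 f) = c \<and>
     finite (sing_points f) \<and>
     (\<forall>p\<in>sing_points f. A1_point f p \<or> D4_point f p \<or> X9_point f p) \<and>
     card {p. A1_point f p} = n2 \<and> card {p. D4_point f p} = n3 \<and> card {p. X9_point f p} = n4"

definition numerical_terao_hypotheses :: "S \<Rightarrow> S \<Rightarrow> bool" where
  "numerical_terao_hypotheses f g \<longleftrightarrow>
     reduced_curve f \<and> smooth_components f \<and> quasi_homogeneous_singularities f \<and>
     reduced_curve g \<and> smooth_components g \<and> quasi_homogeneous_singularities g \<and>
     same_weak_combinatorics f g \<and> free_curve f"

definition numerical_terao_conjecture :: bool where
  "numerical_terao_conjecture \<longleftrightarrow> (\<forall>f g. numerical_terao_hypotheses f g \<longrightarrow> free_curve g)"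

definition numerical_terao_counterexample :: "S \<Rightarrow> S \<Rightarrow> bool" where
  "numerical_terao_counterexample f g \<longleftrightarrow> numerical_terao_hypotheses f g \<and> \<not> free_curve g"

end

theory Submission
  imports Defs "HOL-Computational_Algebra.Field_as_Ring"
begin

text \<open>Both curves consist of seven lines and a smooth conic. The proof has an algebraic part, about
  syzygies, and a local analytic part, about the types of the singular points.

  \<^emph>\<open>Syzygies.\<close> Let \<open>f\<close> be a square-free form. Its partial derivatives have no common prime factor
  (\<open>squarefree_gradient_primitive\<close>): by Euler's formula such a factor \<open>p\<close> would divide \<open>f\<close>, hence, \<open>f\<close>
  being square-free, the partial derivatives of \<open>p\<close> itself, which have smaller degree. If \<open>r\<close> and \<open>s\<close>
  are syzygies of \<open>\<nabla>f\<close>, then \<open>r \<times> s\<close> is parallel to \<open>\<nabla>f\<close>, so that \<open>r \<times> s = w \<nabla>f\<close> for a polynomial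
  \<open>w\<close> (\<open>AR_cross\<close>). If the degrees of \<open>r\<close> and \<open>s\<close> add up to \<open>deg f - 1\<close>, then \<open>w\<close> is a constant, and
  if it is not zero, Cramer's rule shows that \<open>r\<close> and \<open>s\<close> form a basis of \<open>AR(f)\<close>
  (\<open>free_with_exponentsI\<close>). Two explicit syzygies of degree 4 thus prove that \<open>F\<close> is free.

  For \<open>G\<close> there is an explicit syzygy \<open>r1\<close> of degree 3, and \<open>AR(G)\<close> is read off from the cofactors \<open>w\<close>
  in \<open>r1 \<times> r = w \<nabla>G\<close>. The syzygy \<open>r1\<close> vanishes at the point \<open>[2 : 2 : 3]\<close>, which is a smooth point of
  the curve on its line \<open>x = y\<close>; therefore all cofactors vanish there. Two syzygies \<open>r2\<close> and \<open>r3\<close> of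
  degree 6 have linearly independent linear forms \<open>l2\<close> and \<open>l3\<close> as cofactors, and these generate the
  ideal of the point. A syzygy of degree \<open>k\<close> has a cofactor of degree \<open>k - 5\<close>; if \<open>k < 6\<close>, the cofactor
  must be 0, and the syzygy is a multiple of \<open>r1\<close>. Hence \<open>mdr(G) = 3\<close>, and \<open>G\<close> is not free because the
  degrees of a basis would add up to 8. Moreover \<open>r1\<close>, \<open>r2\<close>, \<open>r3\<close> generate \<open>AR(G)\<close>, and their relations
  are the multiples of a single one \<open>(q, l3, - l2)\<close>: the curve is nearly free.

  \<^emph>\<open>Singular points.\<close> These are the points on two of the components. Every line meets every other line
  in a listed point and the conic in two listed points, so that the lists are complete
  (\<open>sing_points_subset\<close>). At each of them the curve is equivalent to a product of 2, 3 or 4 pairwise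
  independent linear forms. If the conic passes through the point \<open>[v]\<close>, the chart \<open>[v + s a + t b]\<close> is
  chosen with \<open>[a]\<close> and \<open>[b]\<close> on the conic, such that the lines through \<open>[v]\<close> are among \<open>s = 0\<close>, \<open>t = 0\<close>
  and \<open>s = t\<close>. The conic then has the equation \<open>A s + B t + c (A + B) s t = 0\<close>, and the coordinate change
  \<open>(s, t) \<mapsto> (s / (1 - c s), t / (1 - c t))\<close> replaces it by \<open>A s + B t = 0\<close> and maps each of these three
  lines to itself (\<open>normal_pointI\<close>). The number of branches of an ordinary germ is an invariant, and
  products of two or three independent linear forms are equivalent to \<open>s t\<close> or \<open>s t (s - t)\<close>. As
  quadruple points all count as one type, the types of the singular points are determined by
  the numbers of branches, and both curves have the same weak combinatorics.\<close>

section \<open>Arithmetic in the polynomial ring\<close>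


lemma eval_simps [simp]:
  "eval 0 v = 0" "eval 1 v = 1" "eval (numeral n) v = numeral n"
  "eval (f + g) v = eval f v + eval g v" "eval (f - g) v = eval f v - eval g v"
  "eval (- f) v = - eval f v" "eval (f * g) v = eval f v * eval g v"
  "eval (f ^ k) v = eval f v ^ k"
  "eval varx v = v $ 1" "eval vary v = v $ 2" "eval varz v = v $ 3" "eval (cst c) v = c"
  by (simp_all add: eval_def varx_def vary_def varz_def cst_def)

lemma cst_simps:
  "cst 0 = 0" "cst 1 = 1" "cst (a + b) = cst a + cst b" "cst (a - b) = cst a - cst b"
  "cst (- a) = - cst a" "cst (a * b) = cst a * cst b"
  by (simp_all add: cst_def one_pCons)

lemma cst_eq_0_iff [simp]: "cst c = 0 \<longleftrightarrow> c = 0"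
  by (simp add: cst_def)

lemma coeff3_simps [simp]:
  "coeff3 0 i j k = 0" "coeff3 (f + g) i j k = coeff3 f i j k + coeff3 g i j k"
  "coeff3 (f - g) i j k = coeff3 f i j k - coeff3 g i j k" "coeff3 (- f) i j k = - coeff3 f i j k"
  by (simp_all add: coeff3_def)

lemma S_eqI: "(\<And>i j k. coeff3 f i j k = coeff3 g i j k) \<Longrightarrow> f = g"
  unfolding coeff3_def by (intro poly_eqI)

lemma coeff3_var_mult:
  "coeff3 (varx * f) i j k = (if i = 0 then 0 else coeff3 f (i - 1) j k)"
  "coeff3 (vary * f) i j k = (if j = 0 then 0 else coeff3 f i (j - 1) k)"
  "coeff3 (varz * f) i j k = (if k = 0 then 0 else coeff3 f i j (k - 1))"
  by (auto simp: coeff3_def varx_def vary_def varz_def coeff_pCons split: nat.splits)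

lemma coeff3_cst: "coeff3 (cst c) i j k = (if i = 0 \<and> j = 0 \<and> k = 0 then c else 0)"
  by (auto simp: coeff3_def cst_def coeff_pCons split: nat.splits)

lemma coeff3_cst_mult: "coeff3 (cst c * f) i j k = c * coeff3 f i j k"
  by (simp add: coeff3_def cst_def)


section \<open>Partial derivatives\<close>

lemma derivation_map_poly:
  fixes D :: "'a::comm_ring_1 \<Rightarrow> 'a"
  assumes D: "D 0 = 0" "\<And>a b. D (a + b) = D a + D b" "\<And>a b. D (a * b) = D a * b + a * D b"
  shows "map_poly D 0 = 0" "map_poly D (p + q) = map_poly D p + map_poly D q"
    "map_poly D (p * q) = map_poly D p * q + p * map_poly D q"
proof -
  have sum: "D (sum g A) = (\<Sum>i\<in>A. D (g i))" for g :: "nat \<Rightarrow> 'a" and A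
    by (induction A rule: infinite_finite_induct) (simp_all add: D)
  show "map_poly D 0 = 0" by simp
  show "map_poly D (p + q) = map_poly D p + map_poly D q"
    by (rule poly_eqI) (simp add: coeff_map_poly D)
  show "map_poly D (p * q) = map_poly D p * q + p * map_poly D q"
    by (rule poly_eqI) (simp add: coeff_map_poly D coeff_mult sum sum.distrib)
qed

lemma dx_simps: "dx (f + g) = dx f + dx g" "dx (f * g) = dx f * g + f * dx g"
  by (simp_all add: dx_def pderiv_add pderiv_mult)

lemma dy_simps: "dy (f + g) = dy f + dy g" "dy (f * g) = dy f * g + f * dy g"
  unfolding dy_def by (rule derivation_map_poly; simp add: pderiv_add pderiv_mult)+

lemma dz_simps: "dz (f + g) = dz f + dz g" "dz (f * g) = dz f * g + f * dz g"
  unfolding dz_def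
  by (rule derivation_map_poly; (rule derivation_map_poly)?; simp add: pderiv_add pderiv_mult)+

lemma coeff3_partials:
  "coeff3 (dx f) i j k = of_nat (Suc i) * coeff3 f (Suc i) j k"
  "coeff3 (dy f) i j k = of_nat (Suc j) * coeff3 f i (Suc j) k"
  "coeff3 (dz f) i j k = of_nat (Suc k) * coeff3 f i j (Suc k)"
proof -
  have of_nat_coeff: "coeff (of_nat n * p) i = of_nat n * coeff p i" for n i and p :: "'a::comm_ring_1 poly"
    by (simp add: of_nat_poly)
  show "coeff3 (dx f) i j k = of_nat (Suc i) * coeff3 f (Suc i) j k"
    unfolding coeff3_def dx_def coeff_pderiv of_nat_coeff ..
  show "coeff3 (dy f) i j k = of_nat (Suc j) * coeff3 f i (Suc j) k"
    by (simp only: coeff3_def dy_def coeff_map_poly pderiv_0 coeff_pderiv of_nat_coeff)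
  show "coeff3 (dz f) i j k = of_nat (Suc k) * coeff3 f i j (Suc k)"
    by (simp only: coeff3_def dz_def coeff_map_poly pderiv_0 map_poly_0 coeff_pderiv of_nat_coeff)
qed

lemma partials_var [simp]:
  "dx varx = 1" "dx vary = 0" "dx varz = 0" "dx (cst c) = 0"
  "dy varx = 0" "dy vary = 1" "dy varz = 0" "dy (cst c) = 0"
  "dz varx = 0" "dz vary = 0" "dz varz = 1" "dz (cst c) = 0"
  by (simp_all add: dx_def dy_def dz_def varx_def vary_def varz_def cst_def pderiv_pCons
      map_poly_pCons one_pCons)

lemma partials_0_1 [simp]: "dx 0 = 0" "dy 0 = 0" "dz 0 = 0" "dx 1 = 0" "dy 1 = 0" "dz 1 = 0"
  by (simp_all add: dx_def dy_def dz_def map_poly_pCons one_pCons pderiv_pCons)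


section \<open>Homogeneous forms\<close>

text \<open>Evaluation of polynomials over \<open>'a\<close> at \<open>X\<close>, with the coefficients mapped by the ring
  homomorphism \<open>h\<close>, is again a ring homomorphism. It is applied once for each of the three variables.\<close>

lemma ring_hom_extend:
  fixes h :: "'a::comm_ring_1 \<Rightarrow> 'b::comm_ring_1" and X :: 'b
  assumes h: "h 0 = 0" "\<And>a b. h (a + b) = h a + h b" "\<And>a b. h (a * b) = h a * h b"
  defines "L \<equiv> \<lambda>p. poly (map_poly h p) X"
  shows "L 0 = 0" "L (pCons a p) = h a + X * L p" "L (p + q) = L p + L q" "L (p * q) = L p * L q"
proof -
  show L0: "L 0 = 0" by (simp add: L_def)
  have L_pCons: "L (pCons a p) = h a + X * L p" for a p
    by (simp add: L_def map_poly_pCons h)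
  then show "L (pCons a p) = h a + X * L p" .
  have L_add: "L (p + q) = L p + L q" for p q
    by (induction p q rule: poly_induct2) (simp_all add: L0 L_pCons h algebra_simps)
  then show "L (p + q) = L p + L q" .
  have L_smult: "L (smult a p) = h a * L p" for a p
    by (induction p) (simp_all add: L0 L_pCons h algebra_simps)
  show "L (p * q) = L p * L q"
    by (induction p) (simp_all add: L0 L_pCons L_add L_smult h algebra_simps)
qed

text \<open>The substitution \<open>f(x, y, z) \<mapsto> f(x T, y T, z T)\<close> as a ring homomorphism \<open>grading\<close> into \<open>S[T]\<close>, built
  up in three steps: the first one treats constants, the next two polynomials in \<open>z\<close> and in \<open>y\<close> and \<open>z\<close>.
  The coefficient of \<open>T\<^sup>e\<close> in \<open>grading f\<close> is the part of \<open>f\<close> of degree \<open>e\<close>; so \<open>f\<close> is homogeneous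
  if and only if \<open>grading f\<close> is a monomial in \<open>T\<close>.\<close>

definition homogenize0 :: "complex \<Rightarrow> S poly" where "homogenize0 c = [:cst c:]"
definition homogenize1 :: "complex poly \<Rightarrow> S poly" where
  "homogenize1 p = poly (map_poly homogenize0 p) [:0, varz:]"
definition homogenize2 :: "complex poly poly \<Rightarrow> S poly" where
  "homogenize2 p = poly (map_poly homogenize1 p) [:0, vary:]"
definition grading :: "S \<Rightarrow> S poly" where
  "grading p = poly (map_poly homogenize2 p) [:0, varx:]"

lemma homogenize0_hom: "homogenize0 0 = 0" "homogenize0 (a + b) = homogenize0 a + homogenize0 b"
  "homogenize0 (a * b) = homogenize0 a * homogenize0 b"
  by (simp_all add: homogenize0_def cst_simps)

lemmas homogenize1_hom = ring_hom_extend[where h = homogenize0 and X = "[:0, varz:]", OF homogenize0_hom,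
    folded homogenize1_def]
lemmas homogenize2_hom = ring_hom_extend[where h = homogenize1 and X = "[:0, vary:]",
    OF homogenize1_hom(1,3,4), folded homogenize2_def]
lemmas grading_hom = ring_hom_extend[where h = homogenize2 and X = "[:0, varx:]",
    OF homogenize2_hom(1,3,4), folded grading_def]

lemma coeff3_grading:
  "coeff3 (coeff (grading f) e) i j k = (if e = i + j + k then coeff3 f i j k else 0)"
proof -
  have shift: "coeff ([:0, c:] * q) e = (if e = 0 then 0 else c * coeff q (e - 1))"
    for c :: S and q e by (auto simp: coeff_pCons split: nat.splits)
  have 1: "coeff3 (coeff (homogenize1 p) e) i j k = (if i = 0 \<and> j = 0 \<and> e = k then coeff p k else 0)"
    for p e i j k
  proof (induction p arbitrary: e i j k)
    case (pCons a p)
    show ?case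
      by (cases e; cases k) (simp_all del: mult_pCons_left
          add: homogenize1_hom homogenize0_def shift coeff3_var_mult coeff3_cst pCons.IH)
  qed (simp add: homogenize1_hom)
  have 2: "coeff3 (coeff (homogenize2 p) e) i j k = (if i = 0 \<and> e = j + k then coeff (coeff p j) k else 0)"
    for p e i j k
  proof (induction p arbitrary: e i j k)
    case (pCons a p)
    show ?case
      by (cases e; cases j) (simp_all del: mult_pCons_left
          add: homogenize2_hom 1 shift coeff3_var_mult pCons.IH)
  qed (simp add: homogenize2_hom)
  have "coeff3 (coeff (grading f) e) i j k = (if e = i + j + k then coeff (coeff (coeff f i) j) k else 0)"
  proof (induction f arbitrary: e i j k)
    case (pCons a p)
    show ?case
      by (cases e; cases i) (simp_all del: mult_pCons_left
          add: grading_hom 2 shift coeff3_var_mult pCons.IH)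
  qed (simp add: grading_hom)
  then show ?thesis by (simp add: coeff3_def)
qed

lemma homogeneous_iff_grading: "homogeneous d f \<longleftrightarrow> grading f = monom f d"
proof
  assume *: "homogeneous d f"
  show "grading f = monom f d"
    by (intro poly_eqI S_eqI) (use * in \<open>auto simp: coeff3_grading homogeneous_def coeff_monom\<close>)
next
  assume *: "grading f = monom f d"
  show "homogeneous d f"
    unfolding homogeneous_def
  proof (intro allI impI)
    fix i j k assume "coeff3 f i j k \<noteq> 0"
    then have "coeff3 (coeff (monom f d) (i + j + k)) i j k \<noteq> 0"
      unfolding *[symmetric] coeff3_grading by simp
    then show "i + j + k = d" by (auto simp: coeff_monom split: if_splits)
  qed
qed

lemma grading_eq_0_iff: "grading f = 0 \<longleftrightarrow> f = 0"
proof
  assume *: "grading f = 0"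
  show "f = 0"
  proof (rule S_eqI)
    fix i j k
    show "coeff3 f i j k = coeff3 0 i j k"
      using coeff3_grading[of f "i + j + k" i j k] * by simp
  qed
qed (simp add: grading_hom)

lemma homogeneous_0 [simp]: "homogeneous d 0"
  by (simp add: homogeneous_def)

lemma homogeneous_add: "homogeneous d f \<Longrightarrow> homogeneous d g \<Longrightarrow> homogeneous d (f + g)"
  by (auto simp: homogeneous_iff_grading grading_hom add_monom)

lemma homogeneous_diff: "homogeneous d f \<Longrightarrow> homogeneous d g \<Longrightarrow> homogeneous d (f - g)"
  unfolding homogeneous_def by simp (metis diff_self)

lemma homogeneous_minus: "homogeneous d f \<Longrightarrow> homogeneous d (- f)"
  by (simp add: homogeneous_def)

lemma homogeneous_mult: "homogeneous a f \<Longrightarrow> homogeneous b g \<Longrightarrow> homogeneous (a + b) (f * g)"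
  by (simp add: homogeneous_iff_grading grading_hom mult_monom)

lemma homogeneous_cst [simp]: "homogeneous 0 (cst c)"
  by (simp add: homogeneous_def coeff3_cst)

lemma homogeneous_var [simp]: "homogeneous (Suc 0) varx" "homogeneous (Suc 0) vary" "homogeneous (Suc 0) varz"
  using coeff3_var_mult[of 1] coeff3_cst[of 1]
  by (auto simp: homogeneous_def cst_simps split: if_splits)

lemma homogeneous_unique: "homogeneous a f \<Longrightarrow> homogeneous b f \<Longrightarrow> f \<noteq> 0 \<Longrightarrow> a = b"
  unfolding homogeneous_def by (metis S_eqI coeff3_simps(1))

lemma homogeneous_dvd_degree:
  assumes "homogeneous a f" "homogeneous b g" "f dvd g" "g \<noteq> 0"
  shows "a \<le> b"
proof -
  from assms obtain h where h: "g = f * h" by auto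
  have "grading f dvd grading g" unfolding h by (simp add: grading_hom)
  then have "degree (grading f) \<le> degree (grading g)"
    using assms(4) by (intro dvd_imp_degree_le) (simp_all add: grading_eq_0_iff)
  moreover have "f \<noteq> 0" using h assms(4) by auto
  ultimately show ?thesis
    using assms by (simp add: homogeneous_iff_grading degree_monom_eq)
qed

text \<open>A factor of a monomial is a monomial, as its order at 0 equals its degree.\<close>

lemma monom_factor:
  fixes p q :: "'a::idom poly"
  assumes pq: "p * q = monom c n" and c: "c \<noteq> 0"
  obtains a m b l where "p = monom a m" "q = monom b l" "m + l = n"
proof -
  have monomI: "p = monom (lead_coeff p) (degree p)" if "degree p \<le> order 0 p" "p \<noteq> 0" for p :: "'a poly"
  proof -
    have "[:0, 1:] ^ degree p dvd p"
      using order_1[of 0 p] that(1) by (metis dvd_trans le_imp_power_dvd minus_zero)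
    then obtain r where r: "p = [:0, 1:] ^ degree p * r" by auto
    then have "r \<noteq> 0" using that by auto
    have "degree p = degree p + degree r"
      by (subst r, subst degree_mult_eq) (use \<open>r \<noteq> 0\<close> in \<open>auto simp: degree_power_eq\<close>)
    then obtain d where "r = [:d:]" using degree_eq_zeroE by auto
    then have *: "p = monom d (degree p)" using r by (simp add: monom_altdef)
    show ?thesis by (subst *, subst * ) (metis * degree_monom_eq coeff_monom monom_eq_0 that(2) lead_coeff_monom)
  qed
  have nz: "p \<noteq> 0" "q \<noteq> 0" using pq c by (auto simp: monom_eq_0_iff)
  have "order 0 (monom c n) = n"
    using c order_power_n_n[of "0::'a" n] by (simp add: monom_altdef order_smult)
  then have o: "order 0 p + order 0 q = n" using pq nz by (metis mult_eq_0_iff order_mult)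
  have d: "degree p + degree q = n" using pq nz c by (metis degree_mult_eq degree_monom_eq)
  have "order 0 p \<le> degree p" "order 0 q \<le> degree q" using nz by (auto simp: order_degree)
  then show ?thesis using o d nz by (intro that[of "lead_coeff p" "degree p" "lead_coeff q" "degree q"] monomI) auto
qed

text \<open>The factors of a form are forms, because those of the monomial \<open>grading (f * g)\<close> are monomials.\<close>

lemma homogeneous_factor:
  assumes "homogeneous d (f * g)" "f * g \<noteq> 0"
  obtains a b where "homogeneous a f" "homogeneous b g" "a + b = d"
proof -
  have "grading f * grading g = monom (f * g) d"
    using assms(1) by (simp add: homogeneous_iff_grading grading_hom)
  then obtain a m b l where m: "grading f = monom a m" "grading g = monom b l" "m + l = d"
    using monom_factor assms(2) by blast
  have "homogeneous m f" if "grading f = monom a m" for f a m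
    unfolding homogeneous_def
  proof (intro allI impI)
    fix i j k assume "coeff3 f i j k \<noteq> 0"
    then have "coeff3 (coeff (monom a m) (i + j + k)) i j k \<noteq> 0"
      unfolding that[symmetric] coeff3_grading by simp
    then show "i + j + k = m" by (auto simp: coeff_monom split: if_splits)
  qed
  then show ?thesis using that m by blast
qed

lemma homogeneous_0D: "homogeneous 0 f \<Longrightarrow> f = cst (coeff3 f 0 0 0)"
  by (rule S_eqI) (auto simp: coeff3_cst homogeneous_def)

lemma is_unit_cst: "c \<noteq> 0 \<Longrightarrow> is_unit (cst c)"
  by (metis cst_simps(2,6) dvdI right_inverse)

lemma is_unit_S:
  assumes "is_unit f"
  obtains c where "f = cst c" "c \<noteq> 0"
proof -
  from assms obtain g where g: "f * g = 1" by (metis dvdE)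
  have "homogeneous 0 (f * g)" using g cst_simps(2) by (metis homogeneous_cst)
  then obtain a b where "homogeneous a f" "a + b = 0"
    by (rule homogeneous_factor) (use g in auto)
  then have "f = cst (coeff3 f 0 0 0)" using homogeneous_0D by simp
  moreover have "f \<noteq> 0" using g by auto
  ultimately show ?thesis using that by (metis cst_simps(1))
qed

lemma eval_homogeneous:
  assumes "homogeneous d f" shows "eval f (c *s v) = c ^ d * eval f v"
proof -
  have 1: "poly (poly (poly p [:[:c * v $ 1:]:]) [:c * v $ 2:]) (c * v $ 3)
    = eval (poly (grading p) (cst c)) v" for p
  proof -
    \<comment> \<open>setting \<open>T = c\<close> in \<open>grading\<close> scales the variables by \<open>c\<close>\<close>
    have h1: "eval (poly (homogenize1 p) (cst c)) v = poly p (c * v $ 3)" for p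
      by (induction p) (simp_all add: homogenize1_hom homogenize0_def)
    have h2: "eval (poly (homogenize2 p) (cst c)) v = poly (poly p [:c * v $ 2:]) (c * v $ 3)" for p
      by (induction p) (simp_all add: homogenize2_hom h1)
    show ?thesis
      by (induction p) (simp_all add: grading_hom h2)
  qed
  then have "eval f (c *s v) = eval (poly (grading f) (cst c)) v" by (simp add: eval_def)
  also have "grading f = monom f d" using assms by (simp add: homogeneous_iff_grading)
  finally show ?thesis by (simp add: poly_monom)
qed

lemma homogeneous_partials:
  assumes "homogeneous (Suc d) f"
  shows "homogeneous d (dx f)" "homogeneous d (dy f)" "homogeneous d (dz f)"
proof -
  have "coeff3 f i j k = 0" if "i + j + k \<noteq> Suc d" for i j k
    using assms that by (auto simp: homogeneous_def)
  then have *: "coeff3 f (Suc i) j k = 0" "coeff3 f i (Suc j) k = 0" "coeff3 f i j (Suc k) = 0"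
    if "i + j + k \<noteq> d" for i j k
    using that by simp_all
  show "homogeneous d (dx f)" "homogeneous d (dy f)" "homogeneous d (dz f)"
    unfolding homogeneous_def coeff3_partials using * by (metis mult_zero_right)+
qed

lemma euler:
  assumes "homogeneous d f"
  shows "varx * dx f + vary * dy f + varz * dz f = of_nat d * f"
proof (rule S_eqI)
  fix i j k
  have "coeff3 (of_nat d * f) i j k = of_nat d * coeff3 f i j k"
    by (simp add: coeff3_def of_nat_poly)
  moreover have "coeff3 f i j k = 0 \<or> d = i + j + k" using assms by (auto simp: homogeneous_def)
  ultimately show "coeff3 (varx * dx f + vary * dy f + varz * dz f) i j k = coeff3 (of_nat d * f) i j k"
    by (cases i; cases j; cases k) (auto simp: coeff3_var_mult coeff3_partials algebra_simps)
qed


section \<open>The gradient of a square-free form is primitive\<close>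

lemma squarefree_gradient_primitive:
  assumes f: "squarefree f" "homogeneous (Suc d) f" and p: "prime_elem p"
    and dvd: "p dvd dx f" "p dvd dy f" "p dvd dz f"
  shows False
proof -
  have f0: "f \<noteq> 0" using f(1) by auto
  have u: "is_unit (of_nat (Suc n) :: S)" for n
  proof -
    have "(of_nat (Suc n) :: S) = cst (of_nat (Suc n))" by (simp add: cst_def of_nat_poly)
    then show ?thesis using is_unit_cst of_nat_neq_0 by metis
  qed
  have "p dvd of_nat (Suc d) * f" unfolding euler[OF f(2), symmetric] using dvd by simp
  then have "p dvd f" using u p by (metis dvd_mult_unit_iff' mult.commute)
  then obtain g where g: "f = p * g" by auto
  have pg: "\<not> p dvd g"
  proof
    assume "p dvd g"
    then have "p ^ 2 dvd f" unfolding g power2_eq_square by (rule mult_dvd_mono[OF dvd_refl])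
    then have "is_unit p" using f(1) squarefreeD by blast
    then show False using p by auto
  qed
  obtain a b where a: "homogeneous a p" using homogeneous_factor[of "Suc d" p g] f(2) f0 g by metis
  have p0: "p \<noteq> 0" using p by auto
  have "a \<noteq> 0"
    using homogeneous_0D a p0 p is_unit_cst cst_simps(1) by (metis prime_elem_not_unit)
  then obtain a' where a': "a = Suc a'" by (cases a) auto
  have small: "h = 0" if "p dvd h" "homogeneous a' h" for h
    using homogeneous_dvd_degree[OF a that(2,1)] a' by auto
  \<comment> \<open>a factor \<open>p\<close> of a derivative \<open>dx (p * g) = dx p * g + p * dx g\<close> divides \<open>dx p\<close>\<close>
  have h: "p dvd q" if "p dvd q * g + p * r" for q r
    using that pg p by (metis dvd_add_left_iff dvd_triv_left prime_elem_dvd_mult_iff)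
  have "dx p = 0" "dy p = 0" "dz p = 0"
    using dvd homogeneous_partials[OF a[unfolded a']] unfolding g dx_simps dy_simps dz_simps
    by (auto intro!: small dest: h)
  then have "of_nat a * p = 0" using euler[OF a] by simp
  then show False using p0 u[of a'] unfolding a' by auto
qed


section \<open>Syzygies of the gradient\<close>

text \<open>The vector product. The entries are numbers, when it is applied to points of \<open>\<complex>\<^sup>3\<close>, or polynomials.\<close>

definition cross :: "'a::comm_ring_1^3 \<Rightarrow> 'a^3 \<Rightarrow> 'a^3" where
  "cross u v = vector [u $ 2 * v $ 3 - u $ 3 * v $ 2, u $ 3 * v $ 1 - u $ 1 * v $ 3,
     u $ 1 * v $ 2 - u $ 2 * v $ 1]"

text \<open>The gradient of \<open>f\<close>, of which the elements of \<open>AR(f)\<close> are the syzygies.\<close>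

definition grad :: "S \<Rightarrow> S^3" where "grad f = vector [dx f, dy f, dz f]"

lemma cross_nth [simp]:
  "cross u v $ 1 = u $ 2 * v $ 3 - u $ 3 * v $ 2" "cross u v $ 2 = u $ 3 * v $ 1 - u $ 1 * v $ 3"
  "cross u v $ 3 = u $ 1 * v $ 2 - u $ 2 * v $ 1"
  by (simp_all add: cross_def)

lemma grad_nth [simp]: "grad f $ 1 = dx f" "grad f $ 2 = dy f" "grad f $ 3 = dz f"
  by (simp_all add: grad_def)

lemma cross_bilinear:
  "cross (u + v) w = cross u w + cross v w" "cross u (v + w) = cross u v + cross u w"
  "cross u (v - w) = cross u v - cross u w"
  "cross (c *s u) v = c *s cross u v" "cross u (c *s v) = c *s cross u v" "cross u u = 0"
  "cross u 0 = 0"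
  by (simp_all add: vec_eq_iff forall_3 algebra_simps)

lemma smult_eq_0_iff: "c *s v = 0 \<longleftrightarrow> c = 0 \<or> v = 0" for c :: "'a::idom" and v :: "'a^'n"
  by (auto simp: vec_eq_iff)

lemma homogeneous_grad: "homogeneous (Suc d) f \<Longrightarrow> homogeneous d (grad f $ i)"
  using homogeneous_partials exhaust_3[of i] by fastforce

lemma homogeneous_cross:
  assumes "\<And>i. homogeneous a (u $ i)" "\<And>i. homogeneous b (v $ i)"
  shows "homogeneous (a + b) (cross u v $ i)"
  using exhaust_3[of i] assms homogeneous_mult homogeneous_diff by auto

lemma grad_nonzero:
  assumes "homogeneous (Suc d) f" "f \<noteq> 0"
  shows "grad f \<noteq> 0"
proof
  assume "grad f = 0"
  then have "dx f = 0" "dy f = 0" "dz f = 0" by (simp_all add: vec_eq_iff forall_3)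
  then have "of_nat (Suc d) * f = 0" using euler[OF assms(1)] by simp
  then show False using assms(2) by (metis mult_eq_0_iff of_nat_eq_0_iff nat.distinct(1))
qed

lemma dvd_mult_gcd:
  fixes a b c x :: S
  assumes "x dvd c * a" "x dvd c * b"
  shows "x dvd c * gcd a b"
  using gcd_greatest[OF assms] by (simp add: gcd_mult_left)

text \<open>Over a factorial ring a vector that is parallel to a primitive one is a multiple of it.\<close>

lemma parallel_to_primitive:
  fixes m w :: "S^3"
  assumes m: "m \<noteq> 0" and prim: "\<And>p. prime_elem p \<Longrightarrow> (\<And>i. p dvd m $ i) \<Longrightarrow> False"
    and cross: "cross w m = 0"
  obtains p where "w = p *s m"
proof -
  obtain k where k: "m $ k \<noteq> 0" using m by (auto simp: vec_eq_iff)
  have eq: "w $ i * m $ j = w $ j * m $ i" for i j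
    using cross exhaust_3[of i] exhaust_3[of j] by (auto simp: vec_eq_iff forall_3)
  define g where "g = gcd (m $ 1) (gcd (m $ 2) (m $ 3))"
  have g: "g dvd m $ i" for i
    using exhaust_3[of i] by (auto simp: g_def intro: dvd_trans[OF gcd_dvd2])
  have "g \<noteq> 0" using g[of k] k by auto
  have "is_unit g"
  proof (rule ccontr)
    assume "\<not> is_unit g"
    then obtain p where p: "p dvd g" "prime p" using \<open>g \<noteq> 0\<close> prime_divisor_exists by blast
    then show False using prim[of p] g by (meson dvd_trans prime_def)
  qed
  have "m $ k dvd w $ k * m $ j" for j using eq[of k j] by simp
  then have "m $ k dvd w $ k * g" unfolding g_def by (intro dvd_mult_gcd)
  then have "m $ k dvd w $ k" using \<open>is_unit g\<close> by (metis dvd_mult_unit_iff)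
  then obtain p where p: "w $ k = m $ k * p" by auto
  have "w $ j = p * m $ j" for j
  proof -
    have "w $ j * m $ k = (p * m $ j) * m $ k" using eq[of j k] p by (simp add: algebra_simps)
    then show ?thesis using k by simp
  qed
  then show ?thesis by (intro that[of p]) (simp add: vec_eq_iff)
qed

lemma AR_iff: "r \<in> AR f \<longleftrightarrow> r $ 1 * grad f $ 1 + r $ 2 * grad f $ 2 + r $ 3 * grad f $ 3 = 0"
  by (simp add: AR_def)

lemma AR_closed:
  "0 \<in> AR f" "r \<in> AR f \<Longrightarrow> s \<in> AR f \<Longrightarrow> r + s \<in> AR f" "r \<in> AR f \<Longrightarrow> s \<in> AR f \<Longrightarrow> r - s \<in> AR f"
  "r \<in> AR f \<Longrightarrow> c *s r \<in> AR f"
proof -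
  show "0 \<in> AR f" by (simp add: AR_def)
  show "r + s \<in> AR f" "r - s \<in> AR f" if "r \<in> AR f" "s \<in> AR f"
    using that unfolding AR_def mem_Collect_eq vector_add_component vector_minus_component
    by algebra+
  show "c *s r \<in> AR f" if "r \<in> AR f"
  proof -
    have "c * (r $ 1 * dx f + r $ 2 * dy f + r $ 3 * dz f) = 0" using that by (simp add: AR_def)
    then show ?thesis by (simp add: AR_def algebra_simps)
  qed
qed

text \<open>Both syzygies are orthogonal to the gradient, so their vector product is parallel to it.\<close>

lemma AR_cross:
  assumes f: "squarefree f" "homogeneous (Suc d) f" and r: "r \<in> AR f" "s \<in> AR f"
  obtains w where "cross r s = w *s grad f"
proof (rule parallel_to_primitive[where m = "grad f" and w = "cross r s"])
  have "f \<noteq> 0" using f(1) by auto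
  then show "grad f \<noteq> 0" using f grad_nonzero by blast
  show False if "prime_elem p" "\<And>i. p dvd grad f $ i" for p
    using squarefree_gradient_primitive[OF f that(1)] that(2) by (metis grad_nth)
  show "cross (cross r s) (grad f) = 0"
    using r unfolding AR_iff vec_eq_iff forall_3 cross_nth zero_index
    by (safe; algebra)
qed (rule that)

text \<open>The factor between two vectors of forms is a form, of the difference of the degrees.\<close>

lemma homogeneous_cofactor:
  assumes "w *s m = u" "\<And>i. homogeneous a (u $ i)" "\<And>i. homogeneous b (m $ i)" "m \<noteq> 0" "w \<noteq> 0"
  obtains c where "homogeneous c w" "a = b + c"
proof -
  obtain k where k: "m $ k \<noteq> 0" using assms(4) by (auto simp: vec_eq_iff)
  have "homogeneous a (w * m $ k)" using assms(1,2) by (metis vector_smult_component)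
  then obtain c b' where c: "homogeneous c w" "homogeneous b' (m $ k)" "c + b' = a"
    using homogeneous_factor k assms(5) by (metis mult_eq_0_iff)
  then have "b' = b" using homogeneous_unique[OF _ assms(3)] k by blast
  then show ?thesis using that c by auto
qed

lemma in_degree_mult:
  assumes "u = 0 \<or> (d \<le> k \<and> homogeneous (k - d) u)" "homogeneous d r"
  shows "homogeneous k (u * r)"
  using assms homogeneous_mult[of "k - d" u d r] by auto

lemma module_scalar_mult: "module (vector_scalar_mult :: 'a::comm_ring_1 \<Rightarrow> 'a^'n \<Rightarrow> 'a^'n)"
  by unfold_locales (simp_all add: vec_eq_iff algebra_simps)

lemma reduced_curveI: "squarefree f \<Longrightarrow> homogeneous (Suc d) f \<Longrightarrow> reduced_curve f"
  unfolding reduced_curve_def by blast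


section \<open>Free curves\<close>

text \<open>Saito's criterion: as \<open>d1 + d2\<close> is the degree of the gradient, \<open>r1 \<times> r2\<close> is a constant multiple
  of the gradient. If the constant is not zero, the coordinates of any syzygy with respect to \<open>r1\<close> and
  \<open>r2\<close> are obtained from Cramer's rule by dividing by it.\<close>

lemma free_with_exponentsI:
  assumes f: "squarefree f" "homogeneous (d1 + d2 + 1) f" and le: "d1 \<le> d2"
    and r: "r1 \<in> AR f" "r2 \<in> AR f"
    and hom: "\<And>i. homogeneous d1 (r1 $ i)" "\<And>i. homogeneous d2 (r2 $ i)"
    and nz: "cross r1 r2 \<noteq> 0"
  shows "free_with_exponents f d1 d2"
proof -
  have f': "homogeneous (Suc (d1 + d2)) f" using f by simp
  have f0: "f \<noteq> 0" using f by auto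
  note g0 = grad_nonzero[OF f' f0]
  obtain c' where c': "cross r1 r2 = c' *s grad f" using AR_cross[OF f(1) f' r] .
  have c'0: "c' \<noteq> 0" using nz c' by auto
  obtain e where "homogeneous e c'" "d1 + d2 = d1 + d2 + e"
    by (rule homogeneous_cofactor[OF c'[symmetric] homogeneous_cross[OF hom] homogeneous_grad[OF f'] g0 c'0])
      simp
  then have "c' = cst (coeff3 c' 0 0 0)" using homogeneous_0D by simp
  then obtain c where c: "c' = cst c" "c \<noteq> 0" using c'0 by (metis cst_simps(1))
  have inv: "cst (1 / c) * cst c = 1" using c by (simp add: cst_simps(2) flip: cst_simps(6))
  define \<phi> where "\<phi> = (\<lambda>u :: S^2. u $ 1 *s r1 + u $ 2 *s r2)"
  have "graded_hom (vector [d1, d2]) 0 \<phi>"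
    unfolding graded_hom_def
  proof (intro conjI allI impI)
    show "module_hom (vector_scalar_mult :: S \<Rightarrow> S^2 \<Rightarrow> _) (vector_scalar_mult :: S \<Rightarrow> S^3 \<Rightarrow> _) \<phi>"
      by (intro module_hom.intro module_scalar_mult module_hom_axioms.intro)
        (simp_all add: \<phi>_def vec_eq_iff algebra_simps)
    fix k and u :: "S^2" assume "in_degree (vector [d1, d2]) k u"
    then have "homogeneous k (u $ 1 * r1 $ i)" "homogeneous k (u $ 2 * r2 $ i)" for i
      unfolding in_degree_def forall_2 vector_2 using hom in_degree_mult by blast+
    then show "in_degree 0 k (\<phi> u)"
      by (simp add: in_degree_def \<phi>_def homogeneous_add)
  qed
  moreover have "bij_betw \<phi> UNIV (AR f)"
    unfolding bij_betw_def
  proof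
    show "inj \<phi>"
    proof (rule injI)
      fix u v assume "\<phi> u = \<phi> v"
      then have *: "(u $ 1 - v $ 1) *s r1 + (u $ 2 - v $ 2) *s r2 = 0"
        by (simp add: \<phi>_def vec_eq_iff algebra_simps)
      have cr: "a *s cross r1 r2 = cross (a *s r1 + b *s r2) r2"
        "b *s cross r1 r2 = cross r1 (a *s r1 + b *s r2)" for a b
        by (simp_all add: cross_bilinear)
      have z: "cross 0 r2 = 0" "cross r1 0 = 0" by (simp_all add: vec_eq_iff forall_3)
      have "(u $ 1 - v $ 1) *s cross r1 r2 = 0" "(u $ 2 - v $ 2) *s cross r1 r2 = 0"
        using cr(1)[where a = "u $ 1 - v $ 1" and b = "u $ 2 - v $ 2", unfolded * z]
          cr(2)[where a = "u $ 1 - v $ 1" and b = "u $ 2 - v $ 2", unfolded * z] .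
      then have "u $ 1 - v $ 1 = 0" "u $ 2 - v $ 2 = 0" using nz by (metis smult_eq_0_iff)+
      then show "u = v" by (simp add: vec_eq_iff forall_2)
    qed
    show "range \<phi> = AR f"
    proof
      show "range \<phi> \<subseteq> AR f" using r AR_closed by (auto simp: \<phi>_def)
      show "AR f \<subseteq> range \<phi>"
      proof
        fix r assume rf: "r \<in> AR f"
        obtain w1 where w1: "cross r r2 = w1 *s grad f" using AR_cross[OF f(1) f' rf r(2)] .
        obtain w2 where w2: "cross r1 r = w2 *s grad f" using AR_cross[OF f(1) f' r(1) rf] .
        \<comment> \<open>Cramer's rule; the determinant of the three syzygies vanishes\<close>
        have det: "r $ 1 * cross r1 r2 $ 1 + r $ 2 * cross r1 r2 $ 2 + r $ 3 * cross r1 r2 $ 3 = 0"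
          using rf unfolding c' AR_iff vector_smult_component by algebra
        have "\<forall>k i. cross r1 r2 $ k * r $ i = cross r r2 $ k * r1 $ i + cross r1 r $ k * r2 $ i"
          unfolding forall_3 cross_nth
          by (intro conjI; (simp only: algebra_simps; fail)?; insert det[unfolded cross_nth]; algebra)
        then have cramer: "cross r1 r2 $ k * r $ i = cross r r2 $ k * r1 $ i + cross r1 r $ k * r2 $ i" for i k
          by blast
        obtain k where k: "grad f $ k \<noteq> 0" using g0 by (auto simp: vec_eq_iff)
        have "r $ i = cst (1 / c) * (w1 * r1 $ i + w2 * r2 $ i)" for i
        proof -
          have "grad f $ k * (cst c * r $ i) = grad f $ k * (w1 * r1 $ i + w2 * r2 $ i)"
            using cramer[of k i] unfolding c' w1 w2 c by (simp add: algebra_simps)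
          then have "cst c * r $ i = w1 * r1 $ i + w2 * r2 $ i" using k by simp
          then show ?thesis using inv by (metis mult.assoc mult_1)
        qed
        then have "r = \<phi> (vector [cst (1 / c) * w1, cst (1 / c) * w2])"
          by (simp add: \<phi>_def vec_eq_iff algebra_simps)
        then show "r \<in> range \<phi>" by blast
      qed
    qed
  qed
  ultimately show ?thesis
    using f le f' reduced_curveI unfolding free_with_exponents_def by blast
qed


section \<open>Nearly free curves\<close>

lemma homogeneous_coeff3_0: "homogeneous (Suc d) f \<Longrightarrow> coeff3 f 0 0 0 = 0"
  unfolding homogeneous_def by fastforce

text \<open>Setting shared by the next results: a syzygy \<open>r1\<close> of degree \<open>d1\<close> such that the cofactors
  \<open>w\<close> in \<open>r1 \<times> r = w \<nabla>f\<close>, for \<open>r \<in> AR(f)\<close>, form the ideal \<open>(l2, l3)\<close> of a point. Here \<open>l2\<close> and \<open>l3\<close>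
  are the cofactors of two syzygies of degree \<open>d2\<close>, and the degree of \<open>f\<close> is such that they are linear.\<close>

locale nearly_free_setting =
  fixes f :: S and d1 d2 :: nat and r1 r2 r3 :: "S^3" and l2 l3 :: S
  assumes sqf: "squarefree f" and hom_f: "homogeneous (d1 + d2) f" and d1: "0 < d1" and d12: "d1 + 1 < d2"
    and r1: "r1 \<in> AR f" and r2: "r2 \<in> AR f" and r3: "r3 \<in> AR f"
    and hom_r1: "\<And>i. homogeneous d1 (r1 $ i)"
    and hom_r2: "\<And>i. homogeneous d2 (r2 $ i)" and hom_r3: "\<And>i. homogeneous d2 (r3 $ i)"
    and cross_12: "cross r1 r2 = l2 *s grad f" and cross_13: "cross r1 r3 = l3 *s grad f"
    and hom_l2: "homogeneous 1 l2" and hom_l3: "homogeneous 1 l3"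
    and prime_l2: "prime_elem l2" and l2_l3: "\<not> l2 dvd l3"
    and ideal: "\<And>r w. r \<in> AR f \<Longrightarrow> cross r1 r = w *s grad f \<Longrightarrow> \<exists>a b. w = a * l2 + b * l3"
begin

lemma hom_f': "homogeneous (Suc (d1 + d2 - 1)) f"
  using hom_f d1 by simp

lemma f_nonzero: "f \<noteq> 0"
  using sqf by auto

lemma grad_f: "grad f \<noteq> 0"
  using grad_nonzero hom_f' f_nonzero .

lemma l2_nonzero: "l2 \<noteq> 0"
  using prime_l2 by auto

lemma cross_nonzero: "cross r1 r2 \<noteq> 0"
  unfolding cross_12 using l2_nonzero grad_f by (auto simp: vec_eq_iff)

lemma r1_nonzero: "r1 \<noteq> 0"
  using cross_nonzero by (auto simp: vec_eq_iff forall_3)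

text \<open>A common prime factor of the entries of \<open>r1\<close> would divide the coprime cofactors \<open>l2\<close> and \<open>l3\<close>,
  because it cannot divide the gradient.\<close>

lemma r1_primitive:
  assumes p: "prime_elem p" and dvd: "\<And>i. p dvd r1 $ i"
  shows False
proof -
  have *: "p dvd l" if "cross r1 r = l *s grad f" for r l
  proof (rule ccontr)
    assume "\<not> p dvd l"
    have "p dvd cross r1 r $ i" for i
      using exhaust_3[of i] dvd by auto
    then have "p dvd l * grad f $ i" for i unfolding that by simp
    then have "p dvd grad f $ i" for i
      using p \<open>\<not> p dvd l\<close> prime_elem_dvd_mult_iff by blast
    then show False
      using squarefree_gradient_primitive[OF sqf hom_f' p] by (metis grad_nth)
  qed
  have "p dvd l2" using * cross_12 .
  then have "l2 dvd p"
    using p prime_l2 by (metis associated_iff_dvd dvd_refl irreducibleD' prime_elem_imp_irreducible prime_elem_not_unit)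
  moreover have "p dvd l3" using * cross_13 .
  ultimately show False using l2_l3 dvd_trans by blast
qed

lemma multiple_of_r1:
  assumes "cross r1 r = 0"
  obtains c where "r = c *s r1"
proof -
  have *: "cross r r1 = 0" using assms by (simp add: vec_eq_iff forall_3 mult.commute)
  obtain c where "r = c *s r1"
    by (rule parallel_to_primitive[OF r1_nonzero _ *]) (use r1_primitive in blast)+
  then show ?thesis by (rule that)
qed

lemma cofactor:
  assumes "r \<in> AR f"
  obtains w where "cross r1 r = w *s grad f"
  using AR_cross[OF sqf hom_f' r1 assms] .

text \<open>For degrees below \<open>d2\<close> the cofactor \<open>w\<close> would be a constant. The ideal \<open>(l2, l3)\<close> contains no
  constant other than 0, so \<open>r\<close> is parallel to the primitive vector \<open>r1\<close>.\<close>

lemma low_degree_multiple: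
  assumes r: "r \<in> AR f" "\<And>i. homogeneous k (r $ i)" and k: "k < d2"
  obtains c where "r = c *s r1"
proof -
  obtain w where w: "cross r1 r = w *s grad f" using cofactor[OF r(1)] .
  have "w = 0"
  proof (rule ccontr)
    assume "w \<noteq> 0"
    then obtain e where e: "homogeneous e w" "d1 + k = d1 + d2 - 1 + e"
      using homogeneous_cofactor[OF w[symmetric] homogeneous_cross[OF hom_r1 r(2)]
          homogeneous_grad[OF hom_f'] grad_f] by metis
    with k d1 have "e = 0" by simp
    obtain a b where ab: "w = a * l2 + b * l3" using ideal[OF r(1) w] by blast
    have "coeff3 w 0 0 0 = coeff3 a 0 0 0 * coeff3 l2 0 0 0 + coeff3 b 0 0 0 * coeff3 l3 0 0 0"
      unfolding ab by (simp add: coeff3_def coeff_mult_0)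
    then have "coeff3 w 0 0 0 = 0"
      using homogeneous_coeff3_0 hom_l2 hom_l3 by simp
    then show False using homogeneous_0D e(1) \<open>e = 0\<close> \<open>w \<noteq> 0\<close> by (metis cst_simps(1))
  qed
  then have "cross r1 r = 0" using w by simp
  then show ?thesis using multiple_of_r1 that by blast
qed

lemma multiple_of_r1_degree:
  assumes "r = c *s r1" "\<And>i. homogeneous k (r $ i)" "r \<noteq> 0"
  shows "d1 \<le> k"
proof -
  have "c \<noteq> 0" using assms by auto
  then obtain e where "k = d1 + e"
    using homogeneous_cofactor[OF assms(1)[symmetric] assms(2) hom_r1 r1_nonzero] by metis
  then show ?thesis by simp
qed

lemma mdr_eq: "mdr f = d1"
  unfolding mdr_def
proof (rule Least_equality)
  show "\<exists>r\<in>AR f. r \<noteq> 0 \<and> (\<forall>i. homogeneous d1 (r $ i))"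
    using r1 r1_nonzero hom_r1 by blast
  fix k assume "\<exists>r\<in>AR f. r \<noteq> 0 \<and> (\<forall>i. homogeneous k (r $ i))"
  then obtain r where r: "r \<in> AR f" "r \<noteq> 0" "\<And>i. homogeneous k (r $ i)" by blast
  show "d1 \<le> k"
  proof (rule ccontr)
    assume "\<not> d1 \<le> k"
    then have "k < d2" using d12 by simp
    then obtain c where "r = c *s r1" using low_degree_multiple[OF r(1,3)] by blast
    then show False using multiple_of_r1_degree r(2,3) \<open>\<not> d1 \<le> k\<close> by blast
  qed
qed

text \<open>The degrees of a basis would add up to \<open>d1 + d2 - 1\<close>. As the smaller one is at least \<open>d1\<close>, both are
  below \<open>d2\<close>, and both elements of the basis would be multiples of \<open>r1\<close>.\<close>

lemma not_free: "\<not> free_curve f"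
proof
  assume "free_curve f"
  then obtain e1 e2 where free: "free_with_exponents f e1 e2" unfolding free_curve_def by blast
  then obtain \<phi> :: "S^2 \<Rightarrow> S^3" where e: "e1 \<le> e2" "homogeneous (e1 + e2 + 1) f"
    and \<phi>: "graded_hom (vector [e1, e2]) 0 \<phi>" "bij_betw \<phi> UNIV (AR f)"
    unfolding free_with_exponents_def by blast
  have deg: "e1 + e2 + 1 = d1 + d2" using homogeneous_unique[OF e(2) hom_f f_nonzero] .
  interpret module_hom "vector_scalar_mult :: S \<Rightarrow> S^2 \<Rightarrow> _" "vector_scalar_mult :: S \<Rightarrow> S^3 \<Rightarrow> _" \<phi>
    using \<phi>(1) unfolding graded_hom_def by blast
  have inj: "u = v" if "\<phi> u = \<phi> v" for u v
    using \<phi>(2) that by (auto simp: bij_betw_def dest: injD)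
  define s1 s2 where "s1 = \<phi> (axis 1 1)" and "s2 = \<phi> (axis 2 1)"
  have AR: "\<phi> u \<in> AR f" for u using \<phi>(2) by (auto simp: bij_betw_def)
  have homI: "homogeneous k (\<phi> u $ i)" if "in_degree (vector [e1, e2]) k u" for k u i
  proof -
    have "in_degree 0 k (\<phi> u)" using \<phi>(1) that unfolding graded_hom_def by blast
    then show ?thesis unfolding in_degree_def by (metis homogeneous_0 minus_nat.diff_0 zero_index)
  qed
  have h1: "homogeneous 0 (1 :: S)" using homogeneous_cst[of 1] by (simp add: cst_simps)
  have "in_degree (vector [e1, e2]) e1 (axis 1 1 :: S^2)" "in_degree (vector [e1, e2]) e2 (axis 2 1 :: S^2)"
    unfolding in_degree_def forall_2 by (simp_all add: axis_def h1)
  then have hom: "homogeneous e1 (s1 $ i)" "homogeneous e2 (s2 $ i)" for i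
    unfolding s1_def s2_def by (simp_all add: homI)
  have nz: "s1 \<noteq> 0" "s2 \<noteq> 0"
    unfolding s1_def s2_def using inj[of "axis _ 1" 0] by (auto simp: zero axis_eq_0_iff)
  have "e1 < d2" using deg d12 e(1) by simp
  then obtain a where a: "s1 = a *s r1"
    using low_degree_multiple[of s1 e1] AR hom unfolding s1_def by metis
  then have "d1 \<le> e1" using multiple_of_r1_degree hom nz by blast
  then have "e2 < d2" using deg by simp
  then obtain b where b: "s2 = b *s r1"
    using low_degree_multiple[of s2 e2] AR hom unfolding s2_def by metis
  have "\<phi> (b *s axis 1 1) = \<phi> (a *s axis 2 1)"
    unfolding scale s1_def[symmetric] s2_def[symmetric] a b by (simp add: vec_eq_iff algebra_simps)
  then have "b *s axis 1 1 = (a *s axis 2 1 :: S^2)" by (rule inj)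
  then have "a = 0" by (simp add: vec_eq_iff forall_2 axis_def)
  then show False using a nz by simp
qed

text \<open>The syzygies \<open>r1\<close>, \<open>r2\<close>, \<open>r3\<close> generate \<open>AR(f)\<close>, since the cofactor of any syzygy is a combination
  \<open>a l2 + b l3\<close> of those of \<open>r2\<close> and \<open>r3\<close>. For a relation \<open>u\<close> between them the cofactors give
  \<open>u\<^sub>2 l2 + u\<^sub>3 l3 = 0\<close>, hence \<open>(u\<^sub>2, u\<^sub>3)\<close> is a multiple of \<open>(l3, - l2)\<close>.\<close>

theorem nearly_free: "nearly_free_with_exponents f d1 d2"
proof -
  \<comment> \<open>the cofactor of \<open>l3 r2 - l2 r3\<close> is \<open>l3 l2 - l2 l3\<close>, hence this syzygy is a multiple of \<open>r1\<close>\<close>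
  have "cross r1 (l3 *s r2 - l2 *s r3) = 0"
    by (simp add: cross_bilinear cross_12 cross_13 vec_eq_iff algebra_simps)
  then obtain q' where q': "l3 *s r2 - l2 *s r3 = q' *s r1" using multiple_of_r1 by blast
  define q where "q = - q'"
  have q: "q *s r1 + l3 *s r2 = l2 *s r3"
    using q' by (simp add: q_def vec_eq_iff algebra_simps)
  have hom_q: "homogeneous (d2 + 1 - d1) q"
  proof (cases "q = 0")
    case False
    have "homogeneous (d2 + 1) ((l2 *s r3 - l3 *s r2) $ i)" for i
      using homogeneous_mult[OF hom_l2 hom_r3[of i]] homogeneous_mult[OF hom_l3 hom_r2[of i]]
      by (simp add: homogeneous_diff)
    moreover have "q *s r1 = l2 *s r3 - l3 *s r2" using q by (simp add: algebra_simps)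
    ultimately obtain c where "homogeneous c q" "d2 + 1 = d1 + c"
      using homogeneous_cofactor[OF _ _ hom_r1 r1_nonzero False] by metis
    then show ?thesis by simp
  qed simp
  define \<phi> where "\<phi> = (\<lambda>u :: S^3. u $ 1 *s r1 + u $ 2 *s r2 + u $ 3 *s r3)"
  define \<psi> where "\<psi> = (\<lambda>u :: S^1. u $ 1 *s (vector [q, l3, - l2] :: S^3))"
  have "graded_hom (vector [d1, d2, d2]) 0 \<phi>"
    unfolding graded_hom_def
  proof (intro conjI allI impI)
    show hom: "module_hom (vector_scalar_mult :: S \<Rightarrow> S^3 \<Rightarrow> _) (vector_scalar_mult :: S \<Rightarrow> S^3 \<Rightarrow> _) \<phi>"
      by (intro module_hom.intro module_scalar_mult module_hom_axioms.intro)
        (simp_all add: \<phi>_def vec_eq_iff algebra_simps)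
    fix k and u :: "S^3" assume "in_degree (vector [d1, d2, d2]) k u"
    then have "homogeneous k (u $ 1 * r1 $ i)" "homogeneous k (u $ 2 * r2 $ i)" "homogeneous k (u $ 3 * r3 $ i)" for i
      unfolding in_degree_def forall_3 vector_3 using hom_r1 hom_r2 hom_r3 in_degree_mult by blast+
    then show "in_degree 0 k (\<phi> u)"
      by (simp add: in_degree_def \<phi>_def homogeneous_add)
  qed
  moreover have "graded_hom (vector [d2 + 1]) (vector [d1, d2, d2]) \<psi>"
    unfolding graded_hom_def
  proof (intro conjI allI impI)
    show "module_hom (vector_scalar_mult :: S \<Rightarrow> S^1 \<Rightarrow> _) (vector_scalar_mult :: S \<Rightarrow> S^3 \<Rightarrow> _) \<psi>"
      by (intro module_hom.intro module_scalar_mult module_hom_axioms.intro)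
        (simp_all add: \<psi>_def vec_eq_iff algebra_simps)
    fix k and u :: "S^1" assume "in_degree (vector [d2 + 1]) k u"
    then have *: "u $ 1 = 0 \<or> d2 + 1 \<le> k \<and> homogeneous (k - (d2 + 1)) (u $ 1)"
      by (simp add: in_degree_def vector_def)
    show "in_degree (vector [d1, d2, d2]) k (\<psi> u)"
    proof (cases "u $ 1 = 0")
      case False
      with * have k: "d2 + 1 \<le> k" and h: "homogeneous (k - (d2 + 1)) (u $ 1)" by auto
      have "homogeneous (k - (d2 + 1) + (d2 + 1 - d1)) (u $ 1 * q)"
        "homogeneous (k - (d2 + 1) + 1) (u $ 1 * l3)" "homogeneous (k - (d2 + 1) + 1) (u $ 1 * - l2)"
        by (intro homogeneous_mult homogeneous_minus h hom_q hom_l2 hom_l3)+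
      moreover have "k - (d2 + 1) + (d2 + 1 - d1) = k - d1" "k - (d2 + 1) + 1 = k - d2"
        using k d12 by simp_all
      ultimately show ?thesis
        using k d12 by (simp add: in_degree_def forall_3 \<psi>_def)
    qed (simp add: in_degree_def \<psi>_def)
  qed
  moreover have "inj \<psi>"
  proof (rule injI)
    fix u v assume "\<psi> u = \<psi> v"
    then have "\<psi> u $ 3 = \<psi> v $ 3" by simp
    then have "u $ 1 = v $ 1" using l2_nonzero by (simp add: \<psi>_def)
    then show "u = v" by (simp add: vec_eq_iff forall_1)
  qed
  moreover have kernel: "range \<psi> = {u. \<phi> u = 0}"
  proof
    show "range \<psi> \<subseteq> {u. \<phi> u = 0}"
    proof (clarsimp)
      fix u :: "S^1"
      have "\<phi> (\<psi> u) = u $ 1 *s (q *s r1 + l3 *s r2 - l2 *s r3)"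
        by (simp add: \<phi>_def \<psi>_def vec_eq_iff algebra_simps)
      then show "\<phi> (\<psi> u) = 0" using q by simp
    qed
    show "{u. \<phi> u = 0} \<subseteq> range \<psi>"
    proof clarify
      fix u assume u: "\<phi> u = 0"
      have "cross r1 (\<phi> u) = (u $ 2 * l2 + u $ 3 * l3) *s grad f"
        by (simp add: \<phi>_def cross_bilinear cross_12 cross_13 vec_eq_iff algebra_simps)
      then have "(u $ 2 * l2 + u $ 3 * l3) *s grad f = 0"
        using u by (simp add: cross_bilinear)
      then have rel: "u $ 2 * l2 + u $ 3 * l3 = 0" using grad_f unfolding smult_eq_0_iff by simp
      then have "u $ 3 * l3 = l2 * (- u $ 2)" by (simp add: algebra_simps eq_neg_iff_add_eq_0)
      then have "l2 dvd u $ 3" using prime_l2 l2_l3 by (metis dvd_triv_left prime_elem_dvd_mult_iff)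
      then obtain e' where e': "u $ 3 = l2 * e'" by auto
      define e where "e = - e'"
      have e: "u $ 3 = - (e * l2)" using e' by (simp add: e_def)
      have "l2 * (u $ 2) = l2 * (e * l3)" using rel e by (simp add: algebra_simps)
      then have e2: "u $ 2 = e * l3" using l2_nonzero by simp
      have "u $ 1 *s r1 = e *s (q *s r1)"
      proof -
        have "u $ 1 *s r1 + e *s (l3 *s r2 - l2 *s r3) = 0"
          using u unfolding \<phi>_def e e2 by (simp add: vec_eq_iff algebra_simps)
        moreover have "l3 *s r2 - l2 *s r3 = - (q *s r1)"
          using q by (simp add: vec_eq_iff eq_neg_iff_add_eq_0 algebra_simps)
        ultimately show ?thesis by (simp add: vec_eq_iff)
      qed
      then have "u $ 1 = e * q" using r1_nonzero by (auto simp: vec_eq_iff)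
      then have "u = \<psi> (vector [e])"
        using e e2 by (simp add: vec_eq_iff forall_3 \<psi>_def vector_def)
      then show "u \<in> range \<psi>" by blast
    qed
  qed
  moreover have "range \<phi> = AR f"
  proof
    show "range \<phi> \<subseteq> AR f" using r1 r2 r3 AR_closed by (auto simp: \<phi>_def)
    show "AR f \<subseteq> range \<phi>"
    proof
      fix r assume r: "r \<in> AR f"
      obtain w where w: "cross r1 r = w *s grad f" using cofactor[OF r] .
      then obtain a b where ab: "w = a * l2 + b * l3" using ideal r by blast
      have "cross r1 (r - (a *s r2 + b *s r3)) = 0"
        by (simp add: cross_bilinear cross_12 cross_13 w ab vec_eq_iff algebra_simps)
      then obtain c where "r - (a *s r2 + b *s r3) = c *s r1" using multiple_of_r1 by blast
      then have "r = \<phi> (vector [c, a, b])" by (simp add: \<phi>_def algebra_simps)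
      then show "r \<in> range \<phi>" by blast
    qed
  qed
  moreover have minimal: "coeff3 (\<psi> u $ i) 0 0 0 = 0" for u i
  proof -
    obtain d where d: "d2 + 1 - d1 = Suc d" using d12 by (metis Suc_diff_le add.commute less_imp_le plus_1_eq_Suc add_lessD1)
    have "coeff3 q 0 0 0 = 0" "coeff3 l2 0 0 0 = 0" "coeff3 l3 0 0 0 = 0"
      using homogeneous_coeff3_0 hom_q hom_l2 hom_l3 unfolding d by simp_all
    then show ?thesis using exhaust_3[of i] by (auto simp: \<psi>_def coeff3_def coeff_mult_0)
  qed
  \<comment> \<open>a redundant generator would give a relation with the entry 1, which the resolution, being minimal, excludes\<close>
  moreover have "\<phi> (axis i 1) \<notin> module.span vector_scalar_mult {\<phi> (axis j 1) | j. j \<noteq> i}" for i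
  proof
    interpret V: module "vector_scalar_mult :: S \<Rightarrow> S^3 \<Rightarrow> S^3" by (rule module_scalar_mult)
    interpret \<phi>: module_hom "vector_scalar_mult :: S \<Rightarrow> S^3 \<Rightarrow> S^3" vector_scalar_mult \<phi>
      by (intro module_hom.intro module_scalar_mult module_hom_axioms.intro)
        (simp_all add: \<phi>_def vec_eq_iff algebra_simps)
    assume *: "\<phi> (axis i 1) \<in> V.span {\<phi> (axis j 1) | j. j \<noteq> i}"
    have "V.span {\<phi> (axis j 1) | j. j \<noteq> i} \<subseteq> {\<phi> u | u. u $ i = 0}"
    proof (rule V.span_minimal)
      show "{\<phi> (axis j 1) | j. j \<noteq> i} \<subseteq> {\<phi> u | u. u $ i = 0}"
        by (auto simp: axis_def)
      show "V.subspace {\<phi> u | u. u $ i = 0}"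
      proof (rule V.subspaceI)
        show "0 \<in> {\<phi> u | u. u $ i = 0}"
          by (rule CollectI, rule exI[of _ 0]) (simp add: \<phi>.zero)
        fix s t c assume "s \<in> {\<phi> u | u. u $ i = 0}"
        then obtain u where u: "s = \<phi> u" "u $ i = 0" by blast
        then have "c *s s = \<phi> (c *s u)" "(c *s u) $ i = 0" by (simp_all add: \<phi>.scale)
        then show "c *s s \<in> {\<phi> u | u. u $ i = 0}" by blast
        assume "t \<in> {\<phi> u | u. u $ i = 0}"
        then obtain v where "t = \<phi> v" "v $ i = 0" by blast
        with u have "s + t = \<phi> (u + v)" "(u + v) $ i = 0" by (simp_all add: \<phi>.add)
        then show "s + t \<in> {\<phi> u | u. u $ i = 0}" by blast
      qed
    qed
    with * obtain u where u: "\<phi> (axis i 1) = \<phi> u" "u $ i = 0" by blast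
    then have "\<phi> (axis i 1 - u) = 0" by (simp add: \<phi>.diff)
    then obtain t where "axis i 1 - u = \<psi> t" using kernel by (metis (mono_tags, lifting) mem_Collect_eq rangeE)
    then have "(axis i 1 - u) $ i = \<psi> t $ i" by simp
    then have "coeff3 ((axis i 1 - u) $ i) 0 0 0 = 0" using minimal by metis
    moreover have "(axis i 1 - u) $ i = cst 1" using u(2) by (simp add: axis_def cst_simps)
    ultimately have "coeff3 (cst 1) 0 0 0 = 0" by metis
    then show False by (simp add: coeff3_cst)
  qed
  moreover have "d1 \<le> d2" using d12 by simp
  ultimately show ?thesis
    unfolding nearly_free_with_exponents_def
    using hom_f reduced_curveI[OF sqf hom_f'] by blast
qed

end


section \<open>Products of a smooth conic and lines\<close>

lemma dx_more: "dx (f - g) = dx f - dx g" "dx (- f) = - dx f" "dx (numeral n) = 0"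
  "dx (f ^ 2) = 2 * f * dx f"
  and dy_more: "dy (f - g) = dy f - dy g" "dy (- f) = - dy f" "dy (numeral n) = 0"
  "dy (f ^ 2) = 2 * f * dy f"
  and dz_more: "dz (f - g) = dz f - dz g" "dz (- f) = - dz f" "dz (numeral n) = 0"
  "dz (f ^ 2) = 2 * f * dz f"
proof -
  have m: "- f = cst (- 1) * f" for f by (simp add: cst_simps)
  have n: "numeral n = cst (numeral n)" for n by (simp add: cst_def numeral_poly)
  show neg: "dx (- f) = - dx f" "dy (- f) = - dy f" "dz (- f) = - dz f" for f
    unfolding m by (simp_all add: dx_simps dy_simps dz_simps)
  show "dx (f - g) = dx f - dx g" "dy (f - g) = dy f - dy g" "dz (f - g) = dz f - dz g"
    using dx_simps(1)[of f "- g"] dy_simps(1)[of f "- g"] dz_simps(1)[of f "- g"] by (simp_all add: neg)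
  show "dx (numeral n) = 0" "dy (numeral n) = 0" "dz (numeral n) = 0" unfolding n by simp_all
  show "dx (f ^ 2) = 2 * f * dx f" "dy (f ^ 2) = 2 * f * dy f" "dz (f ^ 2) = 2 * f * dz f"
    by (simp_all add: power2_eq_square dx_simps dy_simps dz_simps)
qed

lemmas partial_simps = dx_simps dy_simps dz_simps dx_more dy_more dz_more

lemma span_singleton_eqD:
  fixes v w :: "complex^3"
  assumes "vec.span {v} = vec.span {w}" "v \<noteq> 0"
  obtains c where "c \<noteq> 0" "v = c *s w"
proof -
  have "v \<in> vec.span {w}" using assms(1) vec.span_base[of v "{v}"] by auto
  then obtain c where "v = c *s w" by (auto simp: vec.span_singleton)
  then show ?thesis using that assms(2) by auto
qed

lemma span_scale:
  assumes "c \<noteq> 0"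
  shows "vec.span {c *s w} = vec.span {w :: complex^3}"
proof -
  have "range (\<lambda>k. k *s (c *s w)) = range (\<lambda>k. k *s w)"
  proof safe
    fix k
    show "k *s (c *s w) \<in> range (\<lambda>k. k *s w)" by (rule image_eqI[of _ _ "k * c"]) simp_all
    show "k *s w \<in> range (\<lambda>k. k *s (c *s w))" by (rule image_eqI[of _ _ "k / c"]) (use assms in simp_all)
  qed
  then show ?thesis by (simp add: vec.span_singleton)
qed

lemma span_in_locus_iff:
  assumes "homogeneous d f" "v \<noteq> 0"
  shows "vec.span {v} \<in> locus f \<longleftrightarrow> eval f v = 0"
proof
  assume "vec.span {v} \<in> locus f"
  then obtain w where "vec.span {v} = vec.span {w}" "eval f w = 0" unfolding locus_def by auto
  moreover obtain c where "c \<noteq> 0" "v = c *s w" using span_singleton_eqD[OF calculation(1) assms(2)] .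
  ultimately show "eval f v = 0" using eval_homogeneous[OF assms(1), of c w] by simp
qed (use assms in \<open>auto simp: locus_def\<close>)

lemma homogeneous_numeral [simp]: "homogeneous 0 (numeral n)"
proof -
  have "(numeral n :: S) = cst (numeral n)" by (simp add: cst_def numeral_poly)
  then show ?thesis by (metis homogeneous_cst)
qed

lemma homogeneous_1: "homogeneous 0 1"
  using homogeneous_cst[of 1] by (simp add: cst_simps)

lemma homogeneous_multI: "homogeneous a f \<Longrightarrow> homogeneous b g \<Longrightarrow> a + b = d \<Longrightarrow> homogeneous d (f * g)"
  using homogeneous_mult by blast

lemma homogeneous_powerI: "homogeneous 1 f \<Longrightarrow> homogeneous n (f ^ n)"
proof (induction n)
  case 0
  show ?case by (simp add: homogeneous_1)
next
  case (Suc n)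
  then show ?case using homogeneous_mult[of 1 f n "f ^ n"] by simp
qed

lemmas homogeneous_intros = homogeneous_add homogeneous_diff homogeneous_minus homogeneous_multI
  homogeneous_powerI homogeneous_1 homogeneous_numeral homogeneous_cst homogeneous_var[folded One_nat_def]

lemma linear_form:
  assumes "homogeneous 1 f"
  obtains a b c where "f = cst a * varx + cst b * vary + cst c * varz"
proof
  define a b c where "a = coeff3 f 1 0 0" and "b = coeff3 f 0 1 0" and "c = coeff3 f 0 0 1"
  have v: "coeff3 varx i j k = (if i = 1 \<and> j = 0 \<and> k = 0 then 1 else 0)"
    "coeff3 vary i j k = (if i = 0 \<and> j = 1 \<and> k = 0 then 1 else 0)"
    "coeff3 varz i j k = (if i = 0 \<and> j = 0 \<and> k = 1 then 1 else 0)" for i j k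
    using coeff3_var_mult[of 1 i j k] coeff3_cst[of 1] by (auto simp: cst_simps)
  show "f = cst (coeff3 f 1 0 0) * varx + cst (coeff3 f 0 1 0) * vary + cst (coeff3 f 0 0 1) * varz"
  proof (rule S_eqI)
    fix i j k
    have "coeff3 f i j k = 0 \<or> i + j + k = 1" using assms by (auto simp: homogeneous_def)
    moreover have "i + j + k = 1 \<longleftrightarrow> (i = 1 \<and> j = 0 \<and> k = 0) \<or> (i = 0 \<and> j = 1 \<and> k = 0) \<or> (i = 0 \<and> j = 0 \<and> k = 1)"
      by presburger
    ultimately show "coeff3 f i j k = coeff3 (cst (coeff3 f 1 0 0) * varx + cst (coeff3 f 0 1 0) * vary + cst (coeff3 f 0 0 1) * varz) i j k"
      by (auto simp: coeff3_cst_mult v)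
  qed
qed

lemma linear_form_irreducible:
  assumes "homogeneous 1 f" "f \<noteq> 0"
  shows "irreducible f"
proof (rule irreducibleI)
  show "f \<noteq> 0" by fact
  show "\<not> is_unit f"
    using is_unit_S homogeneous_cst homogeneous_unique assms by (metis zero_neq_one)
  fix g h assume f: "f = g * h"
  obtain a b where "homogeneous a g" "homogeneous b h" "a + b = 1"
    using homogeneous_factor assms unfolding f by metis
  moreover have "g \<noteq> 0" "h \<noteq> 0" using f assms by auto
  moreover have "is_unit g" if "homogeneous 0 g" "g \<noteq> 0" for g
    using homogeneous_0D[OF that(1)] that(2) is_unit_cst cst_simps(1) by metis
  ultimately show "is_unit g \<or> is_unit h" by (cases a) auto
qed

text \<open>If the coefficient vectors are independent, their vector product is a common zero. Otherwise the
  forms are proportional, and a zero of one of them that is not 0 is also a zero of the other.\<close>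

lemma linear_forms_common_zero:
  assumes "homogeneous 1 f" "homogeneous 1 g"
  obtains v where "v \<noteq> 0" "eval f v = 0" "eval g v = 0"
proof -
  obtain a b c where f: "f = cst a * varx + cst b * vary + cst c * varz" using linear_form[OF assms(1)] .
  obtain a' b' c' where g: "g = cst a' * varx + cst b' * vary + cst c' * varz" using linear_form[OF assms(2)] .
  define u :: "complex^3" where "u = cross (vector [a, b, c]) (vector [a', b', c'])"
  show ?thesis
  proof (cases "u = 0")
    case False
    then show ?thesis
      by (intro that[of u]) (simp_all add: f g u_def algebra_simps)
  next
    case True
    then have par: "b * c' = c * b'" "c * a' = a * c'" "a * b' = b * a'"
      by (simp_all add: u_def vec_eq_iff forall_3)
    show ?thesis
    proof (cases "a = 0 \<and> b = 0 \<and> c = 0")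
      case True
      show ?thesis
      proof (cases "a' = 0 \<and> b' = 0")
        case True
        with \<open>a = 0 \<and> b = 0 \<and> c = 0\<close> show ?thesis
          by (intro that[of "vector [1, 0, 0]"]) (simp_all add: f g vec_eq_iff forall_3)
      next
        case False
        with \<open>a = 0 \<and> b = 0 \<and> c = 0\<close> show ?thesis
          by (intro that[of "vector [b', - a', 0]"]) (auto simp: f g vec_eq_iff forall_3)
      qed
    next
      case False
      then consider "a = 0" "b = 0" "c \<noteq> 0" | "a \<noteq> 0 \<or> b \<noteq> 0" by blast
      then show ?thesis
      proof cases
        case 1
        then have "a' = 0" "b' = 0" using par by auto
        then show ?thesis
          using 1 by (intro that[of "vector [1, 0, 0]"]) (simp_all add: f g vec_eq_iff forall_3)
      next
        case 2
        then show ?thesis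
          using par by (intro that[of "vector [b, - a, 0]"])
            (auto simp: f g vec_eq_iff forall_3 algebra_simps)
      qed
    qed
  qed
qed

text \<open>A reducible conic is a product of two linear forms, whose common zero is a singular point.\<close>

lemma smooth_conic_irreducible:
  assumes "homogeneous 2 f" "f \<noteq> 0" "sing_points f = {}"
  shows "irreducible f"
proof (rule irreducibleI)
  show "f \<noteq> 0" by fact
  show "\<not> is_unit f"
    using is_unit_S homogeneous_cst homogeneous_unique assms by (metis zero_neq_numeral)
  fix g h assume f: "f = g * h"
  obtain a b where ab: "homogeneous a g" "homogeneous b h" "a + b = 2"
    using homogeneous_factor assms unfolding f by metis
  have nz: "g \<noteq> 0" "h \<noteq> 0" using f assms by auto
  have unit: "is_unit g" if "homogeneous 0 g" "g \<noteq> 0" for g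
    using homogeneous_0D[OF that(1)] that(2) is_unit_cst cst_simps(1) by metis
  consider "a = 0" | "b = 0" | "a = 1" "b = 1" using ab(3) by linarith
  then show "is_unit g \<or> is_unit h"
  proof cases
    case 3
    then obtain v where "v \<noteq> 0" "eval g v = 0" "eval h v = 0"
      using linear_forms_common_zero ab by metis
    then have "vec.span {v} \<in> sing_points f"
      unfolding sing_points_def f by (auto simp: partial_simps)
    then show ?thesis using assms(3) by blast
  qed (use ab unit nz in auto)
qed

lemma linear_form_smooth:
  assumes "homogeneous 1 f" "f \<noteq> 0"
  shows "sing_points f = {}"
proof -
  obtain a b c where f: "f = cst a * varx + cst b * vary + cst c * varz" using linear_form[OF assms(1)] .
  have "a \<noteq> 0 \<or> b \<noteq> 0 \<or> c \<noteq> 0" using assms(2) unfolding f by (auto simp: cst_simps)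
  then show ?thesis unfolding sing_points_def f by (auto simp: partial_simps)
qed

lemma locus_cst_mult: "c \<noteq> 0 \<Longrightarrow> locus (cst c * f) = locus f"
  by (simp add: locus_def)

lemma sing_points_cst_mult: "c \<noteq> 0 \<Longrightarrow> sing_points (cst c * f) = sing_points f"
  by (simp add: sing_points_def partial_simps)

lemma homogeneous_cst_mult_iff: "c \<noteq> 0 \<Longrightarrow> homogeneous d (cst c * f) \<longleftrightarrow> homogeneous d f"
  by (simp add: homogeneous_def coeff3_cst_mult)

text \<open>The derivative of \<open>f\<close> along the vector field with coefficients \<open>r\<close>; thus \<open>r \<in> AR(f)\<close> if and only if
  it vanishes.\<close>

definition along :: "S^3 \<Rightarrow> S \<Rightarrow> S" where
  "along r f = r $ 1 * dx f + r $ 2 * dy f + r $ 3 * dz f"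

lemma along_prod_list:
  assumes "list_all2 (\<lambda>f k. along r f = k * f) fs ks"
  shows "along r (prod_list fs) = sum_list ks * prod_list fs"
  using assms
proof (induction rule: list_all2_induct)
  case (Cons f fs k ks)
  have "along r (prod_list (f # fs)) = along r f * prod_list fs + f * along r (prod_list fs)"
    by (simp add: along_def partial_simps algebra_simps)
  then show ?case using Cons by (simp add: algebra_simps)
qed (simp add: along_def)

lemma AR_prod_listI:
  assumes "list_all2 (\<lambda>f k. along r f = k * f) fs ks" "sum_list ks = 0"
  shows "r \<in> AR (prod_list fs)"
  using along_prod_list[OF assms(1)] assms(2) by (simp add: AR_def along_def)

lemma eval_prod_list: "eval (prod_list fs) v = (\<Prod>f\<leftarrow>fs. eval f v)"
  by (induction fs) auto

text \<open>A product of a smooth conic \<open>Q\<close> and linear forms \<open>Ls\<close>. The points \<open>ps\<close> certify that the factors are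
  pairwise different curves: the \<open>j\<close>-th point lies on the \<open>j\<close>-th factor in \<open>Q # Ls\<close> and on no other.\<close>

locale conic_and_lines =
  fixes Ls :: "S list" and Q :: S and ps :: "(complex^3) list"
  assumes lines: "\<And>l. l \<in> set Ls \<Longrightarrow> homogeneous 1 l"
    and conic: "homogeneous 2 Q" and smooth: "sing_points Q = {}"
    and nonzero: "0 \<notin> set ps"
    and len: "length ps = Suc (length Ls)"
    and probe: "\<And>i j. i \<le> length Ls \<Longrightarrow> j \<le> length Ls \<Longrightarrow>
      eval ((Q # Ls) ! i) (ps ! j) = 0 \<longleftrightarrow> i = j"
begin

abbreviation "f \<equiv> Q * prod_list Ls"

lemma prod_list_eq: "f = prod_list (Q # Ls)" by simp

lemma probeE:
  assumes "g \<in> set (Q # Ls)"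
  obtains v where "v \<noteq> 0" "\<And>h. h \<in> set (Q # Ls) \<Longrightarrow> eval h v = 0 \<longleftrightarrow> h = g"
proof -
  have nth: "\<exists>i\<le>length Ls. h = (Q # Ls) ! i" if "h \<in> set (Q # Ls)" for h
    using that by (metis in_set_conv_nth length_Cons less_Suc_eq_le)
  obtain i where i: "i \<le> length Ls" "g = (Q # Ls) ! i" using nth[OF assms] by blast
  have "eval h (ps ! i) = 0 \<longleftrightarrow> h = g" if h: "h \<in> set (Q # Ls)" for h
  proof -
    obtain j where j: "j \<le> length Ls" "h = (Q # Ls) ! j" using nth[OF h] by blast
    show ?thesis using probe[OF j(1) i(1)] probe[OF i(1) i(1)] i j by metis
  qed
  moreover have "ps ! i \<noteq> 0" using nonzero len i by (metis less_Suc_eq_le nth_mem)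
  ultimately show ?thesis using that by blast
qed

lemma distinct: "distinct (Q # Ls)"
  unfolding distinct_conv_nth using probe by (metis length_Cons less_Suc_eq_le)

lemma factor_nonzero: "g \<in> set (Q # Ls) \<Longrightarrow> g \<noteq> 0"
proof
  assume g: "g \<in> set (Q # Ls)" "g = 0"
  then obtain i where i: "i \<le> length Ls" "g = (Q # Ls) ! i"
    by (metis in_set_conv_nth length_Cons less_Suc_eq_le)
  have one: "i = j" if "j \<le> length Ls" for j using probe[OF i(1) that] i(2) g(2) by simp
  then have "length Ls = 0" by (metis le0 le_refl)
  then have "Q = 0" using i g(2) by simp
  then show False using smooth unfolding sing_points_def
    by (auto dest!: spec[of _ "axis 1 1"] simp: axis_eq_0_iff)
qed

lemma factor_smooth: "g \<in> set (Q # Ls) \<Longrightarrow> sing_points g = {}"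
  using linear_form_smooth lines smooth factor_nonzero by auto

lemma factor_prime: "g \<in> set (Q # Ls) \<Longrightarrow> prime_elem g"
  using linear_form_irreducible smooth_conic_irreducible lines conic smooth factor_nonzero
  by (auto intro!: irreducible_imp_prime_elem)

lemma factor_homogeneous: "g \<in> set (Q # Ls) \<Longrightarrow> \<exists>d. homogeneous d g"
  using lines conic by auto

lemma not_dvd:
  assumes "g \<in> set (Q # Ls)" "h \<in> set (Q # Ls)" "g dvd h"
  shows "g = h"
proof -
  obtain v where v: "\<And>h. h \<in> set (Q # Ls) \<Longrightarrow> eval h v = 0 \<longleftrightarrow> h = g" using probeE[OF assms(1)] by blast
  obtain k where "h = g * k" using assms(3) by auto
  then have "eval h v = 0" using v[OF assms(1)] by simp
  then show ?thesis using v[OF assms(2)] by simp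
qed

lemma irreducible_factor:
  assumes "irreducible g" "g dvd f"
  obtains h c where "h \<in> set (Q # Ls)" "c \<noteq> 0" "g = cst c * h"
proof -
  have p: "prime_elem g" using assms(1) by (rule irreducible_imp_prime_elem)
  have "\<exists>h\<in>set hs. g dvd h" if "g dvd prod_list hs" for hs
    using that p by (induction hs) (auto simp: prime_elem_dvd_mult_iff dest: prime_elem_not_unit)
  then obtain h where h: "h \<in> set (Q # Ls)" "g dvd h" using assms(2) unfolding prod_list_eq by blast
  then obtain u where u: "h = g * u" by auto
  have "irreducible h" using factor_prime h prime_elem_imp_irreducible by blast
  then have "is_unit u" using u assms(1) by (metis irreducibleD irreducible_not_unit)
  then obtain c where c: "u = cst c" "c \<noteq> 0" by (rule is_unit_S)
  have "cst (1 / c) * h = (cst c * cst (1 / c)) * g" by (simp add: u c)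
  also have "\<dots> = g" using c by (simp add: cst_simps(2) flip: cst_simps(6))
  finally show ?thesis using that[of h "1 / c"] h c by simp
qed

lemma split_factor:
  assumes "g \<in> set (Q # Ls)"
  obtains hs where "f = g * prod_list hs" "set hs = set (Q # Ls) - {g}"
proof -
  obtain xs ys where "Q # Ls = xs @ g # ys" using split_list[OF assms] by blast
  moreover have "f = prod_list (Q # Ls)" by simp
  moreover have "set (xs @ ys) = set (xs @ g # ys) - {g}" "prod_list (xs @ g # ys) = g * prod_list (xs @ ys)"
    using distinct calculation(1) by auto
  ultimately show ?thesis by (intro that[of "xs @ ys"]) metis+
qed

lemma squarefree_f: "squarefree f"
proof (rule squarefreeI)
  fix p assume p: "p\<^sup>2 dvd f"
  have "0 \<notin> set (Q # Ls)" using factor_nonzero by blast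
  then have f0: "f \<noteq> 0" by (simp add: prod_list_zero_iff)
  show "is_unit p"
  proof (rule ccontr)
    assume "\<not> is_unit p"
    moreover have "p \<noteq> 0" using p f0 by auto
    ultimately obtain q where q: "q dvd p" "prime q" using prime_divisor_exists by blast
    then have q2: "q\<^sup>2 dvd f" using p by (meson dvd_power_same dvd_trans)
    then have "q dvd f" by (metis dvd_mult_left power2_eq_square)
    then obtain h c where h: "h \<in> set (Q # Ls)" "c \<noteq> 0" "q = cst c * h"
      using irreducible_factor q(2) by (metis prime_elem_imp_irreducible prime_imp_prime_elem)
    then have "h\<^sup>2 dvd f" using q2 by (metis dvd_mult_left dvd_power_same dvd_trans dvd_triv_right)
    moreover obtain hs where hs: "f = h * prod_list hs" "set hs = set (Q # Ls) - {h}"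
      using split_factor[OF h(1)] .
    ultimately have "h dvd prod_list hs"
      using factor_nonzero[OF h(1)] by (simp add: power2_eq_square)
    moreover have "\<not> h dvd prod_list gs" if "set gs \<subseteq> set (Q # Ls) - {h}" for gs
      using that
    proof (induction gs)
      case Nil
      then show ?case using factor_prime[OF h(1)] by (simp add: prime_elem_not_unit)
    next
      case (Cons g gs)
      then have "\<not> h dvd g" using not_dvd[OF h(1), of g] by auto
      then show ?case using Cons factor_prime[OF h(1)] by (simp add: prime_elem_dvd_mult_iff)
    qed
    ultimately show False using hs by blast
  qed
qed

lemma homogeneous_f: "homogeneous (Suc (Suc (length Ls))) f"
proof -
  have "homogeneous (length ls) (prod_list ls)" if "\<And>l. l \<in> set ls \<Longrightarrow> homogeneous 1 l" for ls
    using that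
  proof (induction ls)
    case Nil
    then show ?case by (simp add: homogeneous_1)
  next
    case (Cons l ls)
    then show ?case using homogeneous_mult[of 1 l "length ls" "prod_list ls"] by simp
  qed
  then show ?thesis using homogeneous_mult[OF conic] lines by force
qed

lemma conic_line_arrangement_f: "conic_line_arrangement f"
  unfolding conic_line_arrangement_def
proof (intro conjI allI impI)
  show "reduced_curve f" using reduced_curveI squarefree_f homogeneous_f by blast
  fix g assume "irreducible g \<and> g dvd f"
  then obtain h c where h: "h \<in> set (Q # Ls)" "c \<noteq> 0" "g = cst c * h" using irreducible_factor by blast
  then show "homogeneous 1 g \<or> homogeneous 2 g \<and> sing_points g = {}"
    using lines conic smooth by (auto simp: homogeneous_cst_mult_iff sing_points_cst_mult)
qed

lemma smooth_components_f: "smooth_components f"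
  unfolding smooth_components_def
  using irreducible_factor factor_smooth sing_points_cst_mult by metis

lemma curve_components_f:
  "curve_components k f = locus ` {h \<in> set (Q # Ls). homogeneous k h}"
proof safe
  fix p assume "p \<in> curve_components k f"
  then obtain g where g: "p = locus g" "irreducible g" "g dvd f" "homogeneous k g"
    unfolding curve_components_def by blast
  then obtain h c where h: "h \<in> set (Q # Ls)" "c \<noteq> 0" "g = cst c * h" using irreducible_factor by blast
  with g show "p \<in> locus ` {h \<in> set (Q # Ls). homogeneous k h}"
    by (auto simp: locus_cst_mult homogeneous_cst_mult_iff)
next
  fix h assume h: "h \<in> set (Q # Ls)" "homogeneous k h"
  have "irreducible h" using factor_prime h prime_elem_imp_irreducible by blast
  moreover have "h dvd f" using split_factor[OF h(1)] by (metis dvd_triv_left)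
  ultimately show "locus h \<in> curve_components k f" using h unfolding curve_components_def by blast
qed

lemma inj_locus: "inj_on locus (set (Q # Ls))"
proof (rule inj_onI)
  fix g h assume gh: "g \<in> set (Q # Ls)" "h \<in> set (Q # Ls)" "locus g = locus h"
  obtain v where v: "v \<noteq> 0" "\<And>h. h \<in> set (Q # Ls) \<Longrightarrow> eval h v = 0 \<longleftrightarrow> h = g"
    using probeE[OF gh(1)] by blast
  obtain d e where "homogeneous d g" "homogeneous e h" using factor_homogeneous gh by blast
  then show "g = h" using span_in_locus_iff v gh by metis
qed

lemma card_curve_components:
  "card (curve_components k f) = (if k = 1 then length Ls else if k = 2 then 1 else 0)"
proof -
  have "homogeneous k h \<longleftrightarrow> k = 1" if "h \<in> set Ls" for h
    using lines[OF that] factor_nonzero[of h] homogeneous_unique[of k h 1] that by auto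
  moreover have "homogeneous k Q \<longleftrightarrow> k = 2"
    using conic factor_nonzero[of Q] homogeneous_unique[of k Q 2] by auto
  ultimately have "{h \<in> set (Q # Ls). homogeneous k h} = (if k = 1 then set Ls else if k = 2 then {Q} else {})"
    by auto
  moreover have "card (locus ` A) = card A" if "A \<subseteq> set (Q # Ls)" for A
    using card_image inj_on_subset inj_locus that by metis
  ultimately show ?thesis
    unfolding curve_components_f using distinct distinct_card[of Ls] by (auto simp: subset_insertI)
qed

text \<open>As the components are smooth, the singular points are those on two of them.\<close>

lemma sing_points_f:
  "sing_points f = {vec.span {v} | v. v \<noteq> 0 \<and>
     (\<exists>g\<in>set (Q # Ls). \<exists>h\<in>set (Q # Ls). g \<noteq> h \<and> eval g v = 0 \<and> eval h v = 0)}"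
proof -
  have "eval f v = 0 \<and> eval (dx f) v = 0 \<and> eval (dy f) v = 0 \<and> eval (dz f) v = 0 \<longleftrightarrow>
    (\<exists>g\<in>set (Q # Ls). \<exists>h\<in>set (Q # Ls). g \<noteq> h \<and> eval g v = 0 \<and> eval h v = 0)" (is "?l \<longleftrightarrow> ?r")
    if "v \<noteq> 0" for v
  proof
    assume l: ?l
    then have "(\<Prod>g\<leftarrow>Q # Ls. eval g v) = 0" by (simp add: eval_prod_list)
    then have "0 \<in> (\<lambda>g. eval g v) ` set (Q # Ls)" unfolding prod_list_zero_iff set_map .
    then obtain g where g: "g \<in> set (Q # Ls)" "eval g v = 0" by (metis imageE)
    obtain hs where hs: "f = g * prod_list hs" "set hs = set (Q # Ls) - {g}" using split_factor[OF g(1)] .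
    have "eval (prod_list hs) v = 0"
    proof (rule ccontr)
      assume "eval (prod_list hs) v \<noteq> 0"
      then have "vec.span {v} \<in> sing_points g"
        using l g that unfolding hs sing_points_def by (auto simp: partial_simps)
      then show False using factor_smooth[OF g(1)] by blast
    qed
    then obtain h where "h \<in> set hs" "eval h v = 0"
      unfolding eval_prod_list by (auto simp: prod_list_zero_iff)
    then show ?r using g hs by blast
  next
    assume ?r
    then obtain g h where gh: "g \<in> set (Q # Ls)" "h \<in> set (Q # Ls)" "g \<noteq> h" "eval g v = 0" "eval h v = 0"
      by blast
    obtain hs where hs: "f = g * prod_list hs" "set hs = set (Q # Ls) - {g}" using split_factor[OF gh(1)] .
    have "eval (prod_list hs) v = 0"
      unfolding eval_prod_list using hs gh by (auto simp: prod_list_zero_iff image_iff)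
    then show ?l using gh unfolding hs by (simp add: partial_simps)
  qed
  then show ?thesis unfolding sing_points_def by (intro Collect_cong iff_exI conj_cong refl)
qed

end


section \<open>Holomorphic functions of two variables\<close>

lemma holomorphic2_on_subset: "holomorphic2_on h U \<Longrightarrow> V \<subseteq> U \<Longrightarrow> holomorphic2_on h V"
  by (auto simp: holomorphic2_on_def)

lemma holomorphic2_on_const [intro]: "holomorphic2_on (\<lambda>w. c) U"
  unfolding holomorphic2_on_def
  by (intro ballI exI[of _ 0]) (simp add: case_prod_unfold)

lemma holomorphic2_on_fst [intro]: "holomorphic2_on fst U"
  unfolding holomorphic2_on_def
  by (intro ballI exI[of _ 1] exI[of _ 0]) (simp add: case_prod_unfold has_derivative_fst[OF has_derivative_ident])

lemma holomorphic2_on_snd [intro]: "holomorphic2_on snd U"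
  unfolding holomorphic2_on_def
  by (intro ballI exI[of _ 0] exI[of _ 1]) (simp add: case_prod_unfold has_derivative_snd[OF has_derivative_ident])

lemma has_complex_derivative_mult:
  assumes "(f has_derivative (\<lambda>(s, t). a * s + b * t)) (at p)" "(g has_derivative (\<lambda>(s, t). c * s + d * t)) (at p)"
  shows "((\<lambda>w. f w * g w) has_derivative (\<lambda>(s, t). (f p * c + g p * a) * s + (f p * d + g p * b) * (t :: complex))) (at p)"
  using has_derivative_mult[OF assms] by (simp add: case_prod_unfold algebra_simps)

lemma has_complex_derivative_compose:
  assumes g: "(g has_derivative (\<lambda>(s, t). a * s + b * t)) (at (\<phi> p))"
    and 1: "((fst \<circ> \<phi>) has_derivative (\<lambda>(s, t). c * s + d * t)) (at p)"
    and 2: "((snd \<circ> \<phi>) has_derivative (\<lambda>(s, t). e * s + k * t)) (at p)"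
  shows "((\<lambda>w. g (\<phi> w)) has_derivative (\<lambda>(s, t). (a * c + b * e) * s + (a * d + b * k) * (t :: complex))) (at p)"
proof -
  have "((\<lambda>w. (fst (\<phi> w), snd (\<phi> w))) has_derivative (\<lambda>w. (case w of (s, t) \<Rightarrow> c * s + d * t, case w of (s, t) \<Rightarrow> e * s + k * t))) (at p)"
    using has_derivative_Pair[OF 1 2] by (simp add: o_def)
  then have "(\<phi> has_derivative (\<lambda>w. (case w of (s, t) \<Rightarrow> c * s + d * t, case w of (s, t) \<Rightarrow> e * s + k * t))) (at p)"
    by simp
  from diff_chain_at[OF this g] show ?thesis
    by (simp add: o_def case_prod_unfold algebra_simps)
qed

lemma holomorphic2_on_add [intro]:
  assumes "holomorphic2_on f U" "holomorphic2_on g U"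
  shows "holomorphic2_on (\<lambda>w. f w + g w) U"
  unfolding holomorphic2_on_def
proof
  fix p assume "p \<in> U"
  then obtain a b c d where *: "(f has_derivative (\<lambda>(s, t). a * s + b * t)) (at p)"
    "(g has_derivative (\<lambda>(s, t). c * s + d * t)) (at p)" using assms unfolding holomorphic2_on_def by metis
  show "\<exists>a b. ((\<lambda>w. f w + g w) has_derivative (\<lambda>(s, t). a * s + b * t)) (at p)"
    using has_derivative_add[OF *]
    by (intro exI[of _ "a + c"] exI[of _ "b + d"]) (simp add: case_prod_unfold algebra_simps)
qed

lemma holomorphic2_on_mult [intro]:
  assumes "holomorphic2_on f U" "holomorphic2_on g U"
  shows "holomorphic2_on (\<lambda>w. f w * g w) U"
  unfolding holomorphic2_on_def
proof
  fix p assume "p \<in> U"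
  then obtain a b c d where *: "(f has_derivative (\<lambda>(s, t). a * s + b * t)) (at p)"
    "(g has_derivative (\<lambda>(s, t). c * s + d * t)) (at p)" using assms unfolding holomorphic2_on_def by metis
  show "\<exists>a b. ((\<lambda>w. f w * g w) has_derivative (\<lambda>(s, t). a * s + b * t)) (at p)"
    using has_complex_derivative_mult[OF *] by blast
qed

lemma holomorphic2_on_inverse [intro]:
  assumes "holomorphic2_on f U" "\<And>w. w \<in> U \<Longrightarrow> f w \<noteq> 0"
  shows "holomorphic2_on (\<lambda>w. inverse (f w)) U"
  unfolding holomorphic2_on_def
proof
  fix p assume p: "p \<in> U"
  then obtain a b where *: "(f has_derivative (\<lambda>(s, t). a * s + b * t)) (at p)"
    using assms unfolding holomorphic2_on_def by metis
  show "\<exists>a b. ((\<lambda>w. inverse (f w)) has_derivative (\<lambda>(s, t). a * s + b * t)) (at p)"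
    using Deriv.has_derivative_inverse[OF assms(2)[OF p] *]
    by (intro exI[of _ "- (inverse (f p) * a * inverse (f p))"] exI[of _ "- (inverse (f p) * b * inverse (f p))"])
      (simp add: case_prod_unfold algebra_simps)
qed

lemma holomorphic2_on_divide [intro]:
  assumes "holomorphic2_on f U" "holomorphic2_on g U" "\<And>w. w \<in> U \<Longrightarrow> g w \<noteq> 0"
  shows "holomorphic2_on (\<lambda>w. f w / g w) U"
  unfolding divide_inverse by (rule holomorphic2_on_mult[OF assms(1) holomorphic2_on_inverse[OF assms(2,3)]])

lemma holomorphic2_on_diff [intro]:
  assumes "holomorphic2_on f U" "holomorphic2_on g U"
  shows "holomorphic2_on (\<lambda>w. f w - g w) U"
proof -
  have "holomorphic2_on (\<lambda>w. f w + (- 1) * g w) U"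
    by (rule holomorphic2_on_add[OF assms(1) holomorphic2_on_mult[OF holomorphic2_on_const assms(2)]])
  then show ?thesis by simp
qed

lemma holomorphic2_on_compose:
  assumes "holomorphic2_on g V" "holomorphic2_on (fst \<circ> \<phi>) U" "holomorphic2_on (snd \<circ> \<phi>) U" "\<phi> ` U \<subseteq> V"
  shows "holomorphic2_on (\<lambda>w. g (\<phi> w)) U"
  unfolding holomorphic2_on_def
proof
  fix p assume p: "p \<in> U"
  then have "\<phi> p \<in> V" using assms by blast
  then obtain a b c d e k where "(g has_derivative (\<lambda>(s, t). a * s + b * t)) (at (\<phi> p))"
    "((fst \<circ> \<phi>) has_derivative (\<lambda>(s, t). c * s + d * t)) (at p)"
    "((snd \<circ> \<phi>) has_derivative (\<lambda>(s, t). e * s + k * t)) (at p)"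
    using assms p unfolding holomorphic2_on_def by metis
  then show "\<exists>a b. ((\<lambda>w. g (\<phi> w)) has_derivative (\<lambda>(s, t). a * s + b * t)) (at p)"
    using has_complex_derivative_compose by blast
qed

lemma holomorphic2_on_imp_continuous_on: "holomorphic2_on h U \<Longrightarrow> continuous_on U h"
  unfolding holomorphic2_on_def
  by (meson continuous_at_imp_continuous_on has_derivative_continuous)

lemma continuous_on_pair_components:
  "holomorphic2_on (fst \<circ> \<phi>) U \<Longrightarrow> holomorphic2_on (snd \<circ> \<phi>) U \<Longrightarrow> continuous_on U \<phi>"
  using continuous_on_Pair[of U "fst \<circ> \<phi>" "snd \<circ> \<phi>"] holomorphic2_on_imp_continuous_on by fastforce


section \<open>Local biholomorphisms\<close>

text \<open>Two maps that are inverse to each other only where both are defined are restricted to suitable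
  neighbourhoods of 0.\<close>

lemma local_biholomorphismI:
  assumes A: "open A" "0 \<in> A" and B: "open B" "0 \<in> B" and 0: "\<phi> 0 = 0" "\<psi> 0 = 0"
    and hol: "holomorphic2_on (fst \<circ> \<phi>) A" "holomorphic2_on (snd \<circ> \<phi>) A"
      "holomorphic2_on (fst \<circ> \<psi>) B" "holomorphic2_on (snd \<circ> \<psi>) B"
    and inv: "\<And>w. w \<in> A \<Longrightarrow> \<phi> w \<in> B \<Longrightarrow> \<psi> (\<phi> w) = w" "\<And>z. z \<in> B \<Longrightarrow> \<psi> z \<in> A \<Longrightarrow> \<phi> (\<psi> z) = z"
  shows "local_biholomorphism (A \<inter> \<phi> -` B) (B \<inter> \<psi> -` A) \<phi>"
  unfolding local_biholomorphism_def
proof (intro conjI exI)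
  have cont: "continuous_on A \<phi>" "continuous_on B \<psi>"
    using hol continuous_on_pair_components by blast+
  show "open (A \<inter> \<phi> -` B)" "open (B \<inter> \<psi> -` A)"
    using A B cont continuous_open_preimage by blast+
  show "0 \<in> A \<inter> \<phi> -` B" "\<phi> 0 = 0" using A B 0 by auto
  show "homeomorphism (A \<inter> \<phi> -` B) (B \<inter> \<psi> -` A) \<phi> \<psi>"
  proof (rule homeomorphismI)
    show "\<phi> ` (A \<inter> \<phi> -` B) \<subseteq> B \<inter> \<psi> -` A"
    proof (rule image_subsetI)
      fix w assume "w \<in> A \<inter> \<phi> -` B"
      then show "\<phi> w \<in> B \<inter> \<psi> -` A" using inv(1)[of w] by simp
    qed
    show "\<psi> ` (B \<inter> \<psi> -` A) \<subseteq> A \<inter> \<phi> -` B"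
    proof (rule image_subsetI)
      fix z assume "z \<in> B \<inter> \<psi> -` A"
      then show "\<psi> z \<in> A \<inter> \<phi> -` B" using inv(2)[of z] by simp
    qed
  qed (use inv cont in \<open>auto intro: continuous_on_subset\<close>)
  show "holomorphic2_on (fst \<circ> \<phi>) (A \<inter> \<phi> -` B)" "holomorphic2_on (snd \<circ> \<phi>) (A \<inter> \<phi> -` B)"
    "holomorphic2_on (fst \<circ> \<psi>) (B \<inter> \<psi> -` A)" "holomorphic2_on (snd \<circ> \<psi>) (B \<inter> \<psi> -` A)"
    using hol holomorphic2_on_subset by blast+
qed

lemma local_biholomorphism_shrink:
  assumes "local_biholomorphism U V \<phi>" "open W" "0 \<in> W"
  shows "local_biholomorphism (U \<inter> W) (\<phi> ` (U \<inter> W)) \<phi>"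
proof -
  obtain \<psi> where h: "homeomorphism U V \<phi> \<psi>" "holomorphic2_on (fst \<circ> \<phi>) U" "holomorphic2_on (snd \<circ> \<phi>) U"
    "holomorphic2_on (fst \<circ> \<psi>) V" "holomorphic2_on (snd \<circ> \<psi>) V" "open U" "open V" "0 \<in> U" "\<phi> 0 = 0"
    using assms(1) unfolding local_biholomorphism_def by blast
  have img: "\<phi> ` (U \<inter> W) = V \<inter> \<psi> -` W"
    using h(1) unfolding homeomorphism_def by force
  have "continuous_on V \<psi>" using h(1) by (rule homeomorphism_cont2)
  then have "open (V \<inter> \<psi> -` W)" using assms(2) h(7) continuous_open_preimage by blast
  moreover have "homeomorphism (U \<inter> W) (\<phi> ` (U \<inter> W)) \<phi> \<psi>"
    using h(1) by (rule homeomorphism_of_subsets) (auto simp: homeomorphism_image1[OF h(1), symmetric])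
  ultimately show ?thesis
    unfolding local_biholomorphism_def img using h assms holomorphic2_on_subset
    by (metis (no_types, lifting) IntI inf_le1 open_Int)
qed

lemma local_biholomorphism_sym:
  assumes "local_biholomorphism U V \<phi>"
  obtains \<psi> where "local_biholomorphism V U \<psi>" "homeomorphism U V \<phi> \<psi>"
proof -
  obtain \<psi> where h: "homeomorphism U V \<phi> \<psi>" "holomorphic2_on (fst \<circ> \<phi>) U" "holomorphic2_on (snd \<circ> \<phi>) U"
    "holomorphic2_on (fst \<circ> \<psi>) V" "holomorphic2_on (snd \<circ> \<psi>) V" "open U" "open V" "0 \<in> U" "\<phi> 0 = 0"
    using assms(1) unfolding local_biholomorphism_def by blast
  have "0 \<in> V" "\<psi> 0 = 0" using h(1,8,9) unfolding homeomorphism_def by (metis image_eqI)+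
  then have "local_biholomorphism V U \<psi>"
    unfolding local_biholomorphism_def using h homeomorphism_symD by blast
  then show ?thesis using that h by blast
qed

lemma local_biholomorphism_compose:
  assumes 1: "local_biholomorphism U V \<phi>" and 2: "local_biholomorphism U' V' \<phi>'"
  shows "\<exists>W X. local_biholomorphism W X (\<phi> \<circ> \<phi>') \<and> W \<subseteq> U' \<and> \<phi>' ` W \<subseteq> U"
proof -
  obtain \<psi> where h: "homeomorphism U V \<phi> \<psi>" "local_biholomorphism V U \<psi>"
    using local_biholomorphism_sym[OF 1] by blast
  obtain \<psi>' where h': "homeomorphism U' V' \<phi>' \<psi>'" "local_biholomorphism V' U' \<psi>'"
    using local_biholomorphism_sym[OF 2] by blast
  define A where "A = U' \<inter> \<phi>' -` U"
  define B where "B = V \<inter> \<psi> -` V'"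
  have o: "open A" "open B"
    unfolding A_def B_def using h h' 1 2 homeomorphism_cont1 homeomorphism_cont2 continuous_open_preimage
    unfolding local_biholomorphism_def by metis+
  have "0 \<in> A" "0 \<in> B" "(\<phi> \<circ> \<phi>') 0 = 0" "(\<psi>' \<circ> \<psi>) 0 = 0"
    using h h' 1 2 unfolding A_def B_def local_biholomorphism_def by auto
  moreover have "holomorphic2_on (fst \<circ> (\<phi> \<circ> \<phi>')) A" "holomorphic2_on (snd \<circ> (\<phi> \<circ> \<phi>')) A"
    "holomorphic2_on (fst \<circ> (\<psi>' \<circ> \<psi>)) B" "holomorphic2_on (snd \<circ> (\<psi>' \<circ> \<psi>)) B"
    using holomorphic2_on_compose[of "fst \<circ> \<phi>" U \<phi>' A] holomorphic2_on_compose[of "snd \<circ> \<phi>" U \<phi>' A]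
      holomorphic2_on_compose[of "fst \<circ> \<psi>'" V' \<psi> B] holomorphic2_on_compose[of "snd \<circ> \<psi>'" V' \<psi> B]
      1 2 h h' unfolding A_def B_def local_biholomorphism_def
    by (auto simp: o_def intro: holomorphic2_on_subset)
  ultimately have "local_biholomorphism (A \<inter> (\<phi> \<circ> \<phi>') -` B) (B \<inter> (\<psi>' \<circ> \<psi>) -` A) (\<phi> \<circ> \<phi>')"
    using o h(1) h'(1) by (intro local_biholomorphismI) (auto simp: A_def B_def homeomorphism_def)
  then show ?thesis unfolding A_def by blast
qed


section \<open>Equivalence of germs\<close>

lemma germ_equivI:
  assumes "local_biholomorphism U V \<phi>" "open W" "0 \<in> W" "holomorphic2_on u W"
    "\<And>w. w \<in> U \<Longrightarrow> w \<in> W \<Longrightarrow> u w \<noteq> 0 \<and> g (\<phi> w) = u w * h w"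
  shows "germ_equiv g h"
  unfolding germ_equiv_def
  using local_biholomorphism_shrink[OF assms(1-3)] holomorphic2_on_subset[OF assms(4), of "U \<inter> W"] assms(5)
  by (metis IntE inf_le2)

lemma germ_equiv_sym:
  assumes "germ_equiv g h" shows "germ_equiv h g"
proof -
  obtain U V \<phi> u where *: "local_biholomorphism U V \<phi>" "holomorphic2_on u U"
    "\<And>w. w \<in> U \<Longrightarrow> u w \<noteq> 0 \<and> g (\<phi> w) = u w * h w" using assms unfolding germ_equiv_def by blast
  obtain \<psi> where \<psi>: "local_biholomorphism V U \<psi>" "homeomorphism U V \<phi> \<psi>"
    using local_biholomorphism_sym[OF *(1)] .
  have img: "\<psi> z \<in> U" "\<phi> (\<psi> z) = z" if "z \<in> V" for z using \<psi>(2) that unfolding homeomorphism_def by auto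
  have "holomorphic2_on (\<lambda>z. u (\<psi> z)) V"
    using holomorphic2_on_compose[OF *(2), of \<psi> V] \<psi>(1) image_subsetI[of V \<psi> U] img(1)
    unfolding local_biholomorphism_def by blast
  then have hol: "holomorphic2_on (\<lambda>z. inverse (u (\<psi> z))) V"
    by (rule holomorphic2_on_inverse) (use *(3) img in blast)
  have "inverse (u (\<psi> z)) \<noteq> 0 \<and> h (\<psi> z) = inverse (u (\<psi> z)) * g z" if "z \<in> V" for z
    using *(3)[OF img(1)[OF that]] img(2)[OF that] by simp
  then show ?thesis unfolding germ_equiv_def using \<psi>(1) hol by blast
qed

lemma germ_equiv_trans:
  assumes "germ_equiv g h" "germ_equiv h k" shows "germ_equiv g k"
proof -
  obtain U V \<phi> u where 1: "local_biholomorphism U V \<phi>" "holomorphic2_on u U"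
    "\<And>w. w \<in> U \<Longrightarrow> u w \<noteq> 0 \<and> g (\<phi> w) = u w * h w" using assms(1) unfolding germ_equiv_def by blast
  obtain U' V' \<phi>' u' where 2: "local_biholomorphism U' V' \<phi>'" "holomorphic2_on u' U'"
    "\<And>w. w \<in> U' \<Longrightarrow> u' w \<noteq> 0 \<and> h (\<phi>' w) = u' w * k w" using assms(2) unfolding germ_equiv_def by blast
  obtain W X where W: "local_biholomorphism W X (\<phi> \<circ> \<phi>')" "W \<subseteq> U'" "\<phi>' ` W \<subseteq> U"
    using local_biholomorphism_compose[OF 1(1) 2(1)] by blast
  have "holomorphic2_on (fst \<circ> \<phi>') W" "holomorphic2_on (snd \<circ> \<phi>') W"
    using 2(1) W(2) holomorphic2_on_subset unfolding local_biholomorphism_def by blast+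
  then have "holomorphic2_on (\<lambda>w. u (\<phi>' w)) W" using holomorphic2_on_compose[OF 1(2)] W(3) by blast
  moreover have "holomorphic2_on u' W" using 2(2) W(2) by (rule holomorphic2_on_subset)
  ultimately have "holomorphic2_on (\<lambda>w. u (\<phi>' w) * u' w) W" by (rule holomorphic2_on_mult)
  moreover have "u (\<phi>' w) * u' w \<noteq> 0 \<and> g ((\<phi> \<circ> \<phi>') w) = u (\<phi>' w) * u' w * k w" if "w \<in> W" for w
  proof -
    have "w \<in> U'" "\<phi>' w \<in> U" using that W by auto
    then show ?thesis using 1(3)[of "\<phi>' w"] 2(3)[of w] by simp
  qed
  ultimately show ?thesis unfolding germ_equiv_def using W(1) by blast
qed


section \<open>Ordinary germs\<close>

text \<open>The derivative of the inverse map is inverse to the derivative, by the chain rule.\<close>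

lemma jacobian_nonzero:
  assumes bi: "local_biholomorphism U V \<phi>"
    and 1: "((fst \<circ> \<phi>) has_derivative (\<lambda>(s, t). c * s + d * t)) (at 0)"
    and 2: "((snd \<circ> \<phi>) has_derivative (\<lambda>(s, t). e * s + k * t)) (at 0)"
  shows "c * k - d * e \<noteq> 0"
proof
  assume det: "c * k - d * e = 0"
  obtain \<psi> where \<psi>: "local_biholomorphism V U \<psi>" "homeomorphism U V \<phi> \<psi>"
    using local_biholomorphism_sym[OF bi] .
  have U: "open U" "0 \<in> U" "\<phi> 0 = 0" "0 \<in> V"
    using bi \<psi>(1) unfolding local_biholomorphism_def by auto
  have hol: "holomorphic2_on (fst \<circ> \<psi>) V" "holomorphic2_on (snd \<circ> \<psi>) V"
    using \<psi>(1) unfolding local_biholomorphism_def by auto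
  obtain a b where ab: "((fst \<circ> \<psi>) has_derivative (\<lambda>(s, t). a * s + b * t)) (at (\<phi> 0))"
    using hol U unfolding holomorphic2_on_def by metis
  obtain a' b' where ab': "((snd \<circ> \<psi>) has_derivative (\<lambda>(s, t). a' * s + b' * t)) (at (\<phi> 0))"
    using hol U unfolding holomorphic2_on_def by metis
  have inv: "\<psi> (\<phi> w) = w" if "w \<in> U" for w using \<psi>(2) that unfolding homeomorphism_def by auto
  have f: "((\<lambda>w. fst w) has_derivative (\<lambda>(s, t). (a * c + b * e) * s + (a * d + b * k) * t)) (at 0)"
    by (rule has_derivative_transform_within_open[OF has_complex_derivative_compose[OF ab 1 2] U(1,2)])
      (simp add: inv)
  have s: "((\<lambda>w. snd w) has_derivative (\<lambda>(s, t). (a' * c + b' * e) * s + (a' * d + b' * k) * t)) (at 0)"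
    by (rule has_derivative_transform_within_open[OF has_complex_derivative_compose[OF ab' 1 2] U(1,2)])
      (simp add: inv)
  have "(\<lambda>(s, t). (a * c + b * e) * s + (a * d + b * k) * t) = fst"
    by (rule has_derivative_unique[OF f]) (rule has_derivative_fst[OF has_derivative_ident])
  moreover have "(\<lambda>(s, t). (a' * c + b' * e) * s + (a' * d + b' * k) * t) = snd"
    by (rule has_derivative_unique[OF s]) (rule has_derivative_snd[OF has_derivative_ident])
  ultimately have "a * c + b * e = 1" "a * d + b * k = 0" "a' * c + b' * e = 0" "a' * d + b' * k = 1"
    by (auto dest: fun_cong[of _ _ "(1, 0)"] fun_cong[of _ _ "(0, 1)"])
  then have "(a * b' - b * a') * (c * k - d * e) = 1" by algebra
  then show False using det by simp
qed

lemma ordinary_germE: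
  assumes "ordinary_germ m g"
  obtains U H a b where "open U" "0 \<in> U"
     "\<forall>w\<in>U. g w = (\<Prod>i<m. H i w)"
     "\<forall>i<m. holomorphic2_on (H i) U"  "\<forall>i<m. H i 0 = 0"
     "\<forall>i<m. (H i has_derivative (\<lambda>(s, t). a i * s + b i * t)) (at 0)"
     "\<forall>i<m. a i \<noteq> 0 \<or> b i \<noteq> 0"
     "\<forall>i<m. \<forall>j<m. i \<noteq> j \<longrightarrow> a i * b j \<noteq> a j * b i"
proof -
  obtain U H a b where *: "open U \<and> 0 \<in> U \<and> (\<forall>w\<in>U. g w = (\<Prod>i<m. H i w)) \<and>
     (\<forall>i<m. holomorphic2_on (H i) U \<and> H i 0 = 0 \<and>
        (H i has_derivative (\<lambda>(s, t). a i * s + b i * t)) (at 0) \<and> (a i \<noteq> 0 \<or> b i \<noteq> 0)) \<and>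
     (\<forall>i<m. \<forall>j<m. i \<noteq> j \<longrightarrow> a i * b j \<noteq> a j * b i)"
    using assms unfolding ordinary_germ_def by (elim exE)
  show ?thesis by (rule that[of U H a b]) (use * in blast)+
qed

text \<open>The branches are transported along the coordinate change; the unit is absorbed into branch 0, which
  is why at least one branch is required. The tangents stay pairwise different because the Jacobian
  determinant is not zero.\<close>

lemma ordinary_germ_equiv:
  assumes g: "ordinary_germ m g" and equiv: "germ_equiv g h" and m: "0 < m"
  shows "ordinary_germ m h"
proof -
  from g obtain U\<^sub>1 H a b where U\<^sub>1: "open U\<^sub>1" "0 \<in> U\<^sub>1"
    and g_eq: "\<forall>w\<in>U\<^sub>1. g w = (\<Prod>i<m. H i w)"
    and hol: "\<forall>i<m. holomorphic2_on (H i) U\<^sub>1" and zero: "\<forall>i<m. H i 0 = 0"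
    and der: "\<forall>i<m. (H i has_derivative (\<lambda>(s, t). a i * s + b i * t)) (at 0)"
    and nz: "\<forall>i<m. a i \<noteq> 0 \<or> b i \<noteq> 0"
    and trans: "\<forall>i<m. \<forall>j<m. i \<noteq> j \<longrightarrow> a i * b j \<noteq> a j * b i"
    by (rule ordinary_germE)
  note g_eq = g_eq[rule_format] and trans = trans[rule_format]
    and H = hol[rule_format] zero[rule_format] der[rule_format] nz[rule_format]
  obtain U V \<phi> u where bi: "local_biholomorphism U V \<phi>" and u: "holomorphic2_on u U"
    and eq: "\<And>w. w \<in> U \<Longrightarrow> u w \<noteq> 0 \<and> g (\<phi> w) = u w * h w" using equiv unfolding germ_equiv_def by blast
  have U: "open U" "0 \<in> U" "\<phi> 0 = 0" "holomorphic2_on (fst \<circ> \<phi>) U" "holomorphic2_on (snd \<circ> \<phi>) U"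
    using bi unfolding local_biholomorphism_def by auto
  obtain c d where cd: "((fst \<circ> \<phi>) has_derivative (\<lambda>(s, t). c * s + d * t)) (at 0)"
    using U unfolding holomorphic2_on_def by metis
  obtain e k where ek: "((snd \<circ> \<phi>) has_derivative (\<lambda>(s, t). e * s + k * t)) (at 0)"
    using U unfolding holomorphic2_on_def by metis
  have det: "c * k - d * e \<noteq> 0" using jacobian_nonzero[OF bi cd ek] .
  define W where "W = U \<inter> \<phi> -` U\<^sub>1"
  define v where "v = (\<lambda>i w. if i = (0::nat) then inverse (u w) else 1)"
  define K where "K = (\<lambda>i w. v i w * H i (\<phi> w))"
  have W: "open W" "0 \<in> W"
    unfolding W_def using U U\<^sub>1
    by (auto intro!: continuous_open_preimage continuous_on_pair_components)
  have v_hol: "holomorphic2_on (v i) U" for i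
    unfolding v_def using holomorphic2_on_inverse[OF u] eq holomorphic2_on_const[of 1 U]
    by (cases "i = 0") simp_all
  have v_nz: "v i w \<noteq> 0" if "w \<in> U" for i w using eq[OF that] by (simp add: v_def)
  define A where "A = (\<lambda>i. v i 0 * (a i * c + b i * e))"
  define B where "B = (\<lambda>i. v i 0 * (a i * d + b i * k))"
  show ?thesis
    unfolding ordinary_germ_def
  proof (intro exI conjI allI impI ballI)
    show "open W" "0 \<in> W" by fact+
    show "h w = (\<Prod>i<m. K i w)" if "w \<in> W" for w
    proof -
      have "(\<Prod>i<m. v i w) = inverse (u w)"
        unfolding v_def using m by (subst prod.delta) auto
      moreover have "g (\<phi> w) = (\<Prod>i<m. H i (\<phi> w))" using g_eq that unfolding W_def by simp
      ultimately show ?thesis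
        using eq[of w] that unfolding K_def W_def by (simp add: prod.distrib)
    qed
    fix i assume i: "i < m"
    have comp: "holomorphic2_on (\<lambda>w. H i (\<phi> w)) W"
      by (rule holomorphic2_on_compose[OF H(1)[OF i]])
        (use U holomorphic2_on_subset in \<open>auto simp: W_def intro: holomorphic2_on_subset\<close>)
    then show "holomorphic2_on (K i) W"
      unfolding K_def using holomorphic2_on_mult[OF holomorphic2_on_subset[OF v_hol]] by (auto simp: W_def)
    show "K i 0 = 0" using H(2)[OF i] U(3) by (simp add: K_def)
    have "((\<lambda>w. H i (\<phi> w)) has_derivative (\<lambda>(s, t). (a i * c + b i * e) * s + (a i * d + b i * k) * t)) (at 0)"
      using has_complex_derivative_compose[OF _ cd ek] H(3)[OF i] U(3) by metis
    moreover obtain p q where "(v i has_derivative (\<lambda>(s, t). p * s + q * t)) (at 0)"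
      using v_hol U(2) unfolding holomorphic2_on_def by metis
    ultimately show "(K i has_derivative (\<lambda>(s, t). A i * s + B i * t)) (at 0)"
      using has_complex_derivative_mult[of "v i" p q 0 "\<lambda>w. H i (\<phi> w)"] H(2)[OF i] U(3)
      unfolding K_def A_def B_def by simp
    have "(a i * c + b i * e) * k - (a i * d + b i * k) * e = a i * (c * k - d * e)"
      "(a i * d + b i * k) * c - (a i * c + b i * e) * d = b i * (c * k - d * e)" by (simp_all add: algebra_simps)
    then show "A i \<noteq> 0 \<or> B i \<noteq> 0"
      using H(4)[OF i] det v_nz[OF U(2), of i] unfolding A_def B_def
      by (metis cancel_comm_monoid_add_class.diff_cancel mult_eq_0_iff mult_zero_left)
  next
    fix i j assume ij: "i < m" "j < m" "i \<noteq> j"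
    have "A i * B j - A j * B i = v i 0 * v j 0 * (a i * b j - a j * b i) * (c * k - d * e)"
      by (simp add: A_def B_def algebra_simps)
    then show "A i * B j \<noteq> A j * B i"
      using trans[OF ij] det v_nz[OF U(2)] by (metis cancel_comm_monoid_add_class.diff_cancel eq_iff_diff_eq_0 mult_eq_0_iff)
  qed
qed

text \<open>The restriction of \<open>g\<close> to the line \<open>t = s \<tau>\<close> has the leading coefficient \<open>\<Prod>(a\<^sub>i + b\<^sub>i \<tau>)\<close>, which is
  not zero unless \<open>\<tau>\<close> is one of the finitely many slopes of the branches.\<close>

lemma ordinary_germ_limit:
  assumes "ordinary_germ m g"
  obtains a b :: "nat \<Rightarrow> complex" where "\<forall>i<m. a i \<noteq> 0 \<or> b i \<noteq> 0"
    "\<forall>\<tau>. ((\<lambda>r. g (r, r * \<tau>) / r ^ m) \<longlongrightarrow> (\<Prod>i<m. a i + b i * \<tau>)) (at 0)"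
proof -
  from assms obtain U H a b where U: "open U" "0 \<in> U"
    and g_eq: "\<forall>w\<in>U. g w = (\<Prod>i<m. H i w)"
    and hol: "\<forall>i<m. holomorphic2_on (H i) U" and zero: "\<forall>i<m. H i 0 = 0"
    and der: "\<forall>i<m. (H i has_derivative (\<lambda>(s, t). a i * s + b i * t)) (at 0)"
    and nz: "\<forall>i<m. a i \<noteq> 0 \<or> b i \<noteq> 0"
    and trans: "\<forall>i<m. \<forall>j<m. i \<noteq> j \<longrightarrow> a i * b j \<noteq> a j * b i"
    by (rule ordinary_germE)
  note g_eq = g_eq[rule_format] and H = zero[rule_format] der[rule_format] nz[rule_format]
  show ?thesis
  proof (rule that[of a b]; intro allI impI)
    show "a i \<noteq> 0 \<or> b i \<noteq> 0" if "i < m" for i using H(3) that .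
    fix \<tau> :: complex
    define L where "L = (\<lambda>r :: complex. (r, r * \<tau>))"
    have L: "(L has_derivative L) (at 0)"
      unfolding L_def by (auto intro!: derivative_eq_intros)
    have L0: "L 0 = 0" by (simp add: L_def zero_prod_def)
    have "((\<lambda>r. H i (L r) / r) \<longlongrightarrow> a i + b i * \<tau>) (at 0)" if "i < m" for i
    proof -
      have "(H i has_derivative (\<lambda>(s, t). a i * s + b i * t)) (at (L 0))" using H(2)[OF that] L0 by simp
      from diff_chain_at[OF L this]
      have "((\<lambda>r. H i (L r)) has_field_derivative (a i + b i * \<tau>)) (at 0)"
        unfolding has_field_derivative_def o_def
        by (rule has_derivative_eq_rhs) (simp_all add: o_def L_def fun_eq_iff algebra_simps)
      then show ?thesis using H(1)[OF that] L0 by (simp add: DERIV_def)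
    qed
    then have "((\<lambda>r. \<Prod>i<m. H i (L r) / r) \<longlongrightarrow> (\<Prod>i<m. a i + b i * \<tau>)) (at 0)"
      by (intro tendsto_prod) auto
    moreover have "eventually (\<lambda>r. L r \<in> U) (at 0)"
    proof -
      have "isCont L 0" using L has_derivative_continuous by blast
      then have "(L \<longlongrightarrow> 0) (at 0)" using L0 by (simp add: isCont_def)
      then show ?thesis using topological_tendstoD U by blast
    qed
    then have "eventually (\<lambda>r. (\<Prod>i<m. H i (L r) / r) = g (r, r * \<tau>) / r ^ m) (at 0)"
      by eventually_elim (simp add: g_eq prod_dividef L_def)
    ultimately show "((\<lambda>r. g (r, r * \<tau>) / r ^ m) \<longlongrightarrow> (\<Prod>i<m. a i + b i * \<tau>)) (at 0)"
      by (rule Lim_transform_eventually)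
  qed
qed

text \<open>On a line that is not tangent to any branch, \<open>g\<close> vanishes to order exactly \<open>m\<close>, whereas \<open>n\<close> branches
  make it vanish to order at least \<open>n\<close>.\<close>

lemma ordinary_germ_less_False:
  assumes "ordinary_germ m g" "ordinary_germ n g" "m < n"
  shows False
proof -
  obtain a b :: "nat \<Rightarrow> complex" where ab: "\<forall>i<m. a i \<noteq> 0 \<or> b i \<noteq> 0"
    "\<forall>\<tau>. ((\<lambda>r. g (r, r * \<tau>) / r ^ m) \<longlongrightarrow> (\<Prod>i<m. a i + b i * \<tau>)) (at 0)"
    using ordinary_germ_limit[OF assms(1)] .
  obtain c d :: "nat \<Rightarrow> complex" where "\<forall>i<n. c i \<noteq> 0 \<or> d i \<noteq> 0" and cd:
    "\<forall>\<tau>. ((\<lambda>r. g (r, r * \<tau>) / r ^ n) \<longlongrightarrow> (\<Prod>i<n. c i + d i * \<tau>)) (at 0)"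
    using ordinary_germ_limit[OF assms(2)] .
  note ab = ab[rule_format] and cd = cd[rule_format]
  have "finite ((\<lambda>i. - a i / b i) ` {..<m})" by simp
  then obtain \<tau> where \<tau>: "\<tau> \<notin> (\<lambda>i. - a i / b i) ` {..<m}"
    using ex_new_if_finite[OF infinite_UNIV_char_0] by blast
  have "a i + b i * \<tau> \<noteq> 0" if "i < m" for i
  proof
    assume z: "a i + b i * \<tau> = 0"
    then have "b i \<noteq> 0" using ab(1)[OF that] by auto
    then have "\<tau> = - a i / b i" using z by (simp add: field_simps eq_neg_iff_add_eq_0)
    then show False using \<tau> that by blast
  qed
  then have nz: "(\<Prod>i<m. a i + b i * \<tau>) \<noteq> 0" by simp
  have lim: "((\<lambda>r. g (r, r * \<tau>) / r ^ n * r ^ (n - m)) \<longlongrightarrow> (\<Prod>i<n. c i + d i * \<tau>) * 0 ^ (n - m)) (at 0)"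
    by (intro tendsto_intros cd)
  have "eventually (\<lambda>r :: complex. r \<noteq> 0) (at 0)" by (simp add: eventually_at_filter)
  then have ev: "eventually (\<lambda>r. g (r, r * \<tau>) / r ^ n * r ^ (n - m) = g (r, r * \<tau>) / r ^ m) (at 0)"
  proof eventually_elim
    case (elim r)
    have "r ^ n = r ^ m * r ^ (n - m)" using assms(3) by (simp flip: power_add)
    then show ?case using elim by simp
  qed
  have "(\<Prod>i<n. c i + d i * \<tau>) * 0 ^ (n - m) = 0" using assms(3) by simp
  then have "((\<lambda>r. g (r, r * \<tau>) / r ^ m) \<longlongrightarrow> 0) (at 0)"
    using Lim_transform_eventually[OF lim ev] by metis
  then show False using tendsto_unique[OF trivial_limit_at ab(2)[of \<tau>]] nz by metis
qed

lemma ordinary_germ_unique: "ordinary_germ m g \<Longrightarrow> ordinary_germ n g \<Longrightarrow> m = n"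
  using ordinary_germ_less_False by (metis linorder_neqE_nat)


section \<open>Affine charts\<close>

lemma triple_span_UNIV:
  fixes v a b :: "complex^3"
  shows "vec.span {v, a, b} = UNIV \<longleftrightarrow> (\<forall>w. \<exists>x y z. w = x *s v + y *s a + z *s b)"
proof -
  have "w \<in> vec.span {v, a, b} \<longleftrightarrow> (\<exists>x y z. w = x *s v + y *s a + z *s b)" for w
  proof -
    have "w \<in> vec.span {v, a, b} \<longleftrightarrow> (\<exists>x y z. w - x *s v - y *s a - z *s b = 0)"
      by (simp add: vec.span_breakdown_eq)
    also have "\<dots> \<longleftrightarrow> (\<exists>x y z. w = x *s v + y *s a + z *s b)"
      by (simp add: diff_eq_eq algebra_simps)
    finally show ?thesis .
  qed
  then show ?thesis by auto
qed

lemma triple_independent: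
  fixes v a b :: "complex^3"
  assumes "vec.span {v, a, b} = UNIV" "x *s v + y *s a + z *s b = x' *s v + y' *s a + z' *s b"
  shows "x = x' \<and> y = y' \<and> z = z'"
proof -
  define L where "L = (\<lambda>u :: complex^3. u $ 1 *s v + u $ 2 *s a + u $ 3 *s b)"
  have lin: "Vector_Spaces.linear (*s) (*s) L"
    unfolding Vector_Spaces.linear_iff
    by (simp add: vec.vector_space_axioms) (simp_all add: L_def vec_eq_iff algebra_simps)
  have "surj L"
  proof -
    have "w \<in> range L" for w
    proof -
      obtain x y z where "w = x *s v + y *s a + z *s b" using assms(1) unfolding triple_span_UNIV by blast
      then have "w = L (vector [x, y, z])" by (simp add: L_def)
      then show ?thesis by blast
    qed
    then show ?thesis by auto
  qed
  then have "inj L" using vec.linear_surjective_imp_injective lin by blast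
  moreover have "L (vector [x, y, z]) = L (vector [x', y', z'])" using assms(2) by (simp add: L_def)
  ultimately have "vector [x, y, z] = (vector [x', y', z'] :: complex^3)" by (rule injD)
  then show ?thesis by (simp add: vec_eq_iff forall_3)
qed

text \<open>Two charts centred at the same point differ by a fractional linear map \<open>\<Phi>\<close> with denominator \<open>\<mu>\<close>, and
  the equations by the unit \<open>\<mu>\<^sup>d\<close>, where \<open>d\<close> is the degree of the curve.\<close>

lemma charts_equiv:
  assumes f: "homogeneous d f" and 1: "local_equation f p g" and 2: "local_equation f p g'"
  shows "germ_equiv g g'"
proof -
  obtain v a b where vab: "p = vec.span {v}" "vec.span {v, a, b} = UNIV"
    and g: "g = (\<lambda>(s, t). eval f (v + s *s a + t *s b))" using 1 unfolding local_equation_def by blast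
  obtain v' a' b' where vab': "p = vec.span {v'}" "vec.span {v', a', b'} = UNIV"
    and g': "g' = (\<lambda>(s, t). eval f (v' + s *s a' + t *s b'))" using 2 unfolding local_equation_def by blast
  \<comment> \<open>the vectors of the second chart in terms of those of the first\<close>
  define transition where "transition = (\<lambda>v a b v' a' b' x0 x1 x2 x3 y1 y2 y3. x0 \<noteq> (0 :: complex) \<and>
    v' = x0 *s v \<and> a' = x1 *s v + x2 *s a + x3 *s b \<and> b' = y1 *s v + y2 *s a + y3 *s (b :: complex^3))"
  define \<mu> where "\<mu> = (\<lambda>x0 x1 y1 w. x0 + x1 * fst w + y1 * snd w :: complex)"
  define \<Phi> where "\<Phi> = (\<lambda>x0 x1 x2 x3 y1 y2 y3 w. ((x2 * fst w + y2 * snd w) / \<mu> x0 x1 y1 w,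
    (x3 * fst w + y3 * snd w) / \<mu> x0 x1 y1 w))"
  define C where "C = (\<lambda>v a b w. v + fst w *s a + snd w *s (b :: complex^3))"
  have ex: "\<exists>x0 x1 x2 x3 y1 y2 y3. transition v a b v' a' b' x0 x1 x2 x3 y1 y2 y3"
    if v: "vec.span {v} = vec.span {v'}" "vec.span {v, a, b} = UNIV" "vec.span {v', a', b'} = UNIV"
    for v a b v' a' b'
  proof -
    have "v' \<noteq> 0"
      using triple_independent[OF v(3), of 1 0 0 0 0 0] by auto
    then obtain x0 where "x0 \<noteq> 0" "v' = x0 *s v" using span_singleton_eqD[of v' v] v(1) by metis
    then show ?thesis using v(2) unfolding transition_def triple_span_UNIV by metis
  qed
  have chart: "C v' a' b' w = \<mu> x0 x1 y1 w *s C v a b (\<Phi> x0 x1 x2 x3 y1 y2 y3 w)"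
    if "transition v a b v' a' b' x0 x1 x2 x3 y1 y2 y3" "\<mu> x0 x1 y1 w \<noteq> 0"
    for v a b v' a' b' x0 x1 x2 x3 y1 y2 y3 w
  proof -
    define m where "m = \<mu> x0 x1 y1 w"
    have m: "m \<noteq> 0" "m = x0 + x1 * fst w + y1 * snd w" using that(2) by (simp_all add: m_def \<mu>_def)
    have eq: "m * (p + x / m * q + y / m * r) = m * p + x * q + y * r" for p q r x y
      using m(1) by (simp add: distrib_left)
    show ?thesis
      using that(1) unfolding transition_def \<Phi>_def C_def m_def[symmetric]
      by (simp add: vec_eq_iff eq) (use m(1) in \<open>simp add: m(2) algebra_simps\<close>)
  qed
  have inv: "\<Phi> x0' x1' x2' x3' y1' y2' y3' (\<Phi> x0 x1 x2 x3 y1 y2 y3 w) = w"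
    if T: "transition v a b v' a' b' x0 x1 x2 x3 y1 y2 y3"
      and T': "transition v' a' b' v a b x0' x1' x2' x3' y1' y2' y3'"
      and span: "vec.span {v', a', b'} = UNIV"
      and nz: "\<mu> x0 x1 y1 w \<noteq> 0" "\<mu> x0' x1' y1' (\<Phi> x0 x1 x2 x3 y1 y2 y3 w) \<noteq> 0"
    for v a b v' a' b' x0 x1 x2 x3 y1 y2 y3 x0' x1' x2' x3' y1' y2' y3' w
  proof -
    define z where "z = \<Phi> x0' x1' x2' x3' y1' y2' y3' (\<Phi> x0 x1 x2 x3 y1 y2 y3 w)"
    obtain k where k: "C v' a' b' w = k *s C v' a' b' z"
      using chart[OF T nz(1)] chart[OF T' nz(2)] unfolding z_def by (metis vector_smult_assoc)
    then have "1 *s v' + fst w *s a' + snd w *s b' = k *s v' + (k * fst z) *s a' + (k * snd z) *s b'"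
      unfolding C_def by (simp add: vec_eq_iff algebra_simps)
    from triple_independent[OF span this] have "w = z" by (simp add: prod_eq_iff)
    then show ?thesis unfolding z_def by simp
  qed
  obtain x0 x1 x2 x3 y1 y2 y3 where T: "transition v a b v' a' b' x0 x1 x2 x3 y1 y2 y3"
    using ex[of v v' a b a' b'] vab vab' by metis
  obtain x0' x1' x2' x3' y1' y2' y3' where T': "transition v' a' b' v a b x0' x1' x2' x3' y1' y2' y3'"
    using ex[of v' v a' b' a b] vab vab' by metis
  let ?m = "\<mu> x0 x1 y1" and ?\<phi> = "\<Phi> x0 x1 x2 x3 y1 y2 y3"
  let ?m' = "\<mu> x0' x1' y1'" and ?\<phi>' = "\<Phi> x0' x1' x2' x3' y1' y2' y3'"
  have hol_lin: "holomorphic2_on (\<lambda>w. x * fst w + y * snd w) U" for x y U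
    by (intro holomorphic2_on_add holomorphic2_on_mult holomorphic2_on_const holomorphic2_on_fst holomorphic2_on_snd)
  have hol_m: "holomorphic2_on (\<mu> x y z) U" for x y z U
    unfolding \<mu>_def add.assoc by (intro holomorphic2_on_add[OF holomorphic2_on_const] hol_lin)
  have op: "open {w. \<mu> x y z w \<noteq> 0}" for x y z
    unfolding \<mu>_def by (intro open_Collect_neq continuous_intros)
  have hol_\<Phi>: "holomorphic2_on (fst \<circ> \<Phi> x x1 x2 x3 y1 y2 y3) {w. \<mu> x x1 y1 w \<noteq> 0}"
    "holomorphic2_on (snd \<circ> \<Phi> x x1 x2 x3 y1 y2 y3) {w. \<mu> x x1 y1 w \<noteq> 0}" for x x1 x2 x3 y1 y2 y3
    unfolding \<Phi>_def o_def fst_conv snd_conv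
    by (intro holomorphic2_on_divide hol_lin hol_m; simp)+
  have nz: "x0 \<noteq> 0" "x0' \<noteq> 0" using T T' unfolding transition_def by auto
  have zero: "\<Phi> x x1 x2 x3 y1 y2 y3 0 = 0" for x x1 x2 x3 y1 y2 y3
    by (simp add: \<Phi>_def zero_prod_def)
  have bi: "local_biholomorphism ({w. ?m w \<noteq> 0} \<inter> ?\<phi> -` {w. ?m' w \<noteq> 0}) ({w. ?m' w \<noteq> 0} \<inter> ?\<phi>' -` {w. ?m w \<noteq> 0}) ?\<phi>"
  proof (rule local_biholomorphismI)
    show "0 \<in> {w. ?m w \<noteq> 0}" "0 \<in> {w. ?m' w \<noteq> 0}" using nz by (simp_all add: \<mu>_def)
    show "?\<phi>' (?\<phi> w) = w" if "w \<in> {w. ?m w \<noteq> 0}" "?\<phi> w \<in> {w. ?m' w \<noteq> 0}" for w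
      using inv[OF T T' vab'(2)] that by blast
    show "?\<phi> (?\<phi>' w) = w" if "w \<in> {w. ?m' w \<noteq> 0}" "?\<phi>' w \<in> {w. ?m w \<noteq> 0}" for w
      using inv[OF T' T vab(2)] that by blast
  qed (fact op zero hol_\<Phi>)+
  have hol_pow: "holomorphic2_on (\<lambda>w. inverse (?m w) ^ n) {w. ?m w \<noteq> 0}" for n
  proof (induction n)
    case (Suc n)
    have "holomorphic2_on (\<lambda>w. inverse (?m w)) {w. ?m w \<noteq> 0}"
      by (rule holomorphic2_on_inverse[OF hol_m]) simp
    from holomorphic2_on_mult[OF this Suc] show ?case by simp
  qed (simp add: holomorphic2_on_const)
  show ?thesis
  proof (rule germ_equivI[OF bi, of "{w. ?m w \<noteq> 0}" "\<lambda>w. inverse (?m w) ^ d"])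
    show "0 \<in> {w. ?m w \<noteq> 0}" using nz by (simp add: \<mu>_def)
    fix w assume "w \<in> {w. ?m w \<noteq> 0}"
    then have m: "?m w \<noteq> 0" by simp
    have "g' w = ?m w ^ d * g (?\<phi> w)"
      using eval_homogeneous[OF f, of "?m w" "C v a b (?\<phi> w)"] chart[OF T m]
      unfolding g g' C_def by (simp add: case_prod_unfold)
    then show "inverse (?m w) ^ d \<noteq> 0 \<and> g (?\<phi> w) = inverse (?m w) ^ d * g' w"
      using m by (simp add: field_simps)
  qed (fact op hol_pow)+
qed


section \<open>Products of linear forms as normal forms\<close>

text \<open>The product of the linear forms \<open>a s + b t\<close> for the pairs \<open>(a, b)\<close> in the list, and the condition
  that these forms are pairwise linearly independent.\<close>

definition lines_germ :: "(complex \<times> complex) list \<Rightarrow> complex \<times> complex \<Rightarrow> complex" where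
  "lines_germ ps w = (\<Prod>p\<leftarrow>ps. fst p * fst w + snd p * snd w)"

definition distinct_lines :: "(complex \<times> complex) list \<Rightarrow> bool" where
  "distinct_lines ps \<longleftrightarrow> sorted_wrt (\<lambda>p q. fst p * snd q - snd p * fst q \<noteq> 0) ps"

lemma ordinary_lines_germ:
  assumes "distinct_lines ps" "2 \<le> length ps"
  shows "ordinary_germ (length ps) (lines_germ ps)"
proof -
  define a b where "a = (\<lambda>i. fst (ps ! i))" and "b = (\<lambda>i. snd (ps ! i))"
  define H where "H = (\<lambda>i (w :: complex \<times> complex). a i * fst w + b i * snd w)"
  have ne: "a i * b j \<noteq> a j * b i" if "i < length ps" "j < length ps" "i \<noteq> j" for i j
    using that assms(1) unfolding distinct_lines_def sorted_wrt_iff_nth_less a_def b_def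
    by (metis linorder_neqE_nat mult.commute right_minus_eq)
  have nz: "a i \<noteq> 0 \<or> b i \<noteq> 0" if i: "i < length ps" for i
  proof -
    obtain j where "j < length ps" "j \<noteq> i"
      using assms(2) by (intro that[of "if i = 0 then 1 else 0"]) (auto split: if_splits)
    then show ?thesis using ne[OF i] by fastforce
  qed
  have "lines_germ ps w = (\<Prod>i<length ps. H i w)" for w
    unfolding lines_germ_def H_def a_def b_def by (simp add: prod.list_conv_set_nth atLeast0LessThan)
  moreover have "holomorphic2_on (H i) UNIV" for i
    unfolding H_def
    by (intro holomorphic2_on_add holomorphic2_on_mult holomorphic2_on_const holomorphic2_on_fst holomorphic2_on_snd)
  moreover have "(H i has_derivative (\<lambda>(s, t). a i * s + b i * t)) (at 0)" for i
    unfolding H_def by (auto intro!: derivative_eq_intros simp: case_prod_unfold)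
  moreover have "H i 0 = 0" for i by (simp add: H_def)
  ultimately show ?thesis
    unfolding ordinary_germ_def using ne nz by (intro exI[of _ UNIV] exI[of _ H] exI[of _ a] exI[of _ b]) simp
qed

lemma weighted_homogeneous_mult:
  assumes "weighted_homogeneous a b d P" "weighted_homogeneous a b e Q"
  shows "weighted_homogeneous a b (d + e) (P * Q)"
  unfolding weighted_homogeneous_def
proof (intro allI impI)
  fix i j assume "coeff (coeff (P * Q) i) j \<noteq> 0"
  then have "(\<Sum>k\<le>i. \<Sum>l\<le>j. coeff (coeff P k) l * coeff (coeff Q (i - k)) (j - l)) \<noteq> 0"
    by (simp add: coeff_mult coeff_sum)
  then obtain k where k: "k \<le> i" "(\<Sum>l\<le>j. coeff (coeff P k) l * coeff (coeff Q (i - k)) (j - l)) \<noteq> 0"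
    by (auto elim: sum.not_neutral_contains_not_neutral)
  then obtain l where l: "l \<le> j" "coeff (coeff P k) l * coeff (coeff Q (i - k)) (j - l) \<noteq> 0"
    by (auto elim: sum.not_neutral_contains_not_neutral)
  then have "a * k + b * l = d" "a * (i - k) + b * (j - l) = e"
    using assms unfolding weighted_homogeneous_def by auto
  moreover have "a * i = a * k + a * (i - k)" "b * j = b * l + b * (j - l)"
    using k l by (simp_all flip: add_mult_distrib2)
  ultimately show "a * i + b * j = d + e" by simp
qed

lemma quasi_homogeneous_lines_germ:
  assumes "germ_equiv g (lines_germ ps)"
  shows "quasi_homogeneous_germ g"
proof -
  define P where "P = (\<Prod>p\<leftarrow>ps. [:[:0, snd p:], [:fst p:]:])"
  have "weighted_homogeneous 1 1 (length ps) P"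
    unfolding P_def
  proof (induction ps)
    case Nil
    show ?case by (auto simp: weighted_homogeneous_def one_pCons coeff_pCons split: nat.splits)
  next
    case (Cons p ps)
    have "weighted_homogeneous 1 1 1 [:[:0, snd p:], [:fst p:]:]"
      by (auto simp: weighted_homogeneous_def coeff_pCons split: nat.splits)
    from weighted_homogeneous_mult[OF this Cons.IH] show ?case by simp
  qed
  moreover have "lines_germ ps = (\<lambda>(s, t). poly (poly P [:s:]) t)"
    unfolding P_def fun_eq_iff by (induction ps) (simp_all add: lines_germ_def algebra_simps)
  ultimately show ?thesis
    using assms unfolding quasi_homogeneous_germ_def by (metis zero_less_one)
qed

lemma linear_change:
  assumes "D = a * d - b * c" "D \<noteq> 0"
  shows "local_biholomorphism UNIV UNIV (\<lambda>w. (a * fst w + b * snd w, c * fst w + d * snd w))"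
proof -
  let ?\<phi> = "\<lambda>w. (a * fst w + b * snd w, c * fst w + d * snd w)"
  let ?\<psi> = "\<lambda>w. (d / D * fst w + (- b / D) * snd w, (- c / D) * fst w + a / D * snd w)"
  have hol_lin: "holomorphic2_on (\<lambda>w. x * fst w + y * snd w) U" for x y U
    by (intro holomorphic2_on_add holomorphic2_on_mult holomorphic2_on_const holomorphic2_on_fst holomorphic2_on_snd)
  have "local_biholomorphism (UNIV \<inter> ?\<phi> -` UNIV) (UNIV \<inter> ?\<psi> -` UNIV) ?\<phi>"
  proof (rule local_biholomorphismI)
    show "?\<psi> (?\<phi> w) = w" "?\<phi> (?\<psi> w) = w" for w
      using assms(2) by (simp_all add: prod_eq_iff divide_simps, simp_all add: assms(1) algebra_simps)
    show "holomorphic2_on (fst \<circ> ?\<phi>) UNIV" "holomorphic2_on (snd \<circ> ?\<phi>) UNIV"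
      "holomorphic2_on (fst \<circ> ?\<psi>) UNIV" "holomorphic2_on (snd \<circ> ?\<psi>) UNIV"
      by (simp_all only: o_def fst_conv snd_conv hol_lin)
  qed (simp_all add: zero_prod_def)
  then show ?thesis by simp
qed

lemma germ_equiv_linear:
  assumes "a * d - b * c \<noteq> 0" "u \<noteq> 0" "\<And>s t. g (a * s + b * t, c * s + d * t) = u * h (s, t)"
  shows "germ_equiv g h"
proof (rule germ_equivI[OF linear_change[OF refl assms(1)], of UNIV "\<lambda>w. u"])
  show "u \<noteq> 0 \<and> g (a * fst w + b * snd w, c * fst w + d * snd w) = u * h w" for w
    using assms(2,3) by (metis prod.collapse)
qed auto

text \<open>The coordinate change is the inverse of \<open>(s, t) \<mapsto> (p\<^sub>1 s + p\<^sub>2 t, q\<^sub>1 s + q\<^sub>2 t)\<close>, by Cramer's rule.\<close>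

lemma lines_germ_2:
  assumes "distinct_lines [p, q]"
  shows "germ_equiv (lines_germ [p, q]) (\<lambda>(s, t). s * t)"
proof -
  define D where "D = fst p * snd q - snd p * fst q"
  have D: "D \<noteq> 0" using assms by (simp add: distinct_lines_def D_def)
  show ?thesis
  proof (rule germ_equiv_linear[of "snd q / D" "fst p / D" "- snd p / D" "- fst q / D" 1])
    have "snd q / D * (fst p / D) - - snd p / D * (- fst q / D) = D / (D * D)"
      by (simp add: D_def diff_divide_distrib mult.commute)
    then show "snd q / D * (fst p / D) - - snd p / D * (- fst q / D) \<noteq> 0" using D by simp
    fix s t
    have "fst p * (snd q / D * s + - snd p / D * t) + snd p * (- fst q / D * s + fst p / D * t) = D / D * s"
      "fst q * (snd q / D * s + - snd p / D * t) + snd q * (- fst q / D * s + fst p / D * t) = D / D * t"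
      unfolding D_def by (simp_all add: field_simps)
    then show "lines_germ [p, q] (snd q / D * s + - snd p / D * t, - fst q / D * s + fst p / D * t) = 1 * (case (s, t) of (s, t) \<Rightarrow> s * t)"
      using D by (simp add: lines_germ_def)
  qed simp
qed

text \<open>With the determinants \<open>A\<close>, \<open>B\<close>, \<open>C\<close> of the three pairs of forms, the coordinate change takes \<open>p\<close>, \<open>q\<close>
  and \<open>r\<close> to \<open>- (A / C) s\<close>, \<open>- (A / B) t\<close> and \<open>s - t\<close>. This follows from the linear relation
  \<open>C p - B q + A r = 0\<close>.\<close>

lemma lines_germ_3:
  assumes "distinct_lines [p, q, r]"
  shows "germ_equiv (lines_germ [p, q, r]) (\<lambda>(s, t). s * t * (s - t))"
proof -
  define A B C where "A = fst p * snd q - snd p * fst q" and "B = fst p * snd r - snd p * fst r"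
    and "C = fst q * snd r - snd q * fst r"
  have nz: "A \<noteq> 0" "B \<noteq> 0" "C \<noteq> 0" using assms by (simp_all add: distinct_lines_def A_def B_def C_def)
  show ?thesis
  proof (rule germ_equiv_linear[of "- snd q / C" "- fst p / B" "snd p / B" "fst q / C" "A / C * (A / B)"])
    have "- snd q / C * (- fst p / B) - snd p / B * (fst q / C) = A / (B * C)"
      by (simp add: A_def diff_divide_distrib mult.commute)
    then show "- snd q / C * (- fst p / B) - snd p / B * (fst q / C) \<noteq> 0" using nz by simp
    show "A / C * (A / B) \<noteq> 0" using nz by simp
    fix s t
    have "fst p * (- snd q / C * s + snd p / B * t) + snd p * (fst q / C * s + - fst p / B * t) = - (A / C * s)"
      "fst q * (- snd q / C * s + snd p / B * t) + snd q * (fst q / C * s + - fst p / B * t) = - (A / B * t)"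
      unfolding A_def using nz by (simp_all add: field_simps)
    moreover
    have "fst r * (- snd q / C * s + snd p / B * t) + snd r * (fst q / C * s + - fst p / B * t)
        = (fst q * snd r - snd q * fst r) / C * s - (fst p * snd r - snd p * fst r) / B * t"
      by (simp add: algebra_simps diff_divide_distrib add_divide_distrib)
    then have "fst r * (- snd q / C * s + snd p / B * t) + snd r * (fst q / C * s + - fst p / B * t) = s - t"
      using nz unfolding B_def[symmetric] C_def[symmetric] by simp
    ultimately show "lines_germ [p, q, r] (- snd q / C * s + snd p / B * t, fst q / C * s + - fst p / B * t)
        = A / C * (A / B) * (case (s, t) of (s, t) \<Rightarrow> s * t * (s - t))"
      using nz by (simp add: lines_germ_def)
  qed
qed


section \<open>Straightening a conic\<close>

text \<open>The same Moebius transformation fixing 0 in both coordinates. It maps each of the lines \<open>s = 0\<close>,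
  \<open>t = 0\<close> and \<open>s = t\<close> to itself, and its inverse belongs to the parameter \<open>- c\<close>.\<close>

definition mobius :: "complex \<Rightarrow> complex \<times> complex \<Rightarrow> complex \<times> complex" where
  "mobius c w = (fst w / (1 - c * fst w), snd w / (1 - c * snd w))"

text \<open>The set where both denominators in \<open>mobius c\<close> are different from 0.\<close>

definition mobius_domain :: "complex \<Rightarrow> (complex \<times> complex) set" where
  "mobius_domain c = {w. 1 - c * fst w \<noteq> 0 \<and> 1 - c * snd w \<noteq> 0}"

lemma open_mobius_domain: "open (mobius_domain c)"
  unfolding mobius_domain_def Collect_conj_eq
  by (intro open_Int open_Collect_neq continuous_intros)

lemma mobius_zero: "0 \<in> mobius_domain c" "mobius c 0 = 0"
  by (simp_all add: mobius_domain_def mobius_def zero_prod_def)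

lemma holomorphic_denominators:
  "holomorphic2_on (\<lambda>w. 1 - c * fst w) U" "holomorphic2_on (\<lambda>w. 1 - c * snd w) U"
  by (intro holomorphic2_on_diff holomorphic2_on_mult holomorphic2_on_const
      holomorphic2_on_fst holomorphic2_on_snd)+

lemma holomorphic_mobius:
  "holomorphic2_on (fst \<circ> mobius c) (mobius_domain c)" "holomorphic2_on (snd \<circ> mobius c) (mobius_domain c)"
  unfolding o_def mobius_def fst_conv snd_conv
  by (intro holomorphic2_on_divide holomorphic_denominators holomorphic2_on_fst holomorphic2_on_snd;
      simp add: mobius_domain_def)+

lemma mobius_inverse: "w \<in> mobius_domain c \<Longrightarrow> mobius (- c) (mobius c w) = w"
proof -
  have "s / (1 - c * s) / (1 - - c * (s / (1 - c * s))) = s" if "1 - c * s \<noteq> 0" for s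
  proof -
    have "1 - - c * (s / (1 - c * s)) = 1 / (1 - c * s)" using that by (simp add: field_simps)
    then show ?thesis using that by simp
  qed
  then show "w \<in> mobius_domain c \<Longrightarrow> mobius (- c) (mobius c w) = w"
    by (simp add: mobius_def mobius_domain_def prod_eq_iff)
qed

lemma local_biholomorphism_mobius: "\<exists>U V. local_biholomorphism U V (mobius c)"
proof -
  have "local_biholomorphism (mobius_domain c \<inter> mobius c -` mobius_domain (- c))
    (mobius_domain (- c) \<inter> mobius (- c) -` mobius_domain c) (mobius c)"
    by (rule local_biholomorphismI)
      (use mobius_inverse[of _ c] mobius_inverse[of _ "- c"] in
        \<open>simp_all add: open_mobius_domain mobius_zero holomorphic_mobius\<close>)
  then show ?thesis by blast
qed

text \<open>Near 0 the functions \<open>g \<circ> \<phi>\<close> and \<open>l\<close> agree up to a unit. Unlike equivalence of germs, this is stable under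
  products for a fixed \<open>\<phi>\<close>, so that it can be checked for one component at a time.\<close>

definition pulls_back_to ::
  "(complex \<times> complex \<Rightarrow> complex \<times> complex) \<Rightarrow> (complex \<times> complex \<Rightarrow> complex) \<Rightarrow> (complex \<times> complex \<Rightarrow> complex) \<Rightarrow> bool" where
  "pulls_back_to \<phi> g l \<longleftrightarrow> (\<exists>U u. open U \<and> 0 \<in> U \<and> holomorphic2_on u U \<and>
     (\<forall>w\<in>U. u w \<noteq> 0 \<and> g (\<phi> w) = u w * l w))"

lemma pulls_back_to_mult:
  assumes "pulls_back_to \<phi> g l" "pulls_back_to \<phi> g' l'"
  shows "pulls_back_to \<phi> (\<lambda>w. g w * g' w) (\<lambda>w. l w * l' w)"
proof -
  obtain U u where 1: "open U" "0 \<in> U" "holomorphic2_on u U" "\<forall>w\<in>U. u w \<noteq> 0 \<and> g (\<phi> w) = u w * l w"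
    using assms(1) unfolding pulls_back_to_def by blast
  obtain U' u' where 2: "open U'" "0 \<in> U'" "holomorphic2_on u' U'" "\<forall>w\<in>U'. u' w \<noteq> 0 \<and> g' (\<phi> w) = u' w * l' w"
    using assms(2) unfolding pulls_back_to_def by blast
  show ?thesis
    unfolding pulls_back_to_def
  proof (intro exI conjI)
    show "open (U \<inter> U')" "0 \<in> U \<inter> U'" using 1 2 by auto
    show "holomorphic2_on (\<lambda>w. u w * u' w) (U \<inter> U')"
      using 1 2 by (intro holomorphic2_on_mult) (auto intro: holomorphic2_on_subset)
    show "\<forall>w\<in>U \<inter> U'. u w * u' w \<noteq> 0 \<and> g (\<phi> w) * g' (\<phi> w) = u w * u' w * (l w * l' w)"
      using 1(4) 2(4) by (simp add: algebra_simps)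
  qed
qed

lemma pulls_back_to_one: "pulls_back_to \<phi> (\<lambda>w. 1) (\<lambda>w. 1)"
  unfolding pulls_back_to_def by (intro exI[of _ UNIV] exI[of _ "\<lambda>w. 1"]) auto

lemma pulls_back_to_prod_list:
  assumes "\<And>x. x \<in> set xs \<Longrightarrow> pulls_back_to \<phi> (G x) (L x)"
  shows "pulls_back_to \<phi> (\<lambda>w. \<Prod>x\<leftarrow>xs. G x w) (\<lambda>w. \<Prod>x\<leftarrow>xs. L x w)"
  using assms by (induction xs) (auto intro: pulls_back_to_one pulls_back_to_mult)

lemma pulls_back_to_unit:
  assumes "holomorphic2_on g UNIV" "g 0 \<noteq> 0"
  shows "pulls_back_to (mobius c) g (\<lambda>w. 1)"
proof -
  have hol: "holomorphic2_on (\<lambda>w. g (mobius c w)) (mobius_domain c)"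
    using holomorphic2_on_compose[OF assms(1) holomorphic_mobius] by simp
  then have "open (mobius_domain c \<inter> (\<lambda>w. g (mobius c w)) -` (- {0}))"
    by (intro continuous_open_preimage holomorphic2_on_imp_continuous_on open_mobius_domain) auto
  then show ?thesis
    unfolding pulls_back_to_def
    by (intro exI[of _ "mobius_domain c \<inter> (\<lambda>w. g (mobius c w)) -` (- {0})"] exI[of _ "\<lambda>w. g (mobius c w)"])
      (use assms(2) mobius_zero hol in \<open>auto intro: holomorphic2_on_subset\<close>)
qed

text \<open>The first case is the conic (and, with \<open>k = A + B = 0\<close>, the line \<open>s = t\<close>); the second one
  consists of the lines \<open>s = 0\<close> and \<open>t = 0\<close>.\<close>

lemma pulls_back_to_branch:
  assumes "k = c * (A + B) \<or> k = 0 \<and> (A = 0 \<or> B = 0)"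
  shows "pulls_back_to (mobius c) (\<lambda>w. A * fst w + B * snd w + k * fst w * snd w) (\<lambda>w. A * fst w + B * snd w)"
proof -
  have *: "pulls_back_to (mobius c) g l"
    if "holomorphic2_on u (mobius_domain c)"
      "\<And>s t. 1 - c * s \<noteq> 0 \<Longrightarrow> 1 - c * t \<noteq> 0 \<Longrightarrow> u (s, t) \<noteq> 0 \<and> g (s / (1 - c * s), t / (1 - c * t)) = u (s, t) * l (s, t)"
    for u g l
    unfolding pulls_back_to_def
  proof (intro exI[of _ "mobius_domain c"] exI[of _ u] conjI ballI)
    fix w assume "w \<in> mobius_domain c"
    then show "u w \<noteq> 0" "g (mobius c w) = u w * l w"
      using that(2)[of "fst w" "snd w"] by (simp_all add: mobius_domain_def mobius_def)
  qed (use that(1) open_mobius_domain mobius_zero in simp_all)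
  consider "k = c * (A + B)" | "k = 0" "A = 0" | "k = 0" "B = 0" using assms by blast
  then show ?thesis
  proof cases
    case 1
    show ?thesis
    proof (rule *[of "\<lambda>w. inverse ((1 - c * fst w) * (1 - c * snd w))"])
      fix s t assume nz: "1 - c * s \<noteq> 0" "1 - c * t \<noteq> 0"
      have "A * (s / (1 - c * s)) + B * (t / (1 - c * t)) + k * (s / (1 - c * s)) * (t / (1 - c * t))
        = (A * s * (1 - c * t) + B * t * (1 - c * s) + k * s * t) / ((1 - c * s) * (1 - c * t))"
        using nz by (simp add: add_divide_distrib)
      also have "A * s * (1 - c * t) + B * t * (1 - c * s) + k * s * t = A * s + B * t"
        unfolding 1 by (simp add: algebra_simps)
      finally show "inverse ((1 - c * fst (s, t)) * (1 - c * snd (s, t))) \<noteq> 0 \<and>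
        A * fst (s / (1 - c * s), t / (1 - c * t)) + B * snd (s / (1 - c * s), t / (1 - c * t))
          + k * fst (s / (1 - c * s), t / (1 - c * t)) * snd (s / (1 - c * s), t / (1 - c * t))
        = inverse ((1 - c * fst (s, t)) * (1 - c * snd (s, t))) * (A * fst (s, t) + B * snd (s, t))"
        using nz by (simp add: divide_inverse mult.commute)
    qed (intro holomorphic2_on_inverse holomorphic2_on_mult holomorphic_denominators; simp add: mobius_domain_def)
  next
    case 2
    then show ?thesis
      by (intro *[of "\<lambda>w. inverse (1 - c * snd w)"] holomorphic2_on_inverse holomorphic_denominators)
        (simp_all add: mobius_domain_def divide_inverse)
  next
    case 3
    then show ?thesis
      by (intro *[of "\<lambda>w. inverse (1 - c * fst w)"] holomorphic2_on_inverse holomorphic_denominators)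
        (simp_all add: mobius_domain_def divide_inverse)
  qed
qed

lemma holomorphic_eval:
  assumes "holomorphic2_on x U" "holomorphic2_on y U" "holomorphic2_on z U"
  shows "holomorphic2_on (\<lambda>w. eval f (vector [x w, y w, z w])) U"
proof -
  have 1: "holomorphic2_on (\<lambda>w. poly p (z w)) U" for p
    by (induction p) (auto intro!: holomorphic2_on_const holomorphic2_on_add holomorphic2_on_mult assms)
  have 2: "holomorphic2_on (\<lambda>w. poly (poly p [:y w:]) (z w)) U" for p
    by (induction p) (auto intro!: 1 holomorphic2_on_const holomorphic2_on_add holomorphic2_on_mult assms)
  have "holomorphic2_on (\<lambda>w. poly (poly (poly p [:[:x w:]:]) [:y w:]) (z w)) U" for p
    by (induction p) (auto intro!: 2 holomorphic2_on_const holomorphic2_on_add holomorphic2_on_mult assms)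
  then show ?thesis by (simp add: eval_def)
qed

lemma holomorphic_chart: "holomorphic2_on (\<lambda>w. eval f (v + fst w *s a + snd w *s b)) U"
proof -
  have "v + fst w *s a + snd w *s b = vector [v $ 1 + fst w * a $ 1 + snd w * b $ 1,
    v $ 2 + fst w * a $ 2 + snd w * b $ 2, v $ 3 + fst w * a $ 3 + snd w * b $ 3]" for w :: "complex \<times> complex"
    by (simp add: vec_eq_iff forall_3)
  then show ?thesis
    by (simp only:) (intro holomorphic_eval holomorphic2_on_add holomorphic2_on_mult
        holomorphic2_on_const holomorphic2_on_fst holomorphic2_on_snd)
qed

lemma eval_linear_form:
  assumes "homogeneous 1 l"
  shows "eval l (v + s *s a + t *s b) = eval l v + s * eval l a + t * eval l b"
proof -
  obtain p q r where "l = cst p * varx + cst q * vary + cst r * varz" using linear_form[OF assms] .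
  then show ?thesis by (simp add: algebra_simps)
qed

text \<open>The expression is the determinant of the three vectors; coordinates of \<open>w\<close> are given by
  Cramer's rule.\<close>

lemma triple_span_UNIV_I:
  fixes v a b :: "complex^3"
  assumes "v $ 1 * cross a b $ 1 + v $ 2 * cross a b $ 2 + v $ 3 * cross a b $ 3 \<noteq> 0" (is "?D \<noteq> 0")
  shows "vec.span {v, a, b} = UNIV"
  unfolding triple_span_UNIV
proof
  fix w :: "complex^3"
  let ?t = "\<lambda>u c d. u $ 1 * cross c d $ 1 + u $ 2 * cross c d $ 2 + u $ 3 * cross c d $ 3"
  define D p q r where "D = ?D" and "p = ?t w a b" and "q = ?t w b v" and "r = ?t w v a"
  have "D \<noteq> 0" using assms by (simp add: D_def)
  have "D *s w = p *s v + q *s a + r *s b"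
    unfolding vec_eq_iff forall_3 D_def p_def q_def r_def by (simp add: algebra_simps)
  then have "D * w $ i = p * v $ i + q * a $ i + r * b $ i" for i
    by (metis vector_add_component vector_smult_component)
  then have "w = (p / D) *s v + (q / D) *s a + (r / D) *s b"
    using \<open>D \<noteq> 0\<close> by (simp add: vec_eq_iff field_simps)
  then show "\<exists>x y z. w = x *s v + y *s a + z *s b" by blast
qed


section \<open>Points with a linear normal form\<close>

text \<open>A singular point at which the curve has a product of \<open>m\<close> pairwise independent linear forms as its
  normal form. The singular points of both curves are of this kind.\<close>

definition normal_point :: "nat \<Rightarrow> S \<Rightarrow> (complex^3) set \<Rightarrow> bool" where
  "normal_point m f p \<longleftrightarrow> p \<in> sing_points f \<and>
     (\<exists>g ps. local_equation f p g \<and> germ_equiv g (lines_germ ps) \<and> distinct_lines ps \<and> length ps = m)"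

context conic_and_lines
begin

text \<open>In the chart \<open>[v + s a + t b]\<close> the lines through \<open>[v]\<close> are among \<open>s = 0\<close>, \<open>t = 0\<close> and \<open>s = t\<close>, and the
  conic does not pass through \<open>[v]\<close> or has the equation \<open>A s + B t + c (A + B) s t = 0\<close>. The Moebius
  transformation with parameter \<open>c\<close> then takes all branches to their tangents, listed in \<open>bs\<close>; factors
  that do not vanish at \<open>v\<close> become units.\<close>

lemma normal_pointI:
  assumes span: "vec.span {v, a, b} = UNIV"
    and lines0: "\<forall>l\<in>set Ls. eval l v = 0 \<longrightarrow> eval l a = 0 \<or> eval l b = 0 \<or> eval l a + eval l b = 0"
    and conic0: "qs = [] \<and> eval Q v \<noteq> 0 \<or>
      (\<exists>A B. qs = [(A, B)] \<and> (\<forall>s t. eval Q (v + s *s a + t *s b) = A * s + B * t + c * (A + B) * s * t))"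
    and bs: "bs = map (\<lambda>l. (eval l a, eval l b)) (filter (\<lambda>l. eval l v = 0) Ls) @ qs"
    and distinct: "distinct_lines bs" and m: "length bs = m" "2 \<le> m"
  shows "normal_point m f (vec.span {v})"
proof -
  define g where "g = (\<lambda>(s, t). eval f (v + s *s a + t *s b))"
  have "v \<noteq> 0" using triple_independent[OF span, of 1 0 0 0 0 0] by auto
  define ev where "ev = (\<lambda>h w. eval h (v + fst w *s a + snd w *s b))"
  define br where "br = (\<lambda>l w. if eval l v = 0 then eval l a * fst w + eval l b * snd w else 1)"
  have unit: "pulls_back_to (mobius c) (ev h) (\<lambda>w. 1)" if "eval h v \<noteq> 0" for h
    using that by (intro pulls_back_to_unit) (auto simp: ev_def intro: holomorphic_chart)
  have "pulls_back_to (mobius c) (ev l) (br l)" if l: "l \<in> set Ls" for l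
  proof (cases "eval l v = 0")
    case True
    have "ev l = (\<lambda>w. eval l a * fst w + eval l b * snd w + 0 * fst w * snd w)"
      unfolding ev_def eval_linear_form[OF lines[OF l]] using True by (simp add: fun_eq_iff mult.commute)
    moreover have "br l = (\<lambda>w. eval l a * fst w + eval l b * snd w)" using True by (simp add: br_def)
    ultimately show ?thesis
      using pulls_back_to_branch[of 0 c "eval l a" "eval l b"] lines0 l True by auto
  next
    case False
    then show ?thesis using unit by (simp add: br_def)
  qed
  then have "pulls_back_to (mobius c) (\<lambda>w. \<Prod>l\<leftarrow>Ls. ev l w) (\<lambda>w. \<Prod>l\<leftarrow>Ls. br l w)"
    by (rule pulls_back_to_prod_list)
  moreover have "(\<Prod>l\<leftarrow>ls. br l w) = lines_germ (map (\<lambda>l. (eval l a, eval l b)) (filter (\<lambda>l. eval l v = 0) ls)) w"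
    for w ls unfolding lines_germ_def by (induction ls) (simp_all add: br_def)
  ultimately have L: "pulls_back_to (mobius c) (\<lambda>w. \<Prod>l\<leftarrow>Ls. ev l w)
      (lines_germ (map (\<lambda>l. (eval l a, eval l b)) (filter (\<lambda>l. eval l v = 0) Ls)))" by simp
  have "pulls_back_to (mobius c) (ev Q) (lines_germ qs)"
    using conic0
  proof (elim disjE exE conjE)
    assume "qs = []" "eval Q v \<noteq> 0"
    moreover have "lines_germ [] = (\<lambda>w. 1)" by (simp add: lines_germ_def fun_eq_iff)
    ultimately show ?thesis using unit by simp
  next
    fix A B assume *: "qs = [(A, B)]"
      "\<forall>s t. eval Q (v + s *s a + t *s b) = A * s + B * t + c * (A + B) * s * t"
    then have "ev Q = (\<lambda>w. A * fst w + B * snd w + c * (A + B) * fst w * snd w)" by (simp add: ev_def)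
    moreover have "lines_germ qs = (\<lambda>w. A * fst w + B * snd w)" by (simp add: lines_germ_def fun_eq_iff *)
    ultimately show ?thesis using pulls_back_to_branch[of "c * (A + B)" c A B] by simp
  qed
  from pulls_back_to_mult[OF L this]
  moreover have "g = (\<lambda>w. (\<Prod>l\<leftarrow>Ls. ev l w) * ev Q w)"
    by (simp add: g_def ev_def fun_eq_iff eval_prod_list)
  moreover have "lines_germ bs = (\<lambda>w. lines_germ (map (\<lambda>l. (eval l a, eval l b)) (filter (\<lambda>l. eval l v = 0) Ls)) w
      * lines_germ qs w)"
    unfolding bs by (simp add: fun_eq_iff lines_germ_def)
  ultimately have "pulls_back_to (mobius c) g (lines_germ bs)" by simp
  then obtain U u where U: "open U" "0 \<in> U" "holomorphic2_on u U"
    "\<forall>w\<in>U. u w \<noteq> 0 \<and> g (mobius c w) = u w * lines_germ bs w" unfolding pulls_back_to_def by blast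
  obtain V W where "local_biholomorphism V W (mobius c)" using local_biholomorphism_mobius by blast
  then have equiv: "germ_equiv g (lines_germ bs)"
    using germ_equivI[of V W "mobius c" U u] U by blast
  have "local_equation f (vec.span {v}) g"
    unfolding local_equation_def g_def using span by blast
  moreover have "vec.span {v} \<in> sing_points f"
  proof -
    define ls where "ls = filter (\<lambda>l. eval l v = 0) Ls"
    have dist: "List.distinct ls" "set ls \<subseteq> set Ls" "Q \<notin> set Ls" "\<And>l. l \<in> set ls \<Longrightarrow> eval l v = 0"
      using conic_and_lines.distinct[OF conic_and_lines_axioms] by (auto simp: ls_def)
    have len: "length ls + length qs = m" using bs m by (simp add: ls_def)
    have "\<exists>g\<in>set (Q # Ls). \<exists>h\<in>set (Q # Ls). g \<noteq> h \<and> eval g v = 0 \<and> eval h v = 0"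
      using conic0
    proof (elim disjE exE conjE)
      assume "qs = []"
      then have "2 \<le> length ls" using len m by simp
      then obtain l l' ls' where "ls = l # l' # ls'"
        by (cases ls; cases "tl ls") auto
      then have "l \<noteq> l'" "l \<in> set ls" "l' \<in> set ls" using dist(1) by auto
      then show ?thesis using dist by (meson list.set_intros(2) subsetD)
    next
      fix A B assume *: "qs = [(A, B)]"
        "\<forall>s t. eval Q (v + s *s a + t *s b) = A * s + B * t + c * (A + B) * s * t"
      then have "eval Q v = 0" by (metis (no_types, lifting) add.right_neutral mult_zero_right vec.scale_zero_left)
      moreover have "ls \<noteq> []" using len m * by auto
      then have "hd ls \<in> set ls" by simp
      ultimately show ?thesis using dist by (metis list.set_intros subsetD)
    qed
    then show ?thesis unfolding sing_points_f using \<open>v \<noteq> 0\<close> by blast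
  qed
  ultimately show ?thesis unfolding normal_point_def using equiv distinct m by blast
qed

end


section \<open>Equality of weak combinatorics\<close>

lemma normal_point_ordinary:
  assumes "normal_point m f p" "2 \<le> m"
  shows "ordinary_point m f p"
proof -
  obtain g ps where *: "p \<in> sing_points f" "local_equation f p g" "germ_equiv g (lines_germ ps)"
    "distinct_lines ps" "length ps = m" using assms(1) unfolding normal_point_def by blast
  have "ordinary_germ m g"
    by (rule ordinary_germ_equiv[OF _ germ_equiv_sym[OF *(3)]]) (use ordinary_lines_germ[of ps] * assms(2) in auto)
  then show ?thesis using * unfolding ordinary_point_def by blast
qed

lemma ordinary_point_unique:
  assumes f: "homogeneous d f" and m: "ordinary_point m f p" "ordinary_point n f p" "0 < n"
  shows "m = n"
proof -
  obtain g h where "local_equation f p g" "ordinary_germ m g" "local_equation f p h" "ordinary_germ n h"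
    using m unfolding ordinary_point_def by blast
  moreover from this have "ordinary_germ n g" using ordinary_germ_equiv charts_equiv[OF f] m(3) by blast
  ultimately show ?thesis using ordinary_germ_unique by blast
qed

text \<open>For double and triple points the normal form is unique.\<close>

lemma normal_points_equiv:
  assumes "normal_point m f p" "normal_point m g q" "m = 2 \<or> m = 3"
  shows "\<exists>f' g'. local_equation f p f' \<and> local_equation g q g' \<and> germ_equiv f' g'"
proof -
  obtain f' ps where f': "local_equation f p f'" "germ_equiv f' (lines_germ ps)" "distinct_lines ps" "length ps = m"
    using assms(1) unfolding normal_point_def by blast
  obtain g' qs where g': "local_equation g q g'" "germ_equiv g' (lines_germ qs)" "distinct_lines qs" "length qs = m"
    using assms(2) unfolding normal_point_def by blast
  define N :: "complex \<times> complex \<Rightarrow> complex" where "N = (if m = 2 then (\<lambda>(s, t). s * t) else (\<lambda>(s, t). s * t * (s - t)))"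
  have "germ_equiv (lines_germ rs) N" if rs: "distinct_lines rs" "length rs = m" for rs
  proof (cases "m = 2")
    case True
    then obtain p q where "rs = [p, q]" using rs(2) by (auto simp: length_Suc_conv numeral_2_eq_2)
    then show ?thesis using lines_germ_2 rs True by (simp add: N_def)
  next
    case False
    then have "m = 3" using assms(3) by simp
    then obtain p q r where "rs = [p, q, r]" using rs(2) by (auto simp: length_Suc_conv numeral_3_eq_3)
    then show ?thesis using lines_germ_3 rs \<open>m = 3\<close> by (simp add: N_def)
  qed
  then have "germ_equiv f' g'" using f' g' germ_equiv_trans germ_equiv_sym by metis
  then show ?thesis using f' g' by blast
qed

text \<open>The type of a point with a linear normal form is determined by the number of branches. For 4
  branches this uses that quadruple points are of one type, so that \<open>r\<close> is only known to be ordinary.\<close>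

lemma same_type_transfer:
  assumes f: "homogeneous d f" "2 \<le> m" and p: "normal_point m f p" "normal_point m g q"
    and m: "m = 2 \<or> m = 3 \<or> m = 4" and h: "homogeneous e h" "r \<in> sing_points h"
    and same: "same_type f p h r"
  shows "same_type g q h r"
proof (cases "m = 4")
  case True
  have "X9_point h r"
    using same unfolding same_type_def
  proof (elim disjE exE conjE)
    fix f' h' assume *: "local_equation f p f'" "local_equation h r h'" "germ_equiv f' h'"
    obtain f0 where "local_equation f p f0" "ordinary_germ 4 f0"
      using normal_point_ordinary[OF p(1) f(2)] True unfolding ordinary_point_def by blast
    then have "ordinary_germ 4 h'"
      using * charts_equiv[OF f(1)] germ_equiv_trans ordinary_germ_equiv by (metis zero_less_numeral)
    then show ?thesis using * h unfolding ordinary_point_def by blast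
  qed
  moreover have "X9_point g q" using normal_point_ordinary[OF p(2) f(2)] True by simp
  ultimately show ?thesis unfolding same_type_def by blast
next
  case False
  then have m': "m = 2 \<or> m = 3" using m by simp
  obtain f1 g1 where 1: "local_equation f p f1" "local_equation g q g1" "germ_equiv f1 g1"
    using normal_points_equiv[OF p m'] by blast
  have "\<not> X9_point f p"
    using ordinary_point_unique[OF f(1) normal_point_ordinary[OF p(1) f(2)]] False by fastforce
  then obtain f' h' where *: "local_equation f p f'" "local_equation h r h'" "germ_equiv f' h'"
    using same unfolding same_type_def by blast
  have "germ_equiv g1 h'"
    using 1 * charts_equiv[OF f(1)] germ_equiv_trans germ_equiv_sym by metis
  then show ?thesis using 1 * unfolding same_type_def by blast
qed

text \<open>For a given type, represented by the point \<open>r\<close> of \<open>h\<close>, the points of this type are those with \<open>m\<close> branches, for \<open>m\<close>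
  in a set that is the same for both curves.\<close>

lemma same_weak_combinatoricsI:
  assumes comp: "\<And>k. card (curve_components k f) = card (curve_components k g)"
    and hom: "homogeneous d f" "homogeneous e g"
    and fin: "finite (sing_points f)" "finite (sing_points g)"
    and normal: "\<And>p. p \<in> sing_points f \<Longrightarrow> \<exists>m\<in>{2, 3, 4}. normal_point m f p"
      "\<And>p. p \<in> sing_points g \<Longrightarrow> \<exists>m\<in>{2, 3, 4}. normal_point m g p"
    and card: "\<And>m. m \<in> {2, 3, 4} \<Longrightarrow> card {p. normal_point m f p} = card {p. normal_point m g p}"
  shows "same_weak_combinatorics f g"
  unfolding same_weak_combinatorics_def
proof (intro conjI allI impI)
  show "card (curve_components k f) = card (curve_components k g)" for k by (rule comp)
  fix h r assume hr: "reduced_curve h \<and> r \<in> sing_points h"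
  then obtain c where h: "homogeneous c h" "r \<in> sing_points h" unfolding reduced_curve_def by blast
  have sub: "normal_point m k p \<Longrightarrow> p \<in> sing_points k" for m k p by (simp add: normal_point_def)
  \<comment> \<open>points with \<open>m\<close> branches are of the given type\<close>
  define T where "T = (\<lambda>m. \<exists>p. normal_point m f p \<and> same_type f p h r)"
  have Tf: "same_type f p h r \<longleftrightarrow> T m" if "normal_point m f p" "m \<in> {2, 3, 4}" for m p
    unfolding T_def using that same_type_transfer[OF hom(1) _ _ that(1) _ h] by auto
  have Tg: "same_type g p h r \<longleftrightarrow> T m" if p: "normal_point m g p" "m \<in> {2, 3, 4}" for m p
  proof
    assume same: "same_type g p h r"
    have "finite {p. normal_point m g p}" by (rule finite_subset[OF _ fin(2)]) (use sub in blast)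
    then have "card {p. normal_point m f p} \<noteq> 0" using card[OF p(2)] p(1) by (auto simp: card_eq_0_iff)
    then obtain q where q: "normal_point m f q" by (metis (mono_tags) Collect_empty_eq card.empty)
    then have "same_type f q h r" using same_type_transfer[OF hom(2) _ p(1) q _ h same] p(2) by auto
    then show "T m" unfolding T_def using q by blast
  next
    assume "T m"
    then show "same_type g p h r"
      unfolding T_def using same_type_transfer[OF hom(1) _ _ p(1) _ h] p(2) by auto
  qed
  have count: "card {p \<in> sing_points k. same_type k p h r}
      = (\<Sum>m\<in>{m \<in> {2, 3, 4}. T m}. card {p. normal_point m k p})"
    if k: "finite (sing_points k)" "homogeneous c' k" "\<And>p. p \<in> sing_points k \<Longrightarrow> \<exists>m\<in>{2, 3, 4}. normal_point m k p"
      "\<And>m p. normal_point m k p \<Longrightarrow> m \<in> {2, 3, 4} \<Longrightarrow> same_type k p h r \<longleftrightarrow> T m" for k c'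
  proof -
    have "{p \<in> sing_points k. same_type k p h r} = (\<Union>m\<in>{m \<in> {2, 3, 4}. T m}. {p. normal_point m k p})"
    proof (intro equalityI subsetI)
      fix p assume "p \<in> {p \<in> sing_points k. same_type k p h r}"
      then have p: "p \<in> sing_points k" "same_type k p h r" by simp_all
      obtain m where m: "m \<in> {2, 3, 4}" "normal_point m k p" using k(3)[OF p(1)] by blast
      then have "T m" using k(4)[OF m(2,1)] p(2) by simp
      then show "p \<in> (\<Union>m\<in>{m \<in> {2, 3, 4}. T m}. {p. normal_point m k p})" using m by blast
    next
      fix p assume "p \<in> (\<Union>m\<in>{m \<in> {2, 3, 4}. T m}. {p. normal_point m k p})"
      then obtain m where m: "m \<in> {2, 3, 4}" "T m" "normal_point m k p" by blast
      then show "p \<in> {p \<in> sing_points k. same_type k p h r}" using k(4)[OF m(3,1)] sub by simp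
    qed
    moreover have "finite {p. normal_point m k p}" for m
      by (rule finite_subset[OF _ k(1)]) (use sub in blast)
    moreover have "{p. normal_point m k p} \<inter> {p. normal_point n k p} = {}"
      if "m \<in> {2, 3, 4}" "n \<in> {2, 3, 4}" "m \<noteq> n" for m n
    proof (rule ccontr)
      assume "{p. normal_point m k p} \<inter> {p. normal_point n k p} \<noteq> {}"
      then obtain p where p: "normal_point m k p" "normal_point n k p" by blast
      have "2 \<le> m" "2 \<le> n" using that by auto
      then show False
        using ordinary_point_unique[OF k(2) normal_point_ordinary[OF p(1)] normal_point_ordinary[OF p(2)]] that by simp
    qed
    moreover have "finite {m \<in> {2, 3, 4 :: nat}. T m}" by simp
    ultimately show ?thesis
      using card_UN_disjoint[of "{m \<in> {2, 3, 4}. T m}" "\<lambda>m. {p. normal_point m k p}"] by simp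
  qed
  have "(\<Sum>m\<in>{m \<in> {2, 3, 4}. T m}. card {p. normal_point m f p})
      = (\<Sum>m\<in>{m \<in> {2, 3, 4}. T m}. card {p. normal_point m g p})"
    by (rule sum.cong) (use card in auto)
  then show "card {p \<in> sing_points f. same_type f p h r} = card {p \<in> sing_points g. same_type g p h r}"
    using count[OF fin(1) hom(1) normal(1) Tf] count[OF fin(2) hom(2) normal(2) Tg] by simp
qed


section \<open>Locating the singular points\<close>

lemma parallel_vectors:
  fixes v w :: "complex^3"
  assumes "cross v w = 0" "w \<noteq> 0"
  obtains t where "v = t *s w"
proof -
  obtain k where k: "w $ k \<noteq> 0" using assms(2) by (auto simp: vec_eq_iff)
  have "v $ i * w $ k = v $ k * w $ i" for i
    using assms(1) exhaust_3[of i] exhaust_3[of k] by (auto simp: vec_eq_iff forall_3)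
  then have "v = (v $ k / w $ k) *s w" using k by (simp add: vec_eq_iff field_simps)
  then show ?thesis by (rule that)
qed

lemma linear_form_vector:
  assumes "homogeneous 1 l" "l \<noteq> 0"
  obtains A :: "complex^3" where "A \<noteq> 0" "\<And>v. eval l v = A $ 1 * v $ 1 + A $ 2 * v $ 2 + A $ 3 * v $ 3"
proof -
  obtain a b c where l: "l = cst a * varx + cst b * vary + cst c * varz" using linear_form[OF assms(1)] .
  show ?thesis
    by (rule that[of "vector [a, b, c]"])
      (use assms(2) in \<open>auto simp: l vec_eq_iff forall_3 cst_simps\<close>)
qed

text \<open>The vector product of two points of a line is a multiple of its coefficient vector \<open>A\<close>.\<close>

lemma line_through:
  fixes A v p :: "complex^3"
  assumes "A $ 1 * v $ 1 + A $ 2 * v $ 2 + A $ 3 * v $ 3 = 0" "A $ 1 * p $ 1 + A $ 2 * p $ 2 + A $ 3 * p $ 3 = 0"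
    and "A \<noteq> 0"
  obtains k where "cross v p = k *s A"
proof -
  have "cross (cross v p) A = 0"
    using assms(1,2) unfolding vec_eq_iff forall_3 cross_nth zero_index by (intro conjI; algebra)
  then show ?thesis using parallel_vectors assms(3) that by metis
qed

lemma eval_quadratic_form:
  assumes "homogeneous 2 f"
  shows "eval f (v + s *s p + t *s q) = eval f v + s\<^sup>2 * eval f p + t\<^sup>2 * eval f q
    + s * (eval f (v + p) - eval f v - eval f p) + t * (eval f (v + q) - eval f v - eval f q)
    + s * t * (eval f (p + q) - eval f p - eval f q)"
proof -
  have f: "homogeneous (Suc 1) f" using assms by (simp add: numeral_2_eq_2)
  note h = homogeneous_partials[OF f]
  obtain a1 a2 a3 where x: "dx f = cst a1 * varx + cst a2 * vary + cst a3 * varz" using linear_form[OF h(1)] .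
  obtain b1 b2 b3 where y: "dy f = cst b1 * varx + cst b2 * vary + cst b3 * varz" using linear_form[OF h(2)] .
  obtain c1 c2 c3 where z: "dz f = cst c1 * varx + cst c2 * vary + cst c3 * varz" using linear_form[OF h(3)] .
  have e: "2 * eval f v = v $ 1 * (a1 * v $ 1 + a2 * v $ 2 + a3 * v $ 3)
    + v $ 2 * (b1 * v $ 1 + b2 * v $ 2 + b3 * v $ 3) + v $ 3 * (c1 * v $ 1 + c2 * v $ 2 + c3 * v $ 3)" for v
    using arg_cong[OF euler[OF assms], of "\<lambda>g. eval g v"] by (simp add: x y z)
  show ?thesis
    using e[of "v + s *s p + t *s q"] e[of v] e[of p] e[of q] e[of "v + p"] e[of "v + q"] e[of "p + q"]
    unfolding vector_add_component vector_smult_component by algebra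
qed

lemma distinct_spans:
  fixes vs :: "(complex^3) list"
  assumes "sorted_wrt (\<lambda>v w. cross v w \<noteq> 0) vs" "0 \<notin> set vs"
  shows "distinct (map (\<lambda>p. vec.span {p}) vs)"
proof -
  have "vec.span {v} \<noteq> vec.span {w}" if vw: "cross v w \<noteq> 0" "v \<noteq> 0" for v w :: "complex^3"
  proof
    assume "vec.span {v} = vec.span {w}"
    then obtain c where "v = c *s w" using span_singleton_eqD vw(2) by metis
    then have "cross v w = 0" by (simp add: cross_bilinear)
    then show False using vw(1) by blast
  qed
  then show ?thesis using assms by (induction vs) auto
qed

context conic_and_lines
begin

text \<open>If \<open>[v]\<close>, \<open>[a]\<close> and \<open>[b]\<close> lie on the conic, its equation in the chart has no \<open>s\<^sup>2\<close> and \<open>t\<^sup>2\<close> terms, and the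
  other coefficients are the values of \<open>Q\<close> at \<open>v + a\<close>, \<open>v + b\<close> and \<open>a + b\<close>, which determine \<open>c\<close>. If there
  are three lines through \<open>[v]\<close>, then \<open>a\<close> and \<open>b\<close> lie on two of them and are scaled so that the third one
  is \<open>s = t\<close>.\<close>

lemma normal_point_on_conic:
  assumes "vec.span {v, a, b} = UNIV"
    and "\<forall>l\<in>set Ls. eval l v = 0 \<longrightarrow> eval l a = 0 \<or> eval l b = 0 \<or> eval l a + eval l b = 0"
    and Q: "eval Q v = 0" "eval Q a = 0" "eval Q b = 0" "eval Q (a + b) = c * (eval Q (v + a) + eval Q (v + b))"
    and "bs = map (\<lambda>l. (eval l a, eval l b)) (filter (\<lambda>l. eval l v = 0) Ls) @ [(eval Q (v + a), eval Q (v + b))]"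
    and "distinct_lines bs" "length bs = m" "2 \<le> m"
  shows "normal_point m f (vec.span {v})"
proof (rule normal_pointI[OF assms(1,2) _ assms(7-10), where c = c])
  have "eval Q (v + s *s a + t *s b) = eval Q (v + a) * s + eval Q (v + b) * t
      + c * (eval Q (v + a) + eval Q (v + b)) * s * t" for s t
    unfolding eval_quadratic_form[OF conic, of v s a t b] Q(1-3) unfolding Q(4) by (simp add: algebra_simps)
  then show "[(eval Q (v + a), eval Q (v + b))] = [] \<and> eval Q v \<noteq> 0 \<or>
      (\<exists>A B. [(eval Q (v + a), eval Q (v + b))] = [(A, B)] \<and>
        (\<forall>s t. eval Q (v + s *s a + t *s b) = A * s + B * t + c * (A + B) * s * t))"
    by blast
qed

lemmas normal_point_off_conic = normal_pointI[where qs = "[]" and c = 0, OF _ _ disjI1[OF conjI[OF refl]]]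

lemma lines_meet:
  assumes g: "g \<in> set Ls" and h: "h \<in> set Ls" "g \<noteq> h"
    and v: "eval g v = 0" "eval h v = 0" and p: "eval g p = 0" "eval h p = 0" "p \<noteq> 0"
  obtains t where "v = t *s p"
proof -
  have hom: "homogeneous 1 g" "homogeneous 1 h" "g \<noteq> 0" "h \<noteq> 0" using lines factor_nonzero g h by auto
  obtain A :: "complex^3" where A: "A \<noteq> 0" "\<And>v. eval g v = A $ 1 * v $ 1 + A $ 2 * v $ 2 + A $ 3 * v $ 3"
    using linear_form_vector[OF hom(1,3)] by metis
  obtain B :: "complex^3" where B: "B \<noteq> 0" "\<And>v. eval h v = B $ 1 * v $ 1 + B $ 2 * v $ 2 + B $ 3 * v $ 3"
    using linear_form_vector[OF hom(2,4)] by metis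
  obtain k where k: "cross v p = k *s A" using line_through[of A v p] A v p by metis
  obtain k' where k': "cross v p = k' *s B" using line_through[of B v p] B v p by metis
  have "k = 0"
  proof (rule ccontr)
    assume "k \<noteq> 0"
    then have "A = (1 / k) *s cross v p" using k by simp
    then have AB: "A = (k' / k) *s B" unfolding k' by simp
    obtain u where u: "eval g u = 0 \<longleftrightarrow> g = h" "eval h u = 0"
      using probeE[of h] g h by (metis list.set_intros(2))
    have "eval g u = (k' / k) * eval h u" unfolding A(2) B(2) unfolding AB by (simp add: algebra_simps)
    then show False using u h by simp
  qed
  then have "cross v p = 0" using k by simp
  then show ?thesis using parallel_vectors p(3) that by blast
qed

text \<open>A line meets the conic in at most two points: it is spanned by \<open>p\<close> and \<open>q\<close>, and the restriction of \<open>Q\<close>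
  to it is a multiple of the product of the two coordinates.\<close>

lemma line_meets_conic:
  assumes g: "g \<in> set Ls" and v: "eval g v = 0" "eval Q v = 0"
    and p: "eval g p = 0" "eval Q p = 0" and q: "eval g q = 0" "eval Q q = 0" and pq: "cross p q \<noteq> 0"
  obtains t where "v = t *s p \<or> v = t *s q"
proof -
  have hom: "homogeneous 1 g" "g \<noteq> 0" using lines factor_nonzero g by auto
  obtain A :: "complex^3" where A: "A \<noteq> 0" "\<And>v. eval g v = A $ 1 * v $ 1 + A $ 2 * v $ 2 + A $ 3 * v $ 3"
    using linear_form_vector[OF hom] by metis
  obtain k where k: "A $ k \<noteq> 0" using A(1) by (auto simp: vec_eq_iff)
  obtain c where c: "cross p q = c *s A" using line_through[of A p q] A p q by metis
  have "c \<noteq> 0" using pq c by auto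
  have comb: "\<exists>x y. u = x *s p + y *s q" if u: "eval g u = 0" for u
  proof -
    obtain a where a: "cross u q = a *s A" using line_through[of A u q] A u q by metis
    obtain b where b: "cross p u = b *s A" using line_through[of A p u] A p u by metis
    have det: "u $ 1 * cross p q $ 1 + u $ 2 * cross p q $ 2 + u $ 3 * cross p q $ 3 = 0"
      using u unfolding c A(2) vector_smult_component by algebra
    \<comment> \<open>Cramer's rule; \<open>u\<close>, \<open>p\<close> and \<open>q\<close> lie on a line, so their determinant vanishes\<close>
    have "\<forall>k i. cross p q $ k * u $ i = cross u q $ k * p $ i + cross p u $ k * q $ i"
      unfolding forall_3 cross_nth
      by (intro conjI; (simp only: algebra_simps; fail)?; insert det[unfolded cross_nth]; algebra)
    then have "c * A $ k * u $ i = a * A $ k * p $ i + b * A $ k * q $ i" for i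
      unfolding a b c vector_smult_component by blast
    then have "A $ k * (c * u $ i) = A $ k * (a * p $ i + b * q $ i)" for i
      by (simp add: algebra_simps)
    then have "c * u $ i = a * p $ i + b * q $ i" for i using k by simp
    then have "u = (a / c) *s p + (b / c) *s q" using \<open>c \<noteq> 0\<close> by (simp add: vec_eq_iff field_simps)
    then show ?thesis by blast
  qed
  define P where "P = eval Q (p + q) - eval Q p - eval Q q"
  have Q: "eval Q (x *s p + y *s q) = x * y * P" for x y
    using eval_quadratic_form[OF conic, of 0 x p y q] eval_homogeneous[OF conic, of 0 0] p q
    by (simp add: P_def)
  \<comment> \<open>otherwise the line would be contained in the conic\<close>
  have "P \<noteq> 0"
  proof
    assume "P = 0"
    obtain u where u: "eval g u = 0" "eval Q u = 0 \<longleftrightarrow> Q = g"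
      using probeE[of g] g by (metis list.set_intros)
    obtain x y where "u = x *s p + y *s q" using comb[OF u(1)] by blast
    then have "Q = g" using u(2) Q \<open>P = 0\<close> by simp
    then show False using distinct g by simp
  qed
  obtain x y where xy: "v = x *s p + y *s q" using comb[OF v(1)] by blast
  then have "x = 0 \<or> y = 0" using Q[of x y] v(2) \<open>P \<noteq> 0\<close> by simp
  then show ?thesis using that xy by (metis add.left_neutral add.right_neutral vec.scale_zero_left)
qed

text \<open>A list \<open>vs\<close> of points is complete if it contains, for any two lines, their common point, and for each
  line the pair in \<open>ws\<close> of its different intersection points with the conic.\<close>

lemma sing_points_subset:
  assumes nz: "0 \<notin> set vs"
    and ll: "sorted_wrt (\<lambda>g h. \<exists>p\<in>set vs. eval g p = 0 \<and> eval h p = 0) Ls"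
    and lc: "list_all2 (\<lambda>l (p, q). p \<in> set vs \<and> q \<in> set vs \<and> cross p q \<noteq> 0 \<and> eval l p = 0 \<and> eval Q p = 0
      \<and> eval l q = 0 \<and> eval Q q = 0) Ls ws"
  shows "sing_points f \<subseteq> set (map (\<lambda>p. vec.span {p}) vs)"
proof
  fix x assume "x \<in> sing_points f"
  then obtain v g h where v: "x = vec.span {v}" "v \<noteq> 0" "g \<in> set (Q # Ls)" "h \<in> set (Q # Ls)" "g \<noteq> h"
    "eval g v = 0" "eval h v = 0" unfolding sing_points_f by blast
  have *: "\<exists>p\<in>set vs. \<exists>t. v = t *s p" if g: "g \<in> set Ls" "h \<in> set (Q # Ls)" "g \<noteq> h" "eval g v = 0" "eval h v = 0" for g h
  proof (cases "h = Q")
    case True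
    obtain i where i: "i < length Ls" "g = Ls ! i" using g(1) by (metis in_set_conv_nth)
    obtain p q where pq: "p \<in> set vs" "q \<in> set vs" "cross p q \<noteq> 0" "eval g p = 0" "eval Q p = 0" "eval g q = 0" "eval Q q = 0"
      using list_all2_nthD[OF lc i(1)] i(2) by auto
    then obtain t where "v = t *s p \<or> v = t *s q"
      using line_meets_conic[of g v p q] g True by metis
    then show ?thesis using pq by blast
  next
    case False
    then have h: "h \<in> set Ls" using g(2) by simp
    obtain i j where ij: "g = Ls ! i" "h = Ls ! j" "i < length Ls" "j < length Ls" "i \<noteq> j"
      using g(1,3) h by (metis in_set_conv_nth)
    then obtain p where p: "p \<in> set vs" "eval g p = 0" "eval h p = 0"
      using ll unfolding sorted_wrt_iff_nth_less by (metis linorder_neqE_nat)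
    then obtain t where "v = t *s p"
      using lines_meet[OF g(1) h g(3) g(4,5), of p] nz by metis
    then show ?thesis using p by blast
  qed
  have "g \<in> set Ls \<or> h \<in> set Ls" using v by auto
  then obtain p t where p: "p \<in> set vs" "v = t *s p" using * v by metis
  then have "t \<noteq> 0" using v by auto
  then show "x \<in> set (map (\<lambda>p. vec.span {p}) vs)" using p v span_scale by auto
qed

lemma combinatorics:
  assumes sing: "sing_points f = set P2 \<union> set P3 \<union> set P4"
    and normal: "\<forall>p\<in>set P2. normal_point 2 f p" "\<forall>p\<in>set P3. normal_point 3 f p"
      "\<forall>p\<in>set P4. normal_point 4 f p"
    and dist: "List.distinct P2" "List.distinct P3" "List.distinct P4"
  shows "weak_combinatorics f (length Ls) 1 (length P2) (length P3) (length P4)"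
    and "{p. normal_point 2 f p} = set P2" "{p. normal_point 3 f p} = set P3" "{p. normal_point 4 f p} = set P4"
    and "ordinary_singularities f" "quasi_homogeneous_singularities f"
proof -
  have ord: "ordinary_point 2 f p" if "p \<in> set P2" for p using normal_point_ordinary normal(1) that by simp
  have ord3: "ordinary_point 3 f p" if "p \<in> set P3" for p using normal_point_ordinary normal(2) that by simp
  have ord4: "ordinary_point 4 f p" if "p \<in> set P4" for p using normal_point_ordinary normal(3) that by simp
  have uniq: "m = n" if "ordinary_point m f p" "ordinary_point n f p" "0 < n" for m n p
    using ordinary_point_unique[OF homogeneous_f that] .
  have sub: "p \<in> set P2 \<union> set P3 \<union> set P4" if "ordinary_point m f p" for m p
    using that unfolding ordinary_point_def sing[symmetric] by blast
  have 2: "{p. ordinary_point 2 f p} = set P2"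
    using ord ord3 ord4 sub uniq[of 2 _ 3] uniq[of 2 _ 4] by auto blast+
  have 3: "{p. ordinary_point 3 f p} = set P3"
    using ord ord3 ord4 sub uniq[of 3 _ 2] uniq[of 3 _ 4] by auto blast+
  have 4: "{p. ordinary_point 4 f p} = set P4"
    using ord ord3 ord4 sub uniq[of 4 _ 2] uniq[of 4 _ 3] by auto blast+
  show "weak_combinatorics f (length Ls) 1 (length P2) (length P3) (length P4)"
    unfolding weak_combinatorics_def 2 3 4
    using conic_line_arrangement_f card_curve_components[of 1] card_curve_components[of 2]
      distinct_card[OF dist(1)] distinct_card[OF dist(2)] distinct_card[OF dist(3)] ord ord3 ord4
    by (auto simp: sing)
  show "{p. normal_point 2 f p} = set P2" using 2 normal(1) normal_point_ordinary[of 2] by auto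
  show "{p. normal_point 3 f p} = set P3" using 3 normal(2) normal_point_ordinary[of 3] by auto
  show "{p. normal_point 4 f p} = set P4" using 4 normal(3) normal_point_ordinary[of 4] by auto
  show "ordinary_singularities f"
    unfolding ordinary_singularities_def sing using ord ord3 ord4 by blast
  show "quasi_homogeneous_singularities f"
    unfolding quasi_homogeneous_singularities_def
  proof
    fix p assume "p \<in> sing_points f"
    then obtain m where "normal_point m f p" unfolding sing using normal by blast
    then show "\<exists>g. local_equation f p g \<and> quasi_homogeneous_germ g"
      unfolding normal_point_def using quasi_homogeneous_lines_germ by blast
  qed
qed

end


section \<open>The singular points of \<open>F\<close>\<close>

text \<open>The factors of \<open>F\<close>.\<close>

definition F_lines :: "S list" where
  "F_lines = [vary, vary - varx, vary + varx, vary - varx - 2 * varz, vary - varx + 2 * varz, vary + varx - 2 * varz, vary + varx + 2 * varz]"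

definition F_conic :: S where
  "F_conic = varx^2 - vary^2 + 4 * cst \<i> * vary * varz - 4 * varz^2"

text \<open>The double, triple and quadruple points of the curve \<open>F = 0\<close>.\<close>

definition F_points2 :: "(complex^3) list" where
  "F_points2 = [vector [0, - 2, 1],
    vector [0, 2, 1],
    vector [- 1, 1, 1],
    vector [\<i>, - \<i>, 1],
    vector [1, - 1, 1],
    vector [- 1, - 1, 1],
    vector [1, 1, 1],
    vector [- \<i>, - \<i>, 1]]"

definition F_points3 :: "(complex^3) list" where
  "F_points3 = [vector [0, 0, 1]]"

definition F_points4 :: "(complex^3) list" where
  "F_points4 = [vector [- 1, 1, 0],
    vector [- 2, 0, 1],
    vector [2, 0, 1],
    vector [1, 1, 0]]"

interpretation F: conic_and_lines F_lines F_conic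
  "[vector [2, 4 * \<i>, 1],
    vector [- 1, 0, 0],
    vector [- 1, - 1, - 2],
    vector [- 1, 1, - 2],
    vector [- 1, - 3, - 1],
    vector [- 1, - 3, 1],
    vector [- 1, 3, 1],
    vector [- 1, 3, - 1]]"
proof
  show "homogeneous 1 l" if "l \<in> set F_lines" for l
    using that homogeneous_mult[OF homogeneous_numeral[of "Num.Bit0 Num.One"] homogeneous_var(1)]
      homogeneous_mult[OF homogeneous_numeral[of "Num.Bit0 Num.One"] homogeneous_var(3)]
    by (auto simp: F_lines_def intro!: homogeneous_add homogeneous_diff)
  show "sing_points F_conic = {}"
  proof -
    have "v = 0" if "eval (dx F_conic) v = 0" "eval (dy F_conic) v = 0" "eval (dz F_conic) v = 0" for v
    proof -
      have e: "2 * v $ 1 = 0" "4 * \<i> * v $ 3 - 2 * v $ 2 = 0" "4 * \<i> * v $ 2 - 8 * v $ 3 = 0"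
        using that by (simp_all add: F_conic_def partial_simps)
      have "v $ 2 = 2 * (\<i> * v $ 3)" using e(2) by simp
      then have "v $ 3 = 0" using e(3) by simp
      then show ?thesis using e by (simp add: vec_eq_iff forall_3)
    qed
    then show ?thesis unfolding sing_points_def by blast
  qed
  show "homogeneous 2 F_conic"
    unfolding F_conic_def by (rule homogeneous_intros refl | simp)+
  show "eval ((F_conic # F_lines) ! i) ([vector [2, 4 * \<i>, 1], vector [- 1, 0, 0], vector [- 1, - 1, - 2], vector [- 1, 1, - 2], vector [- 1, - 3, - 1], vector [- 1, - 3, 1], vector [- 1, 3, 1], vector [- 1, 3, - 1]] ! j) = 0 \<longleftrightarrow> i = j"
    if "i \<le> length F_lines" "j \<le> length F_lines" for i j
  proof -
    have "i \<in> {0, 1, 2, 3, 4, 5, 6, 7}" "j \<in> {0, 1, 2, 3, 4, 5, 6, 7}"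
      using that unfolding F_lines_def by auto
    then show ?thesis
      unfolding F_lines_def F_conic_def
      by (elim insertE emptyE; simp add: power2_eq_square complex_eq_iff)
  qed
qed (simp_all add: F_lines_def vec_eq_iff forall_3 complex_eq_iff)

lemma F_normal_points2:
  assumes "v \<in> set F_points2"
  shows "normal_point 2 F.f (vec.span {v})"
proof -
  have "normal_point 2 F.f (vec.span {vector [0, - 2, 1]})"
    by (rule F.normal_point_off_conic[where a = "vector [1, - 1, 1]" and b = "vector [- 1, 1, 0]",
          OF triple_span_UNIV_I _ _ refl])
      (simp_all add: F_lines_def F_conic_def distinct_lines_def complex_eq_iff power2_eq_square)
  moreover
  have "normal_point 2 F.f (vec.span {vector [0, 2, 1]})"
    by (rule F.normal_point_off_conic[where a = "vector [- 1, 1, 1]" and b = "vector [- 1, 1, 0]",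
          OF triple_span_UNIV_I _ _ refl])
      (simp_all add: F_lines_def F_conic_def distinct_lines_def complex_eq_iff power2_eq_square)
  moreover
  have "normal_point 2 F.f (vec.span {vector [- 1, 1, 1]})"
    by (rule F.normal_point_off_conic[where a = "vector [0, 0, 1]" and b = "vector [0, 2, 1]",
          OF triple_span_UNIV_I _ _ refl])
      (simp_all add: F_lines_def F_conic_def distinct_lines_def complex_eq_iff power2_eq_square)
  moreover
  have "normal_point 2 F.f (vec.span {vector [\<i>, - \<i>, 1]})"
    by (rule F.normal_point_on_conic[where c = "1 - \<i>" and a = "vector [\<i>, - \<i>, 0]" and b = "vector [2, 0, 1]",
          OF triple_span_UNIV_I _ _ _ _ _ refl])
      (simp_all add: F_lines_def F_conic_def distinct_lines_def complex_eq_iff power2_eq_square)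
  moreover
  have "normal_point 2 F.f (vec.span {vector [1, - 1, 1]})"
    by (rule F.normal_point_off_conic[where a = "vector [0, 0, 1]" and b = "vector [0, - 2, 1]",
          OF triple_span_UNIV_I _ _ refl])
      (simp_all add: F_lines_def F_conic_def distinct_lines_def complex_eq_iff power2_eq_square)
  moreover
  have "normal_point 2 F.f (vec.span {vector [- 1, - 1, 1]})"
    by (rule F.normal_point_off_conic[where a = "vector [0, 0, 1]" and b = "vector [0, - 2, 1]",
          OF triple_span_UNIV_I _ _ refl])
      (simp_all add: F_lines_def F_conic_def distinct_lines_def complex_eq_iff power2_eq_square)
  moreover
  have "normal_point 2 F.f (vec.span {vector [1, 1, 1]})"
    by (rule F.normal_point_off_conic[where a = "vector [0, 0, 1]" and b = "vector [0, 2, 1]",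
          OF triple_span_UNIV_I _ _ refl])
      (simp_all add: F_lines_def F_conic_def distinct_lines_def complex_eq_iff power2_eq_square)
  moreover
  have "normal_point 2 F.f (vec.span {vector [- \<i>, - \<i>, 1]})"
    by (rule F.normal_point_on_conic[where c = "1 + \<i>" and a = "vector [- \<i>, - \<i>, 0]" and b = "vector [2, 0, 1]",
          OF triple_span_UNIV_I _ _ _ _ _ refl])
      (simp_all add: F_lines_def F_conic_def distinct_lines_def complex_eq_iff power2_eq_square)
  ultimately show ?thesis using assms unfolding F_points2_def by auto
qed

lemma F_normal_points3:
  assumes "v \<in> set F_points3"
  shows "normal_point 3 F.f (vec.span {v})"
proof -
  have "normal_point 3 F.f (vec.span {vector [0, 0, 1]})"
    by (rule F.normal_point_off_conic[where a = "vector [- 2, 0, 1]" and b = "vector [1, 1, - 1]",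
          OF triple_span_UNIV_I _ _ refl])
      (simp_all add: F_lines_def F_conic_def distinct_lines_def complex_eq_iff power2_eq_square)
  then show ?thesis using assms unfolding F_points3_def by auto
qed

lemma F_normal_points4:
  assumes "v \<in> set F_points4"
  shows "normal_point 4 F.f (vec.span {v})"
proof -
  have "normal_point 4 F.f (vec.span {vector [- 1, 1, 0]})"
    by (rule F.normal_point_on_conic[where c = "- (2 * \<i>)" and a = "vector [- 2, 0, - 1]" and b = "vector [2, 0, - 1]",
          OF triple_span_UNIV_I _ _ _ _ _ refl])
      (simp_all add: F_lines_def F_conic_def distinct_lines_def complex_eq_iff power2_eq_square)
  moreover
  have "normal_point 4 F.f (vec.span {vector [- 2, 0, 1]})"
    by (rule F.normal_point_on_conic[where c = "1" and a = "vector [- 2, 2, 0]" and b = "vector [2, 0, 1]",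
          OF triple_span_UNIV_I _ _ _ _ _ refl])
      (simp_all add: F_lines_def F_conic_def distinct_lines_def complex_eq_iff power2_eq_square)
  moreover
  have "normal_point 4 F.f (vec.span {vector [2, 0, 1]})"
    by (rule F.normal_point_on_conic[where c = "1" and a = "vector [2, 2, 0]" and b = "vector [- 2, 0, 1]",
          OF triple_span_UNIV_I _ _ _ _ _ refl])
      (simp_all add: F_lines_def F_conic_def distinct_lines_def complex_eq_iff power2_eq_square)
  moreover
  have "normal_point 4 F.f (vec.span {vector [1, 1, 0]})"
    by (rule F.normal_point_on_conic[where c = "- (2 * \<i>)" and a = "vector [2, 0, - 1]" and b = "vector [- 2, 0, - 1]",
          OF triple_span_UNIV_I _ _ _ _ _ refl])
      (simp_all add: F_lines_def F_conic_def distinct_lines_def complex_eq_iff power2_eq_square)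
  ultimately show ?thesis using assms unfolding F_points4_def by auto
qed

lemma F_sing_points:
  "sing_points F.f = set (map (\<lambda>v. vec.span {v}) F_points2) \<union> set (map (\<lambda>v. vec.span {v}) F_points3)
     \<union> set (map (\<lambda>v. vec.span {v}) F_points4)"
proof
  have "sing_points F.f \<subseteq> set (map (\<lambda>v. vec.span {v}) (F_points2 @ F_points3 @ F_points4))"
  proof (rule F.sing_points_subset)
    show "0 \<notin> set (F_points2 @ F_points3 @ F_points4)"
      by (simp add: F_points2_def F_points3_def F_points4_def vec_eq_iff forall_3)
    \<comment> \<open>the common points of two lines\<close>
    show "sorted_wrt (\<lambda>g h. \<exists>p\<in>set (F_points2 @ F_points3 @ F_points4). eval g p = 0 \<and> eval h p = 0) F_lines"
      by (simp add: F_lines_def F_points2_def F_points3_def F_points4_def)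
    \<comment> \<open>the intersection points of each line with the conic\<close>
    show "list_all2 (\<lambda>l (p, q). p \<in> set (F_points2 @ F_points3 @ F_points4)
        \<and> q \<in> set (F_points2 @ F_points3 @ F_points4)
        \<and> cross p q \<noteq> 0 \<and> eval l p = 0 \<and> eval F_conic p = 0 \<and> eval l q = 0 \<and> eval F_conic q = 0) F_lines
      [(vector [- 2, 0, 1], vector [2, 0, 1]),
       (vector [1, 1, 0], vector [- \<i>, - \<i>, 1]),
       (vector [\<i>, - \<i>, 1], vector [- 1, 1, 0]),
       (vector [- 2, 0, 1], vector [1, 1, 0]),
       (vector [2, 0, 1], vector [1, 1, 0]),
       (vector [- 1, 1, 0], vector [2, 0, 1]),
       (vector [- 1, 1, 0], vector [- 2, 0, 1])]"
      by (simp add: F_lines_def F_conic_def F_points2_def F_points3_def F_points4_def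
          vec_eq_iff[of _ 0] forall_3 power2_eq_square complex_eq_iff)
  qed
  then show "sing_points F.f \<subseteq> set (map (\<lambda>v. vec.span {v}) F_points2) \<union> set (map (\<lambda>v. vec.span {v}) F_points3)
     \<union> set (map (\<lambda>v. vec.span {v}) F_points4)"
    by auto
  show "set (map (\<lambda>v. vec.span {v}) F_points2) \<union> set (map (\<lambda>v. vec.span {v}) F_points3)
     \<union> set (map (\<lambda>v. vec.span {v}) F_points4) \<subseteq> sing_points F.f"
    using F_normal_points2 F_normal_points3 F_normal_points4 by (auto simp: normal_point_def)
qed

lemma F_distinct:
  "distinct (map (\<lambda>v. vec.span {v}) F_points2)" "distinct (map (\<lambda>v. vec.span {v}) F_points3)"
  "distinct (map (\<lambda>v. vec.span {v}) F_points4)"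
  by (rule distinct_spans; simp add: F_points2_def F_points3_def F_points4_def vec_eq_iff forall_3 complex_eq_iff)+

lemmas F_combinatorics = F.combinatorics[OF F_sing_points _ _ _ F_distinct]


section \<open>The singular points of \<open>G\<close>\<close>

text \<open>A root of \<open>r\<^sup>2 = 3 r - 1 + \<i>\<close>; the other one is \<open>3 - G_root\<close>. This is the equation for the points
  \<open>[1 : 1 : r]\<close> in which the line \<open>x = y\<close> meets the conic of \<open>G\<close>.\<close>

definition G_root :: complex where
  "G_root = (3 + csqrt (5 + 4 * \<i>)) / 2"

lemma G_root: "G_root * G_root = 3 * G_root - 1 + \<i>"
  "(3 - G_root) * (3 - G_root) = 3 * (3 - G_root) - 1 + \<i>"
proof -
  have "(2 * G_root - 3)\<^sup>2 = 5 + 4 * \<i>" by (simp add: G_root_def)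
  then show "G_root * G_root = 3 * G_root - 1 + \<i>"
    "(3 - G_root) * (3 - G_root) = 3 * (3 - G_root) - 1 + \<i>" by algebra+
qed

lemma G_root_cases:
  assumes "r * r = 3 * r - 1 + \<i>"
  shows "r \<noteq> 0" "r \<noteq> 1" "r \<noteq> 2" "r \<noteq> 3" "2 * r \<noteq> 3" "2 * r + 4 + 5 * \<i> \<noteq> 0"
proof -
  show "r \<noteq> 0" "r \<noteq> 1" "r \<noteq> 2" "r \<noteq> 3" using assms by (auto simp: complex_eq_iff)
  show "2 * r \<noteq> 3"
  proof
    assume "2 * r = 3"
    then have "r = 3 / 2" by (simp add: field_simps)
    then show False using assms by (simp add: complex_eq_iff)
  qed
  show "2 * r + 4 + 5 * \<i> \<noteq> 0"
  proof
    assume "2 * r + 4 + 5 * \<i> = 0"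
    then have "r = - 2 - 5 / 2 * \<i>" by (simp add: complex_eq_iff)
    then show False using assms by (simp add: complex_eq_iff)
  qed
qed

text \<open>The factors of \<open>G\<close>.\<close>

definition G_lines :: "S list" where
  "G_lines = [varx, vary, varz, varx - vary, 2 * varx - varz, vary - varz, 2 * varx + vary - varz]"

definition G_conic :: S where
  "G_conic = varz^2 - vary * varz - 2 * varx * varz + (1 - cst \<i>) * varx * vary"

text \<open>The double, triple and quadruple points of the curve \<open>G = 0\<close>.\<close>

definition G_points2 :: "(complex^3) list" where
  "G_points2 = [vector [1, - 2, 0],
    vector [1, 1, 0],
    vector [1, 1, 1],
    vector [1, 1, 2],
    vector [1, 1, 3],
    vector [1, 2, 2],
    vector [1, 1, G_root],
    vector [1, 1, 3 - G_root]]"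

definition G_points3 :: "(complex^3) list" where
  "G_points3 = [vector [0, 0, 1]]"

definition G_points4 :: "(complex^3) list" where
  "G_points4 = [vector [0, 1, 0],
    vector [0, 1, 1],
    vector [1, 0, 0],
    vector [1, 0, 2]]"

interpretation G: conic_and_lines G_lines G_conic
  "[vector [\<i>, 2 + \<i>, 1],
    vector [0, - 1, 1],
    vector [- 1, 0, - 1],
    vector [- 1, 1, 0],
    vector [- 1, - 1, 1],
    vector [- 1, 1, - 2],
    vector [- 1, 1, 1],
    vector [- 1, 1, - 1]]"
proof
  show "homogeneous 1 l" if "l \<in> set G_lines" for l
    using that homogeneous_mult[OF homogeneous_numeral[of "Num.Bit0 Num.One"] homogeneous_var(1)]
      homogeneous_mult[OF homogeneous_numeral[of "Num.Bit0 Num.One"] homogeneous_var(3)]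
    by (auto simp: G_lines_def intro!: homogeneous_add homogeneous_diff)
  show "sing_points G_conic = {}"
  proof -
    have "v = 0" if "eval (dx G_conic) v = 0" "eval (dy G_conic) v = 0" "eval (dz G_conic) v = 0" for v
    proof -
      have e: "(1 - \<i>) * v $ 2 - 2 * v $ 3 = 0" "(1 - \<i>) * v $ 1 - v $ 3 = 0" "2 * v $ 3 - v $ 2 - 2 * v $ 1 = 0"
        using that by (simp_all add: G_conic_def partial_simps)
      have i_squared: "\<i>\<^sup>2 = - 1" by simp
      have "4 * v $ 1 = 0" "v $ 2 = - 2 * \<i> * v $ 1" "v $ 3 = (1 - \<i>) * v $ 1"
        using e i_squared by algebra+
      then show ?thesis by (simp add: vec_eq_iff forall_3)
    qed
    then show ?thesis unfolding sing_points_def by blast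
  qed
  show "homogeneous 2 G_conic"
    unfolding G_conic_def by (rule homogeneous_intros refl | simp)+
  show "eval ((G_conic # G_lines) ! i) ([vector [\<i>, 2 + \<i>, 1], vector [0, - 1, 1], vector [- 1, 0, - 1], vector [- 1, 1, 0], vector [- 1, - 1, 1], vector [- 1, 1, - 2], vector [- 1, 1, 1], vector [- 1, 1, - 1]] ! j) = 0 \<longleftrightarrow> i = j"
    if "i \<le> length G_lines" "j \<le> length G_lines" for i j
  proof -
    have "i \<in> {0, 1, 2, 3, 4, 5, 6, 7}" "j \<in> {0, 1, 2, 3, 4, 5, 6, 7}"
      using that unfolding G_lines_def by auto
    then show ?thesis
      unfolding G_lines_def G_conic_def
      by (elim insertE emptyE; simp add: power2_eq_square complex_eq_iff)
  qed
qed (simp_all add: G_lines_def vec_eq_iff forall_3 complex_eq_iff)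

text \<open>The chart uses the other point of the conic on the line \<open>x = y\<close> and the point \<open>[1 : 0 : 0]\<close> of the conic.
  The parameter of the Moebius transformation is the quotient \<open>Q(a + b) / (Q(v + a) + Q(v + b))\<close>, whose
  denominator is \<open>- (2 r + 4 + 5 \<i>)\<close>.\<close>

lemma G_normal_point_root:
  assumes r: "r * r = 3 * r - 1 + \<i>"
  shows "normal_point 2 G.f (vec.span {vector [1, 1, r]})"
proof (rule G.normal_point_on_conic[where a = "vector [1, 0, 0]" and b = "vector [1, 1, 3 - r]"
      and c = "(5 + \<i> - 2 * r) / (2 * r + 4 + 5 * \<i>)", OF triple_span_UNIV_I _ _ _ _ _ refl])
  note ne = G_root_cases[OF r]
  have Qa: "eval G_conic (vector [1, 1, r] + vector [1, 0, 0]) = 1 - \<i> - 2 * r"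
    "eval G_conic (vector [1, 1, r]) = 0" "eval G_conic (vector [1, 0, 0]) = 0" "eval G_conic (vector [1, 1, 3 - r]) = 0"
    "eval G_conic (vector [1, 1, r] + vector [1, 1, 3 - r]) = - 5 - 4 * \<i>"
    "eval G_conic (vector [1, 0, 0] + vector [1, 1, 3 - r]) = 2 * r - 5 - \<i>"
    using r by (simp_all add: G_conic_def power2_eq_square algebra_simps)
  show "eval G_conic (vector [1, 1, r]) = 0" "eval G_conic (vector [1, 0, 0]) = 0" "eval G_conic (vector [1, 1, 3 - r]) = 0"
    by (fact Qa)+
  have sum: "1 - \<i> - 2 * r + (- 5 - 4 * \<i>) = - (2 * r + 4 + 5 * \<i>)" by simp
  have "2 * r - 5 - \<i> = (5 + \<i> - 2 * r) / D * (- D)" if "D \<noteq> 0" for D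
    using that by simp
  from this[OF ne(6)] show "eval G_conic (vector [1, 0, 0] + vector [1, 1, 3 - r])
    = (5 + \<i> - 2 * r) / (2 * r + 4 + 5 * \<i>) * (eval G_conic (vector [1, 1, r] + vector [1, 0, 0])
      + eval G_conic (vector [1, 1, r] + vector [1, 1, 3 - r]))"
    unfolding Qa sum .
  show "distinct_lines (map (\<lambda>l. (eval l (vector [1, 0, 0]), eval l (vector [1, 1, 3 - r])))
      (filter (\<lambda>l. eval l (vector [1, 1, r]) = 0) G_lines) @
      [(eval G_conic (vector [1, 1, r] + vector [1, 0, 0]), eval G_conic (vector [1, 1, r] + vector [1, 1, 3 - r]))])"
    unfolding Qa using ne by (simp add: G_lines_def distinct_lines_def complex_eq_iff)
qed (use G_root_cases[OF r] in \<open>simp_all add: G_lines_def\<close>)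

lemma G_normal_points2:
  assumes "v \<in> set G_points2"
  shows "normal_point 2 G.f (vec.span {v})"
proof -
  have "normal_point 2 G.f (vec.span {vector [1, - 2, 0]})"
    by (rule G.normal_point_off_conic[where a = "vector [0, 1, 0]" and b = "vector [0, 1, 1]",
          OF triple_span_UNIV_I _ _ refl])
      (simp_all add: G_lines_def G_conic_def distinct_lines_def complex_eq_iff power2_eq_square)
  moreover
  have "normal_point 2 G.f (vec.span {vector [1, 1, 0]})"
    by (rule G.normal_point_off_conic[where a = "vector [0, 1, 0]" and b = "vector [0, 0, 1]",
          OF triple_span_UNIV_I _ _ refl])
      (simp_all add: G_lines_def G_conic_def distinct_lines_def complex_eq_iff power2_eq_square)
  moreover
  have "normal_point 2 G.f (vec.span {vector [1, 1, 1]})"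
    by (rule G.normal_point_off_conic[where a = "vector [0, 0, 1]" and b = "vector [0, 1, 1]",
          OF triple_span_UNIV_I _ _ refl])
      (simp_all add: G_lines_def G_conic_def distinct_lines_def complex_eq_iff power2_eq_square)
  moreover
  have "normal_point 2 G.f (vec.span {vector [1, 1, 2]})"
    by (rule G.normal_point_off_conic[where a = "vector [0, 0, 1]" and b = "vector [0, 1, 0]",
          OF triple_span_UNIV_I _ _ refl])
      (simp_all add: G_lines_def G_conic_def distinct_lines_def complex_eq_iff power2_eq_square)
  moreover
  have "normal_point 2 G.f (vec.span {vector [1, 1, 3]})"
    by (rule G.normal_point_off_conic[where a = "vector [0, 0, 1]" and b = "vector [0, 1, 1]",
          OF triple_span_UNIV_I _ _ refl])
      (simp_all add: G_lines_def G_conic_def distinct_lines_def complex_eq_iff power2_eq_square)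
  moreover
  have "normal_point 2 G.f (vec.span {vector [1, 2, 2]})"
    by (rule G.normal_point_off_conic[where a = "vector [0, 1, 0]" and b = "vector [0, 1, 1]",
          OF triple_span_UNIV_I _ _ refl])
      (simp_all add: G_lines_def G_conic_def distinct_lines_def complex_eq_iff power2_eq_square)
  moreover
  have "normal_point 2 G.f (vec.span {vector [1, 1, G_root]})"
    by (rule G_normal_point_root[OF G_root(1)])
  moreover
  have "normal_point 2 G.f (vec.span {vector [1, 1, 3 - G_root]})"
    by (rule G_normal_point_root[OF G_root(2)])
  ultimately show ?thesis using assms unfolding G_points2_def by auto
qed

lemma G_normal_points3:
  assumes "v \<in> set G_points3"
  shows "normal_point 3 G.f (vec.span {v})"
proof -
  have "normal_point 3 G.f (vec.span {vector [0, 0, 1]})"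
    by (rule G.normal_point_off_conic[where a = "vector [0, 1, 0]" and b = "vector [1, 0, 0]",
          OF triple_span_UNIV_I _ _ refl])
      (simp_all add: G_lines_def G_conic_def distinct_lines_def complex_eq_iff power2_eq_square)
  then show ?thesis using assms unfolding G_points3_def by auto
qed

lemma G_normal_points4:
  assumes "v \<in> set G_points4"
  shows "normal_point 4 G.f (vec.span {v})"
proof -
  have "normal_point 4 G.f (vec.span {vector [0, 1, 0]})"
    by (rule G.normal_point_on_conic[where c = "2" and a = "vector [0, 2, 2]" and b = "vector [1, 0, 0]",
          OF triple_span_UNIV_I _ _ _ _ _ refl])
      (simp_all add: G_lines_def G_conic_def distinct_lines_def complex_eq_iff power2_eq_square)
  moreover
  have "normal_point 4 G.f (vec.span {vector [0, 1, 1]})"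
    by (rule G.normal_point_on_conic[where c = "2" and a = "vector [1, 0, 2]" and b = "vector [0, 2, 0]",
          OF triple_span_UNIV_I _ _ _ _ _ refl])
      (simp_all add: G_lines_def G_conic_def distinct_lines_def complex_eq_iff power2_eq_square)
  moreover
  have "normal_point 4 G.f (vec.span {vector [1, 0, 0]})"
    by (rule G.normal_point_on_conic[where c = "1" and a = "vector [0, 2, 0]" and b = "vector [1, 0, 2]",
          OF triple_span_UNIV_I _ _ _ _ _ refl])
      (simp_all add: G_lines_def G_conic_def distinct_lines_def complex_eq_iff power2_eq_square)
  moreover
  have "normal_point 4 G.f (vec.span {vector [1, 0, 2]})"
    by (rule G.normal_point_on_conic[where c = "1" and a = "vector [1, 0, 0]" and b = "vector [0, 2, 2]",
          OF triple_span_UNIV_I _ _ _ _ _ refl])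
      (simp_all add: G_lines_def G_conic_def distinct_lines_def complex_eq_iff power2_eq_square)
  ultimately show ?thesis using assms unfolding G_points4_def by auto
qed

lemma G_sing_points:
  "sing_points G.f = set (map (\<lambda>v. vec.span {v}) G_points2) \<union> set (map (\<lambda>v. vec.span {v}) G_points3)
     \<union> set (map (\<lambda>v. vec.span {v}) G_points4)"
proof
  have "sing_points G.f \<subseteq> set (map (\<lambda>v. vec.span {v}) (G_points2 @ G_points3 @ G_points4))"
  proof (rule G.sing_points_subset)
    show "0 \<notin> set (G_points2 @ G_points3 @ G_points4)"
      by (simp add: G_points2_def G_points3_def G_points4_def vec_eq_iff forall_3)
    \<comment> \<open>the common points of two lines\<close>
    show "sorted_wrt (\<lambda>g h. \<exists>p\<in>set (G_points2 @ G_points3 @ G_points4). eval g p = 0 \<and> eval h p = 0) G_lines"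
      by (simp add: G_lines_def G_points2_def G_points3_def G_points4_def)
    \<comment> \<open>the intersection points of each line with the conic\<close>
    show "list_all2 (\<lambda>l (p, q). p \<in> set (G_points2 @ G_points3 @ G_points4)
        \<and> q \<in> set (G_points2 @ G_points3 @ G_points4)
        \<and> cross p q \<noteq> 0 \<and> eval l p = 0 \<and> eval G_conic p = 0 \<and> eval l q = 0 \<and> eval G_conic q = 0) G_lines
      [(vector [0, 1, 0], vector [0, 1, 1]),
       (vector [1, 0, 0], vector [1, 0, 2]),
       (vector [0, 1, 0], vector [1, 0, 0]),
       (vector [1, 1, G_root], vector [1, 1, 3 - G_root]),
       (vector [0, 1, 0], vector [1, 0, 2]),
       (vector [0, 1, 1], vector [1, 0, 0]),
       (vector [0, 1, 1], vector [1, 0, 2])]"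
      by (simp add: G_lines_def G_conic_def G_points2_def G_points3_def G_points4_def
          vec_eq_iff[of _ 0] forall_3 power2_eq_square
          G_root_cases(5)[OF G_root(1), unfolded mult.commute[of 2]]
          G_root_cases[OF G_root(1)] G_root_cases[OF G_root(2)] G_root algebra_simps)
  qed
  then show "sing_points G.f \<subseteq> set (map (\<lambda>v. vec.span {v}) G_points2) \<union> set (map (\<lambda>v. vec.span {v}) G_points3)
     \<union> set (map (\<lambda>v. vec.span {v}) G_points4)"
    by auto
  show "set (map (\<lambda>v. vec.span {v}) G_points2) \<union> set (map (\<lambda>v. vec.span {v}) G_points3)
     \<union> set (map (\<lambda>v. vec.span {v}) G_points4) \<subseteq> sing_points G.f"
    using G_normal_points2 G_normal_points3 G_normal_points4 by (auto simp: normal_point_def)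
qed

lemma G_distinct:
  "distinct (map (\<lambda>v. vec.span {v}) G_points2)" "distinct (map (\<lambda>v. vec.span {v}) G_points3)"
  "distinct (map (\<lambda>v. vec.span {v}) G_points4)"
  by (rule distinct_spans; simp add: G_points2_def G_points3_def G_points4_def vec_eq_iff forall_3
      G_root_cases(5)[OF G_root(1), unfolded mult.commute[of 2]]
          G_root_cases[OF G_root(1)] G_root_cases[OF G_root(2)] G_root algebra_simps)+

lemmas G_combinatorics = G.combinatorics[OF G_sing_points _ _ _ G_distinct]


section \<open>Explicit syzygies\<close>

lemma cst_i: "cst \<i> * cst \<i> = - 1"
  using cst_simps(6)[of \<i> \<i>] by (simp add: cst_simps)

text \<open>The derivation with coefficients \<open>r\<close> maps each factor of \<open>F\<close> to a multiple of itself, and the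
  eight cofactors add up to 0; hence it annihilates \<open>F\<close>.\<close>

definition F_logarithmic :: "'a::comm_ring_1 \<Rightarrow> 'a \<Rightarrow> 'a \<Rightarrow> 'a \<Rightarrow> 'a^3 \<Rightarrow> bool" where
  "F_logarithmic i x y z r \<longleftrightarrow> (\<exists>k0 k1 k2 k3 k4 k5 k6.
     r $ 2 = k0 * y \<and>
     - r $ 1 + r $ 2 = k1 * (y - x) \<and>
     r $ 1 + r $ 2 = k2 * (y + x) \<and>
     - r $ 1 + r $ 2 - 2 * r $ 3 = k3 * (y - x - 2 * z) \<and>
     - r $ 1 + r $ 2 + 2 * r $ 3 = k4 * (y - x + 2 * z) \<and>
     r $ 1 + r $ 2 - 2 * r $ 3 = k5 * (y + x - 2 * z) \<and>
     r $ 1 + r $ 2 + 2 * r $ 3 = k6 * (y + x + 2 * z) \<and>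
     r $ 1 * (2 * x) + r $ 2 * (4 * i * z - 2 * y) + r $ 3 * (4 * i * y - 8 * z)
       = - (k0 + k1 + k2 + k3 + k4 + k5 + k6) * (x^2 - y^2 + 4 * i * y * z - 4 * z^2))"

lemma F_logarithmic_AR:
  assumes "F_logarithmic (cst \<i>) varx vary varz r"
  shows "r \<in> AR F.f"
proof -
  have lin: "along r vary = r $ 2"
    "along r (vary - varx) = - r $ 1 + r $ 2"
    "along r (vary + varx) = r $ 1 + r $ 2"
    "along r (vary - varx - 2 * varz) = - r $ 1 + r $ 2 - 2 * r $ 3"
    "along r (vary - varx + 2 * varz) = - r $ 1 + r $ 2 + 2 * r $ 3"
    "along r (vary + varx - 2 * varz) = r $ 1 + r $ 2 - 2 * r $ 3"
    "along r (vary + varx + 2 * varz) = r $ 1 + r $ 2 + 2 * r $ 3"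
    by (simp_all add: along_def partial_simps algebra_simps)
  have con: "along r F_conic = r $ 1 * (2 * varx) + r $ 2 * (4 * cst \<i> * varz - 2 * vary) + r $ 3 * (4 * cst \<i> * vary - 8 * varz)"
    by (simp add: F_conic_def along_def partial_simps algebra_simps)
  obtain k0 k1 k2 k3 k4 k5 k6 where fac: "along r vary = k0 * vary"
    "along r (vary - varx) = k1 * (vary - varx)"
    "along r (vary + varx) = k2 * (vary + varx)"
    "along r (vary - varx - 2 * varz) = k3 * (vary - varx - 2 * varz)"
    "along r (vary - varx + 2 * varz) = k4 * (vary - varx + 2 * varz)"
    "along r (vary + varx - 2 * varz) = k5 * (vary + varx - 2 * varz)"
    "along r (vary + varx + 2 * varz) = k6 * (vary + varx + 2 * varz)"
    "along r F_conic = - (k0 + k1 + k2 + k3 + k4 + k5 + k6) * F_conic"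
    using assms unfolding F_logarithmic_def
    by (elim exE conjE) (rule that; (unfold lin con)?; (unfold F_conic_def)?; assumption)
  have "list_all2 (\<lambda>f k. along r f = k * f) (F_conic # F_lines)
      [- (k0 + k1 + k2 + k3 + k4 + k5 + k6), k0, k1, k2, k3, k4, k5, k6]"
    unfolding F_lines_def by (intro list.rel_intros fac)
  from AR_prod_listI[OF this] show ?thesis by simp
qed

text \<open>Two syzygies of degree 4 between the partial derivatives of \<open>F\<close>, obtained by solving a linear
  system for the coefficients. They are written over an arbitrary ring, with \<open>i\<close> a square root of
  \<open>-1\<close>, so that the same expressions serve for the polynomials and for their values.\<close>

definition F_syz1 :: "'a::comm_ring_1 \<Rightarrow> 'a \<Rightarrow> 'a \<Rightarrow> 'a \<Rightarrow> 'a^3" where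
  "F_syz1 i x y z = vector [
     - (x^4) + 10 * x^2 * y^2 - 28 * x^2 * z^2 - 9 * y^4 + 36 * y^2 * z^2,
     8 * x^3 * y - 8 * x * y^3 + 8 * x * y * z^2,
     - 10 * x^3 * z + 10 * x * y^2 * z + 8 * x * z^3]"

definition F_syz2 :: "'a::comm_ring_1 \<Rightarrow> 'a \<Rightarrow> 'a \<Rightarrow> 'a \<Rightarrow> 'a^3" where
  "F_syz2 i x y z = vector [
     12 * i * x^3 * y - 40 * x^3 * z - 76 * i * x * y^3 + 136 * x * y^2 * z + 80 * i * x * y * z^2 - 96 * x * z^3,
     - 60 * i * x^2 * y^2 + 104 * x^2 * y * z - 4 * i * y^4 - 8 * y^3 * z + 80 * i * y^2 * z^2 - 96 * y * z^3,
     - 9 * x^4 + 18 * x^2 * y^2 + 48 * i * x^2 * y * z - 40 * x^2 * z^2 - 9 * y^4 + 32 * i * y^3 * z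
     - 8 * y^2 * z^2 - 64 * i * y * z^3 + 48 * z^4]"

lemma F_syz1_logarithmic:
  fixes i x y z :: "'a::idom"
  shows "F_logarithmic i x y z (F_syz1 i x y z)"
  unfolding F_logarithmic_def F_syz1_def vector_3
  by (rule exI[of _ "8 * x^3 - 8 * x * y^2 + 8 * x * z^2"],
    rule exI[of _ "- (x^3) - 9 * x^2 * y + x * y^2 - 28 * x * z^2 + 9 * y^3 - 36 * y * z^2"],
    rule exI[of _ "- (x^3) + 9 * x^2 * y + x * y^2 - 28 * x * z^2 - 9 * y^3 + 36 * y * z^2"],
    rule exI[of _ "- (x^3) - 9 * x^2 * y - 18 * x^2 * z + x * y^2 + 8 * x * z^2 + 9 * y^3 + 18 * y^2 * z"],
    rule exI[of _ "- (x^3) - 9 * x^2 * y + 18 * x^2 * z + x * y^2 + 8 * x * z^2 + 9 * y^3 - 18 * y^2 * z"],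
    rule exI[of _ "- (x^3) + 9 * x^2 * y + 18 * x^2 * z + x * y^2 + 8 * x * z^2 - 9 * y^3 - 18 * y^2 * z"],
    rule exI[of _ "- (x^3) + 9 * x^2 * y - 18 * x^2 * z + x * y^2 + 8 * x * z^2 - 9 * y^3 + 18 * y^2 * z"],
    intro conjI; algebra)

lemma F_syz1_AR: "F_syz1 (cst \<i>) varx vary varz \<in> AR F.f"
  by (rule F_logarithmic_AR[OF F_syz1_logarithmic])

lemma F_syz1_homogeneous: "homogeneous 4 (F_syz1 (cst \<i>) varx vary varz $ n)"
proof -
  have "\<forall>n. homogeneous 4 (F_syz1 (cst \<i>) varx vary varz $ n)"
    unfolding forall_3 F_syz1_def vector_3
    by (intro conjI) (rule homogeneous_intros refl | simp)+
  then show ?thesis by blast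
qed

lemma F_syz1_eval:
  "eval (F_syz1 (cst \<i>) varx vary varz $ n) v = F_syz1 \<i> (v $ 1) (v $ 2) (v $ 3) $ n"
  using exhaust_3[of n] by (auto simp: F_syz1_def)

lemma F_syz2_logarithmic:
  fixes i x y z :: "'a::idom"
  assumes i: "i * i = - 1"
  shows "F_logarithmic i x y z (F_syz2 i x y z)"
  unfolding F_logarithmic_def F_syz2_def vector_3
  by (rule exI[of _ "- 60 * i * x^2 * y + 104 * x^2 * z - 4 * i * y^3 - 8 * y^2 * z + 80 * i * y * z^2 - 96 * z^3"],
    rule exI[of _ "12 * i * x^2 * y - 40 * x^2 * z + 72 * i * x * y^2 - 144 * x * y * z - 4 * i * y^3 - 8 * y^2 * z
      + 80 * i * y * z^2 - 96 * z^3"],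
    rule exI[of _ "12 * i * x^2 * y - 40 * x^2 * z - 72 * i * x * y^2 + 144 * x * y * z - 4 * i * y^3 - 8 * y^2 * z
      + 80 * i * y * z^2 - 96 * z^3"],
    rule exI[of _ "- 18 * x^3 - (18 - 12 * i) * x^2 * y - 4 * x^2 * z + (18 + 72 * i) * x * y^2 - (72 - 72 * i) * x * y * z
      - 72 * x * z^2 + (18 - 4 * i) * y^3 + (28 - 72 * i) * y^2 * z + (72 - 64 * i) * y * z^2 + 48 * z^3"],
    rule exI[of _ "18 * x^3 + (18 + 12 * i) * x^2 * y - 4 * x^2 * z - (18 - 72 * i) * x * y^2 - (72 + 72 * i) * x * y * z
      + 72 * x * z^2 - (18 + 4 * i) * y^3 + (28 + 72 * i) * y^2 * z - (72 + 64 * i) * y * z^2 + 48 * z^3"],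
    rule exI[of _ "18 * x^3 - (18 - 12 * i) * x^2 * y - 4 * x^2 * z - (18 + 72 * i) * x * y^2 + (72 - 72 * i) * x * y * z
      + 72 * x * z^2 + (18 - 4 * i) * y^3 + (28 - 72 * i) * y^2 * z + (72 - 64 * i) * y * z^2 + 48 * z^3"],
    rule exI[of _ "- 18 * x^3 + (18 + 12 * i) * x^2 * y - 4 * x^2 * z + (18 - 72 * i) * x * y^2 + (72 + 72 * i) * x * y * z
      - 72 * x * z^2 - (18 + 4 * i) * y^3 + (28 + 72 * i) * y^2 * z - (72 + 64 * i) * y * z^2 + 48 * z^3"],
    intro conjI; (algebra | simp add: i algebra_simps power2_eq_square eval_nat_numeral))

lemma F_syz2_AR: "F_syz2 (cst \<i>) varx vary varz \<in> AR F.f"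
  by (rule F_logarithmic_AR[OF F_syz2_logarithmic[OF cst_i]])

lemma F_syz2_homogeneous: "homogeneous 4 (F_syz2 (cst \<i>) varx vary varz $ n)"
proof -
  have "\<forall>n. homogeneous 4 (F_syz2 (cst \<i>) varx vary varz $ n)"
    unfolding forall_3 F_syz2_def vector_3
    by (intro conjI) (rule homogeneous_intros refl | simp)+
  then show ?thesis by blast
qed

lemma F_syz2_eval:
  "eval (F_syz2 (cst \<i>) varx vary varz $ n) v = F_syz2 \<i> (v $ 1) (v $ 2) (v $ 3) $ n"
  using exhaust_3[of n] by (auto simp: F_syz2_def)

text \<open>The derivation with coefficients \<open>r\<close> maps each factor of \<open>G\<close> to a multiple of itself, and the
  eight cofactors add up to 0; hence it annihilates \<open>G\<close>.\<close>

definition G_logarithmic :: "'a::comm_ring_1 \<Rightarrow> 'a \<Rightarrow> 'a \<Rightarrow> 'a \<Rightarrow> 'a^3 \<Rightarrow> bool" where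
  "G_logarithmic i x y z r \<longleftrightarrow> (\<exists>k0 k1 k2 k3 k4 k5 k6.
     r $ 1 = k0 * x \<and>
     r $ 2 = k1 * y \<and>
     r $ 3 = k2 * z \<and>
     r $ 1 - r $ 2 = k3 * (x - y) \<and>
     2 * r $ 1 - r $ 3 = k4 * (2 * x - z) \<and>
     r $ 2 - r $ 3 = k5 * (y - z) \<and>
     2 * r $ 1 + r $ 2 - r $ 3 = k6 * (2 * x + y - z) \<and>
     r $ 1 * ((1 - i) * y - 2 * z) + r $ 2 * ((1 - i) * x - z) + r $ 3 * (2 * z - y - 2 * x)
       = - (k0 + k1 + k2 + k3 + k4 + k5 + k6) * (z^2 - y * z - 2 * x * z + (1 - i) * x * y))"

lemma G_logarithmic_AR:
  assumes "G_logarithmic (cst \<i>) varx vary varz r"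
  shows "r \<in> AR G.f"
proof -
  have lin: "along r varx = r $ 1"
    "along r vary = r $ 2"
    "along r varz = r $ 3"
    "along r (varx - vary) = r $ 1 - r $ 2"
    "along r (2 * varx - varz) = 2 * r $ 1 - r $ 3"
    "along r (vary - varz) = r $ 2 - r $ 3"
    "along r (2 * varx + vary - varz) = 2 * r $ 1 + r $ 2 - r $ 3"
    by (simp_all add: along_def partial_simps algebra_simps)
  have con: "along r G_conic = r $ 1 * ((1 - cst \<i>) * vary - 2 * varz) + r $ 2 * ((1 - cst \<i>) * varx - varz) + r $ 3 * (2 * varz - vary - 2 * varx)"
    by (simp add: G_conic_def along_def partial_simps algebra_simps)
  obtain k0 k1 k2 k3 k4 k5 k6 where fac: "along r varx = k0 * varx"
    "along r vary = k1 * vary"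
    "along r varz = k2 * varz"
    "along r (varx - vary) = k3 * (varx - vary)"
    "along r (2 * varx - varz) = k4 * (2 * varx - varz)"
    "along r (vary - varz) = k5 * (vary - varz)"
    "along r (2 * varx + vary - varz) = k6 * (2 * varx + vary - varz)"
    "along r G_conic = - (k0 + k1 + k2 + k3 + k4 + k5 + k6) * G_conic"
    using assms unfolding G_logarithmic_def
    by (elim exE conjE) (rule that; (unfold lin con)?; (unfold G_conic_def)?; assumption)
  have "list_all2 (\<lambda>f k. along r f = k * f) (G_conic # G_lines)
      [- (k0 + k1 + k2 + k3 + k4 + k5 + k6), k0, k1, k2, k3, k4, k5, k6]"
    unfolding G_lines_def by (intro list.rel_intros fac)
  from AR_prod_listI[OF this] show ?thesis by simp
qed

text \<open>A syzygy of degree 3 and two of degree 6 between the partial derivatives of \<open>G\<close>. With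
  their cofactors prescribed, the latter are determined up to multiples of the first; sparse
  representatives are used.\<close>

definition G_syz1 :: "'a::comm_ring_1 \<Rightarrow> 'a \<Rightarrow> 'a \<Rightarrow> 'a \<Rightarrow> 'a^3" where
  "G_syz1 i x y z = vector [
     8 * x^3 - 6 * x^2 * y - 8 * x^2 * z - 5 * x * y^2 + 10 * x * y * z,
     - 10 * x^2 * y + 3 * x * y^2 + 10 * x * y * z + 4 * y^3 - 8 * y^2 * z,
     - 10 * x^2 * z + 12 * x * y * z + x * z^2 - 5 * y^2 * z + y * z^2]"

definition G_syz2 :: "'a::comm_ring_1 \<Rightarrow> 'a \<Rightarrow> 'a \<Rightarrow> 'a \<Rightarrow> 'a^3" where
  "G_syz2 i x y z = vector [
     (12 - 12 * i) * x^3 * y^3 - (64 - 16 * i) * x^3 * y^2 * z - (56 - 32 * i) * x^2 * y^3 * z + (230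
     - 40 * i) * x^2 * y^2 * z^2 - (92 - 8 * i) * x^2 * y * z^3 + 16 * x^2 * z^4 + 83 * x * y^3 * z^2
     - 188 * x * y^2 * z^3 + 82 * x * y * z^4 - 12 * x * z^5,
     (12 - 12 * i) * x^2 * y^4 - (100 - 52 * i) * x^2 * y^3 * z + (270 - 36 * i) * x^2 * y^2 * z^2 - 108 * x^2 * y * z^3
     - (20 + 4 * i) * x * y^4 * z + (77 - 4 * i) * x * y^3 * z^2 - (236 - 8 * i) * x * y^2 * z^3 + 88 * x * y * z^4
     - 34 * y^4 * z^2 + 64 * y^3 * z^3 + 10 * y^2 * z^4 - 12 * y * z^5,
     - (96 - 96 * i) * x^2 * y^3 * z + (296 - 128 * i) * x^2 * y^2 * z^2 - (162 - 36 * i) * x^2 * y * z^3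
     + 36 * x^2 * z^4 + (106 - 22 * i) * x * y^3 * z^2 - (364 - 32 * i) * x * y^2 * z^3 + (205 - 10 * i) * x * y * z^4
     - 38 * x * z^5 + 29 * y^3 * z^3 + 19 * y^2 * z^4 - 26 * y * z^5 + 6 * z^6]"

definition G_syz3 :: "'a::comm_ring_1 \<Rightarrow> 'a \<Rightarrow> 'a \<Rightarrow> 'a \<Rightarrow> 'a^3" where
  "G_syz3 i x y z = vector [
     944 * x^5 * z + (24 - 24 * i) * x^4 * y^2 - (820 - 16 * i) * x^4 * y * z - 936 * x^4 * z^2 - (718
     - 80 * i) * x^3 * y^2 * z + (1578 - 40 * i) * x^3 * y * z^2 - 88 * x^3 * z^3 + (189 - 36 * i) * x^2 * y^2 * z^2
     - (382 - 16 * i) * x^2 * y * z^3 + 100 * x^2 * z^4 - 54 * x * y^2 * z^3 + 88 * x * y * z^4 - 24 * x * z^5,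
     - 1180 * x^4 * y * z + (24 - 24 * i) * x^3 * y^3 + (170 + 88 * i) * x^3 * y^2 * z + 1494 * x^3 * y * z^2
     + (416 + 8 * i) * x^2 * y^3 * z - (663 + 76 * i) * x^2 * y^2 * z^2 - 430 * x^2 * y * z^3 - (94 - 16 * i) * x * y^2 * z^3
     + 172 * x * y * z^4 + 16 * y^2 * z^4 - 24 * y * z^5,
     - 1180 * x^4 * z^2 - (192 - 192 * i) * x^3 * y^2 * z + (1880 - 128 * i) * x^3 * y * z^2 - (250 + 172 * i) * x^2 * y^2 * z^2
     - (654 - 104 * i) * x^2 * y * z^3 + 227 * x^2 * z^4 - (135 - 36 * i) * x * y^2 * z^3 + (311 - 20 * i) * x * y * z^4
     - 98 * x * z^5 + 18 * y^2 * z^4 - 38 * y * z^5 + 12 * z^6]"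

lemma G_syz1_logarithmic:
  fixes i x y z :: "'a::idom"
  shows "G_logarithmic i x y z (G_syz1 i x y z)"
  unfolding G_logarithmic_def G_syz1_def vector_3
  by (rule exI[of _ "8 * x^2 - 6 * x * y - 8 * x * z - 5 * y^2 + 10 * y * z"],
    rule exI[of _ "- 10 * x^2 + 3 * x * y + 10 * x * z + 4 * y^2 - 8 * y * z"],
    rule exI[of _ "- 10 * x^2 + 12 * x * y + x * z - 5 * y^2 + y * z"],
    rule exI[of _ "8 * x^2 + 12 * x * y - 8 * x * z + 4 * y^2 - 8 * y * z"],
    rule exI[of _ "8 * x^2 - 6 * x * y + x * z - 5 * y^2 + y * z"],
    rule exI[of _ "- 10 * x^2 + 3 * x * y + x * z + 4 * y^2 + y * z"],
    rule exI[of _ "8 * x^2 - 15 * x * y + x * z + 4 * y^2 + y * z"],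
    intro conjI; algebra)

lemma G_syz1_AR: "G_syz1 (cst \<i>) varx vary varz \<in> AR G.f"
  by (rule G_logarithmic_AR[OF G_syz1_logarithmic])

lemma G_syz1_homogeneous: "homogeneous 3 (G_syz1 (cst \<i>) varx vary varz $ n)"
proof -
  have "\<forall>n. homogeneous 3 (G_syz1 (cst \<i>) varx vary varz $ n)"
    unfolding forall_3 G_syz1_def vector_3
    by (intro conjI) (rule homogeneous_intros refl | simp)+
  then show ?thesis by blast
qed

lemma G_syz1_eval:
  "eval (G_syz1 (cst \<i>) varx vary varz $ n) v = G_syz1 \<i> (v $ 1) (v $ 2) (v $ 3) $ n"
  using exhaust_3[of n] by (auto simp: G_syz1_def)

lemma G_syz2_logarithmic:
  fixes i x y z :: "'a::idom"
  assumes i: "i * i = - 1"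
  shows "G_logarithmic i x y z (G_syz2 i x y z)"
  unfolding G_logarithmic_def G_syz2_def vector_3
  by (rule exI[of _ "(12 - 12 * i) * x^2 * y^3 - (64 - 16 * i) * x^2 * y^2 * z - (56 - 32 * i) * x * y^3 * z + (230 - 40 * i) * x * y^2 * z^2
      - (92 - 8 * i) * x * y * z^3 + 16 * x * z^4 + 83 * y^3 * z^2 - 188 * y^2 * z^3 + 82 * y * z^4 - 12 * z^5"],
    rule exI[of _ "(12 - 12 * i) * x^2 * y^3 - (100 - 52 * i) * x^2 * y^2 * z + (270 - 36 * i) * x^2 * y * z^2 - 108 * x^2 * z^3
      - (20 + 4 * i) * x * y^3 * z + (77 - 4 * i) * x * y^2 * z^2 - (236 - 8 * i) * x * y * z^3 + 88 * x * z^4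
      - 34 * y^3 * z^2 + 64 * y^2 * z^3 + 10 * y * z^4 - 12 * z^5"],
    rule exI[of _ "- (96 - 96 * i) * x^2 * y^3 + (296 - 128 * i) * x^2 * y^2 * z - (162 - 36 * i) * x^2 * y * z^2 + 36 * x^2 * z^3
      + (106 - 22 * i) * x * y^3 * z - (364 - 32 * i) * x * y^2 * z^2 + (205 - 10 * i) * x * y * z^3 - 38 * x * z^4
      + 29 * y^3 * z^2 + 19 * y^2 * z^3 - 26 * y * z^4 + 6 * z^5"],
    rule exI[of _ "(12 - 12 * i) * x^2 * y^3 - (64 - 16 * i) * x^2 * y^2 * z - (20 + 4 * i) * x * y^3 * z - (40 + 4 * i) * x * y^2 * z^2
      + (16 + 8 * i) * x * y * z^3 + 16 * x * z^4 - 34 * y^3 * z^2 + 64 * y^2 * z^3 + 10 * y * z^4 - 12 * z^5"],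
    rule exI[of _ "(12 - 12 * i) * x^2 * y^3 - (64 - 16 * i) * x^2 * y^2 * z - (2 + 22 * i) * x * y^3 * z + (50 + 32 * i) * x * y^2 * z^2
      - (11 + 10 * i) * x * y * z^3 - 2 * x * z^4 + 29 * y^3 * z^2 + 19 * y^2 * z^3 - 26 * y * z^4 + 6 * z^5"],
    rule exI[of _ "(12 - 12 * i) * x^2 * y^3 + (8 - 56 * i) * x^2 * y^2 * z - (18 - 36 * i) * x^2 * y * z^2 + 36 * x^2 * z^3
      - (20 + 4 * i) * x * y^3 * z - (49 - 14 * i) * x * y^2 * z^2 + (79 - 10 * i) * x * y * z^3 - 38 * x * z^4
      - 34 * y^3 * z^2 + y^2 * z^3 - 8 * y * z^4 + 6 * z^5"],
    rule exI[of _ "(12 - 12 * i) * x^2 * y^3 - (64 - 16 * i) * x^2 * y^2 * z - (20 + 4 * i) * x * y^3 * z + (185 + 14 * i) * x * y^2 * z^2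
      - (65 + 10 * i) * x * y * z^3 - 2 * x * z^4 - 34 * y^3 * z^2 + y^2 * z^3 - 8 * y * z^4 + 6 * z^5"],
    intro conjI; (algebra | simp add: i algebra_simps power2_eq_square eval_nat_numeral))

lemma G_syz2_AR: "G_syz2 (cst \<i>) varx vary varz \<in> AR G.f"
  by (rule G_logarithmic_AR[OF G_syz2_logarithmic[OF cst_i]])

lemma G_syz2_homogeneous: "homogeneous 6 (G_syz2 (cst \<i>) varx vary varz $ n)"
proof -
  have "\<forall>n. homogeneous 6 (G_syz2 (cst \<i>) varx vary varz $ n)"
    unfolding forall_3 G_syz2_def vector_3
    by (intro conjI) (rule homogeneous_intros refl | simp)+
  then show ?thesis by blast
qed

lemma G_syz2_eval:
  "eval (G_syz2 (cst \<i>) varx vary varz $ n) v = G_syz2 \<i> (v $ 1) (v $ 2) (v $ 3) $ n"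
  using exhaust_3[of n] by (auto simp: G_syz2_def)

lemma G_syz3_logarithmic:
  fixes i x y z :: "'a::idom"
  assumes i: "i * i = - 1"
  shows "G_logarithmic i x y z (G_syz3 i x y z)"
  unfolding G_logarithmic_def G_syz3_def vector_3
  by (rule exI[of _ "944 * x^4 * z + (24 - 24 * i) * x^3 * y^2 - (820 - 16 * i) * x^3 * y * z - 936 * x^3 * z^2 - (718
      - 80 * i) * x^2 * y^2 * z + (1578 - 40 * i) * x^2 * y * z^2 - 88 * x^2 * z^3 + (189 - 36 * i) * x * y^2 * z^2
      - (382 - 16 * i) * x * y * z^3 + 100 * x * z^4 - 54 * y^2 * z^3 + 88 * y * z^4 - 24 * z^5"],
    rule exI[of _ "- 1180 * x^4 * z + (24 - 24 * i) * x^3 * y^2 + (170 + 88 * i) * x^3 * y * z + 1494 * x^3 * z^2 + (416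
      + 8 * i) * x^2 * y^2 * z - (663 + 76 * i) * x^2 * y * z^2 - 430 * x^2 * z^3 - (94 - 16 * i) * x * y * z^3
      + 172 * x * z^4 + 16 * y * z^4 - 24 * z^5"],
    rule exI[of _ "- 1180 * x^4 * z - (192 - 192 * i) * x^3 * y^2 + (1880 - 128 * i) * x^3 * y * z - (250 + 172 * i) * x^2 * y^2 * z
      - (654 - 104 * i) * x^2 * y * z^2 + 227 * x^2 * z^3 - (135 - 36 * i) * x * y^2 * z^2 + (311 - 20 * i) * x * y * z^3
      - 98 * x * z^4 + 18 * y^2 * z^3 - 38 * y * z^4 + 12 * z^5"],
    rule exI[of _ "944 * x^4 * z + (24 - 24 * i) * x^3 * y^2 + (1304 + 16 * i) * x^3 * y * z - 936 * x^3 * z^2 + (416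
      + 8 * i) * x^2 * y^2 * z - (852 + 40 * i) * x^2 * y * z^2 - 88 * x^2 * z^3 - (40 - 16 * i) * x * y * z^3
      + 100 * x * z^4 + 16 * y * z^4 - 24 * z^5"],
    rule exI[of _ "944 * x^4 * z + (24 - 24 * i) * x^3 * y^2 - (820 - 16 * i) * x^3 * y * z + 126 * x^3 * z^2 - (610
      + 28 * i) * x^2 * y^2 * z + (228 + 32 * i) * x^2 * y * z^2 - 25 * x^2 * z^3 + (9 + 36 * i) * x * y^2 * z^2
      + (59 - 20 * i) * x * y * z^3 - 26 * x * z^4 + 18 * y^2 * z^3 - 38 * y * z^4 + 12 * z^5"],
    rule exI[of _ "- 1180 * x^4 * z + (24 - 24 * i) * x^3 * y^2 + (386 - 128 * i) * x^3 * y * z + (416 + 8 * i) * x^2 * y^2 * z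
      + (3 + 104 * i) * x^2 * y * z^2 + 227 * x^2 * z^3 + (41 - 20 * i) * x * y * z^3 - 98 * x * z^4 - 2 * y * z^4
      + 12 * z^5"],
    rule exI[of _ "944 * x^4 * z + (24 - 24 * i) * x^3 * y^2 - (1882 - 16 * i) * x^3 * y * z + 126 * x^3 * z^2 + (416
      + 8 * i) * x^2 * y^2 * z + (381 + 32 * i) * x^2 * y * z^2 - 25 * x^2 * z^3 - (67 + 20 * i) * x * y * z^3
      - 26 * x * z^4 - 2 * y * z^4 + 12 * z^5"],
    intro conjI; (algebra | simp add: i algebra_simps power2_eq_square eval_nat_numeral))

lemma G_syz3_AR: "G_syz3 (cst \<i>) varx vary varz \<in> AR G.f"
  by (rule G_logarithmic_AR[OF G_syz3_logarithmic[OF cst_i]])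

lemma G_syz3_homogeneous: "homogeneous 6 (G_syz3 (cst \<i>) varx vary varz $ n)"
proof -
  have "\<forall>n. homogeneous 6 (G_syz3 (cst \<i>) varx vary varz $ n)"
    unfolding forall_3 G_syz3_def vector_3
    by (intro conjI) (rule homogeneous_intros refl | simp)+
  then show ?thesis by blast
qed

lemma G_syz3_eval:
  "eval (G_syz3 (cst \<i>) varx vary varz $ n) v = G_syz3 \<i> (v $ 1) (v $ 2) (v $ 3) $ n"
  using exhaust_3[of n] by (auto simp: G_syz3_def)


section \<open>The ideal of a point\<close>

text \<open>Substituting \<open>A\<close> for \<open>x\<close> and then \<open>B\<close> for \<open>y\<close> and evaluating at \<open>t\<close> amounts to evaluation at a point.\<close>

lemma poly_poly_eval:
  "poly (poly (poly w A) B) t = poly (poly (poly w [:[:poly (poly A B) t:]:]) [:poly B t:]) t"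
  for w :: S
proof -
  have 2: "poly (poly p B) t = poly (poly p [:poly B t:]) t" for p :: "complex poly poly"
    by (induction p) simp_all
  show ?thesis by (induction w) (simp_all add: 2[symmetric])
qed

text \<open>Division by \<open>x - p z\<close> and then by \<open>y - q z\<close> leaves a polynomial in \<open>z\<close> as remainder, whose values at
  \<open>t \<noteq> 0\<close> are those of \<open>w\<close> at \<open>(p t, q t, t)\<close>; so it is 0.\<close>

lemma vanishing_ideal:
  assumes "\<And>t. t \<noteq> 0 \<Longrightarrow> eval w (vector [p * t, q * t, t]) = 0"
  obtains a b where "w = a * (varx - cst p * varz) + b * (vary - cst q * varz)"
proof -
  define A :: "complex poly poly" where "A = [:[:0, p:]:]"
  define B :: "complex poly" where "B = [:0, q:]"
  define v where "v = poly (poly w A) B"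
  have "poly ([:0, 1:] * v) t = 0" for t
  proof (cases "t = 0")
    case False
    have "poly v t = eval w (vector [p * t, q * t, t])"
      unfolding v_def eval_def by (subst poly_poly_eval) (simp add: A_def B_def mult.commute)
    then show ?thesis using assms[OF False] by simp
  qed simp
  then have "[:0, 1:] * v = 0" using poly_all_0_iff_0 by blast
  then have "v = 0" by simp
  have "w = [:- A, 1:] * synthetic_div w A + [:poly w A:]" by (rule synthetic_div_correct'[symmetric])
  moreover have "poly w A = [:- B, 1:] * synthetic_div (poly w A) B + [:poly (poly w A) B:]"
    by (rule synthetic_div_correct'[symmetric])
  then have "poly w A = [:- B, 1:] * synthetic_div (poly w A) B"
    unfolding v_def[symmetric] \<open>v = 0\<close> by simp
  then have "[:poly w A:] = [:[:- B, 1:]:] * [:synthetic_div (poly w A) B:]" by simp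
  ultimately have "w = synthetic_div w A * [:- A, 1:] + [:synthetic_div (poly w A) B:] * [:[:- B, 1:]:]"
    by (metis mult.commute)
  moreover have "[:- A, 1:] = varx - cst p * varz" "[:[:- B, 1:]:] = vary - cst q * varz"
    by (simp_all add: A_def B_def varx_def vary_def varz_def cst_def one_pCons)
  ultimately show ?thesis using that by metis
qed

lemma linear_form_vanishing:
  assumes "homogeneous 1 l" "eval l (vector [p, q, 1]) = 0"
  obtains a b where "l = cst a * (varx - cst p * varz) + cst b * (vary - cst q * varz)"
proof -
  obtain a b c where l: "l = cst a * varx + cst b * vary + cst c * varz" using linear_form[OF assms(1)] .
  have "a * p + b * q + c = 0" using assms(2) unfolding l by simp
  then have c: "c = - (a * p) - b * q" by algebra
  have "l = cst a * (varx - cst p * varz) + cst b * (vary - cst q * varz)"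
    unfolding l c by (simp add: cst_simps algebra_simps)
  then show ?thesis by (rule that)
qed

text \<open>Any two independent linear forms that vanish at the point \<open>[p : q : 1]\<close> generate its ideal.\<close>

lemma point_ideal:
  assumes l: "homogeneous 1 l" "homogeneous 1 m" "eval l (vector [p, q, 1]) = 0" "eval m (vector [p, q, 1]) = 0"
    and indep: "l \<noteq> 0" "\<not> l dvd m"
    and w: "\<And>t. t \<noteq> 0 \<Longrightarrow> eval w (vector [p * t, q * t, t]) = 0"
  shows "\<exists>a b. w = a * l + b * m"
proof -
  let ?x = "varx - cst p * varz" and ?y = "vary - cst q * varz"
  obtain a b where l': "l = cst a * ?x + cst b * ?y" using linear_form_vanishing l by metis
  obtain c d where m': "m = cst c * ?x + cst d * ?y" using linear_form_vanishing l by metis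
  have "a * d - b * c \<noteq> 0"
  proof
    assume det: "a * d - b * c = 0"
    have "\<exists>k. c = k * a \<and> d = k * b"
    proof (cases "a = 0")
      case True
      then have "b \<noteq> 0" using indep(1) l' by (auto simp: cst_simps)
      then show ?thesis using det True by (intro exI[of _ "d / b"]) simp
    next
      case False
      then show ?thesis using det by (intro exI[of _ "c / a"]) (simp add: field_simps)
    qed
    then obtain k where "c = k * a" "d = k * b" by blast
    then have "m = l * cst k" unfolding l' m' by (simp add: cst_simps algebra_simps)
    then show False using indep(2) by simp
  qed
  then obtain D where D: "D * (a * d - b * c) = 1" by (metis left_inverse)
  have one: "cst D * (cst a * cst d - cst b * cst c) = 1"
    using arg_cong[OF D, of cst] by (simp add: cst_simps)
  have x: "?x = cst D * cst d * l - cst D * cst b * m" and y: "?y = cst D * cst a * m - cst D * cst c * l"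
    unfolding l' m' using one by algebra+
  obtain e h where "w = e * ?x + h * ?y" using vanishing_ideal w by metis
  then have "w = (e * cst D * cst d - h * cst D * cst c) * l + (h * cst D * cst a - e * cst D * cst b) * m"
    unfolding x y by (simp add: algebra_simps)
  then show ?thesis by blast
qed


section \<open>\<open>F\<close> is free, \<open>G\<close> is nearly free\<close>

lemma F_free: "free_with_exponents F.f 4 4"
proof (rule free_with_exponentsI[OF F.squarefree_f _ _ F_syz1_AR F_syz2_AR F_syz1_homogeneous F_syz2_homogeneous])
  show "homogeneous (4 + 4 + 1) F.f"
    using F.homogeneous_f by (rule back_subst[where P = "\<lambda>n. homogeneous n F.f"]) (simp add: F_lines_def)
  let ?c = "cross (F_syz1 (cst \<i>) varx vary varz) (F_syz2 (cst \<i>) varx vary varz) :: S^3"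
  have "eval (?c $ 2) (vector [1, 0, 1]) \<noteq> 0"
    by (simp add: F_syz1_eval F_syz2_eval) (simp add: F_syz1_def F_syz2_def complex_eq_iff)
  then show "?c \<noteq> 0" by (metis eval_simps(1) zero_index)
qed simp

text \<open>The point \<open>[2 : 2 : 3]\<close> is a smooth point of the curve: of its components only the line \<open>x = y\<close> passes
  through it.\<close>

lemma G_grad_nonzero:
  assumes "t \<noteq> 0"
  obtains n where "eval (grad G.f $ n) (vector [2 / 3 * t, 2 / 3 * t, t]) \<noteq> 0"
proof (rule ccontr)
  let ?v = "vector [2 / 3 * t, 2 / 3 * t, t] :: complex^3"
  assume "\<not> thesis"
  then have grad: "eval (grad G.f $ n) ?v = 0" for n using that by blast
  have v: "?v \<noteq> 0" using assms by (simp add: vec_eq_iff forall_3)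
  have line: "eval (varx - vary) ?v = 0" by simp
  then have "eval G.f ?v = 0" unfolding eval_prod_list eval_simps G_lines_def by simp
  then have "vec.span {?v} \<in> sing_points G.f"
    using grad[of 1] grad[of 2] grad[of 3] v unfolding sing_points_def by auto
  then obtain w g h where w: "vec.span {?v} = vec.span {w}" "w \<noteq> 0" "g \<in> set (G_conic # G_lines)"
    "h \<in> set (G_conic # G_lines)" "g \<noteq> h" "eval g w = 0" "eval h w = 0" unfolding G.sing_points_f by blast
  obtain c where c: "?v = c *s w" using span_singleton_eqD[OF w(1) v] by metis
  have "eval g ?v = 0" "eval h ?v = 0"
    unfolding c using w G.factor_homogeneous eval_homogeneous by (metis mult_zero_right)+
  have "eval G_conic ?v = t * t * (- 5 / 9 - 4 / 9 * \<i>)"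
    by (simp add: G_conic_def power2_eq_square field_simps)
  moreover have "- 5 / 9 - 4 / 9 * \<i> \<noteq> 0" by (simp add: complex_eq_iff)
  ultimately have "eval G_conic ?v \<noteq> 0" using assms by simp
  then have "\<forall>k\<in>set (G_conic # G_lines). eval k ?v = 0 \<longrightarrow> k = varx - vary"
    using assms unfolding G_lines_def by simp
  then show False using w(3-5) \<open>eval g ?v = 0\<close> \<open>eval h ?v = 0\<close> by blast
qed

lemma G_syz1_zero: "eval (G_syz1 (cst \<i>) varx vary varz $ n) (vector [2 / 3 * t, 2 / 3 * t, t]) = 0"
  unfolding G_syz1_eval using exhaust_3[of n]
  by (auto simp: G_syz1_def power2_eq_square power3_eq_cube field_simps)

text \<open>At the point \<open>[2 : 2 : 3]\<close> the syzygy vanishes and the gradient does not.\<close>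

lemma G_cofactor_vanishes:
  assumes "cross (G_syz1 (cst \<i>) varx vary varz) r = w *s grad G.f" "t \<noteq> 0"
  shows "eval w (vector [2 / 3 * t, 2 / 3 * t, t]) = 0"
proof -
  obtain n where n: "eval (grad G.f $ n) (vector [2 / 3 * t, 2 / 3 * t, t]) \<noteq> 0"
    using G_grad_nonzero[OF assms(2)] .
  have "eval (cross (G_syz1 (cst \<i>) varx vary varz) r $ n) (vector [2 / 3 * t, 2 / 3 * t, t]) = 0"
    using exhaust_3[of n] by (elim disjE; simp only: cross_nth eval_simps G_syz1_zero; simp)
  then show ?thesis using n unfolding assms(1) by simp
qed

lemma G_nearly_free_setting:
  "\<exists>l2 l3. nearly_free_setting G.f 3 6 (G_syz1 (cst \<i>) varx vary varz)
     (G_syz2 (cst \<i>) varx vary varz) (G_syz3 (cst \<i>) varx vary varz) l2 l3"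
proof -
  let ?r1 = "G_syz1 (cst \<i>) varx vary varz" and ?r2 = "G_syz2 (cst \<i>) varx vary varz"
    and ?r3 = "G_syz3 (cst \<i>) varx vary varz"
  have len: "length G_lines = 7" by (simp add: G_lines_def)
  have hom: "homogeneous (Suc 8) G.f"
    using G.homogeneous_f by (rule back_subst[where P = "\<lambda>n. homogeneous n G.f"]) (simp add: len)
  have f0: "G.f \<noteq> 0" using G.squarefree_f by auto
  obtain l2 where l2: "cross ?r1 ?r2 = l2 *s grad G.f" using AR_cross[OF G.squarefree_f hom G_syz1_AR G_syz2_AR] .
  obtain l3 where l3: "cross ?r1 ?r3 = l3 *s grad G.f" using AR_cross[OF G.squarefree_f hom G_syz1_AR G_syz3_AR] .
  have v2: "eval (l2 * grad G.f $ n) v = eval (cross ?r1 ?r2 $ n) v"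
    and v3: "eval (l3 * grad G.f $ n) v = eval (cross ?r1 ?r3 $ n) v" for n v
    unfolding l2 l3 by simp_all
  \<comment> \<open>up to values of a derivative of \<open>G\<close> these are the values of \<open>l2\<close> and \<open>l3\<close>, which are not proportional\<close>
  have vals: "eval (cross ?r1 ?r2 $ 3) (vector [2, 1, 0]) = 4320 - 4320 * \<i>"
    "eval (cross ?r1 ?r3 $ 3) (vector [2, 1, 0]) = 17280 - 17280 * \<i>"
    "eval (cross ?r1 ?r2 $ 3) (vector [1, 2, 0]) = - 6912 + 6912 * \<i>"
    "eval (cross ?r1 ?r3 $ 3) (vector [1, 2, 0]) = - 6912 + 6912 * \<i>"
    by (simp_all add: G_syz1_eval G_syz2_eval G_syz3_eval)
      (simp_all add: G_syz1_def G_syz2_def G_syz3_def complex_eq_iff)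
  have nz: "l2 \<noteq> 0" "l3 \<noteq> 0"
    using vals(1,2) v2[of 3 "vector [2, 1, 0]"] v3[of 3 "vector [2, 1, 0]"] by (auto simp: complex_eq_iff)
  have linear: "homogeneous 1 l" if l: "cross ?r1 r = l *s grad G.f" "\<And>i. homogeneous 6 (r $ i)" "l \<noteq> 0" for l r
  proof -
    obtain e where "homogeneous e l" "3 + 6 = 8 + e"
      using homogeneous_cofactor[OF l(1)[symmetric] homogeneous_cross[OF G_syz1_homogeneous l(2)]
          homogeneous_grad[OF hom] grad_nonzero[OF hom f0] l(3)] by metis
    then show ?thesis by simp
  qed
  have hom_l: "homogeneous 1 l2" "homogeneous 1 l3"
    using linear[OF l2 G_syz2_homogeneous nz(1)] linear[OF l3 G_syz3_homogeneous nz(2)] .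
  have "\<not> l2 dvd l3"
  proof
    assume "l2 dvd l3"
    then obtain k where k: "l3 = l2 * k" by auto
    then obtain a b where "homogeneous b k" "a = 1" "a + b = 1" "homogeneous a l2"
      using homogeneous_factor hom_l nz homogeneous_unique by metis
    then obtain c where "k = cst c" using homogeneous_0D by auto
    then have "l3 = cst c * l2" using k by (simp add: mult.commute)
    then have "eval (cross ?r1 ?r3 $ 3) v = c * eval (cross ?r1 ?r2 $ 3) v" for v
      unfolding v2[symmetric] v3[symmetric] by simp
    from this[of "vector [2, 1, 0]"] this[of "vector [1, 2, 0]"] show False
      unfolding vals by (auto simp: complex_eq_iff)
  qed
  moreover have "eval l2 (vector [2 / 3, 2 / 3, 1]) = 0" "eval l3 (vector [2 / 3, 2 / 3, 1]) = 0"
    using G_cofactor_vanishes[OF l2, of 1] G_cofactor_vanishes[OF l3, of 1] by simp_all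
  moreover have "\<exists>a b. w = a * l2 + b * l3" if "cross ?r1 r = w *s grad G.f" for r w
    using point_ideal[OF hom_l, of "2 / 3" "2 / 3" w] G_cofactor_vanishes[OF that] calculation nz(1) by blast
  moreover have "prime_elem l2"
    using irreducible_imp_prime_elem[OF linear_form_irreducible[OF hom_l(1) nz(1)]] .
  ultimately have "nearly_free_setting G.f 3 6 ?r1 ?r2 ?r3 l2 l3"
    using G.squarefree_f hom G_syz1_AR G_syz2_AR G_syz3_AR G_syz1_homogeneous G_syz2_homogeneous
      G_syz3_homogeneous l2 l3 hom_l nz
    by (intro nearly_free_setting.intro) auto
  then show ?thesis by blast
qed

lemma G_nearly_free: "nearly_free_with_exponents G.f 3 6" "mdr G.f = 3" "\<not> free_curve G.f"
proof -
  obtain l2 l3 where "nearly_free_setting G.f 3 6 (G_syz1 (cst \<i>) varx vary varz)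
     (G_syz2 (cst \<i>) varx vary varz) (G_syz3 (cst \<i>) varx vary varz) l2 l3"
    using G_nearly_free_setting by blast
  then interpret nearly_free_setting G.f 3 6 "G_syz1 (cst \<i>) varx vary varz"
     "G_syz2 (cst \<i>) varx vary varz" "G_syz3 (cst \<i>) varx vary varz" l2 l3 .
  show "nearly_free_with_exponents G.f 3 6" "mdr G.f = 3" "\<not> free_curve G.f"
    by (fact nearly_free mdr_eq not_free)+
qed


section \<open>The counterexample\<close>

lemma F_weak_combinatorics: "weak_combinatorics F.f 7 1 8 1 4"
  and F_singularities: "ordinary_singularities F.f" "quasi_homogeneous_singularities F.f"
  and F_card_normal: "card {p. normal_point 2 F.f p} = 8" "card {p. normal_point 3 F.f p} = 1"
    "card {p. normal_point 4 F.f p} = 4"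
proof -
  have normal: "\<forall>p\<in>set (map (\<lambda>v. vec.span {v}) F_points2). normal_point 2 F.f p"
    "\<forall>p\<in>set (map (\<lambda>v. vec.span {v}) F_points3). normal_point 3 F.f p"
    "\<forall>p\<in>set (map (\<lambda>v. vec.span {v}) F_points4). normal_point 4 F.f p"
    using F_normal_points2 F_normal_points3 F_normal_points4 by auto
  note c = F_combinatorics[OF normal]
  have len: "length F_lines = 7" "length F_points2 = 8" "length F_points3 = 1" "length F_points4 = 4"
    by (simp_all add: F_lines_def F_points2_def F_points3_def F_points4_def)
  show "weak_combinatorics F.f 7 1 8 1 4" using c(1) by (simp only: len length_map)
  show "ordinary_singularities F.f" "quasi_homogeneous_singularities F.f" using c(5,6) .
  show "card {p. normal_point 2 F.f p} = 8" "card {p. normal_point 3 F.f p} = 1" "card {p. normal_point 4 F.f p} = 4"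
    unfolding c(2-4) using F_distinct[THEN distinct_card] by (simp_all only: len length_map)
qed

lemma G_weak_combinatorics: "weak_combinatorics G.f 7 1 8 1 4"
  and G_singularities: "ordinary_singularities G.f" "quasi_homogeneous_singularities G.f"
  and G_card_normal: "card {p. normal_point 2 G.f p} = 8" "card {p. normal_point 3 G.f p} = 1"
    "card {p. normal_point 4 G.f p} = 4"
proof -
  have normal: "\<forall>p\<in>set (map (\<lambda>v. vec.span {v}) G_points2). normal_point 2 G.f p"
    "\<forall>p\<in>set (map (\<lambda>v. vec.span {v}) G_points3). normal_point 3 G.f p"
    "\<forall>p\<in>set (map (\<lambda>v. vec.span {v}) G_points4). normal_point 4 G.f p"
    using G_normal_points2 G_normal_points3 G_normal_points4 by auto
  note c = G_combinatorics[OF normal]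
  have len: "length G_lines = 7" "length G_points2 = 8" "length G_points3 = 1" "length G_points4 = 4"
    by (simp_all add: G_lines_def G_points2_def G_points3_def G_points4_def)
  show "weak_combinatorics G.f 7 1 8 1 4" using c(1) by (simp only: len length_map)
  show "ordinary_singularities G.f" "quasi_homogeneous_singularities G.f" using c(5,6) .
  show "card {p. normal_point 2 G.f p} = 8" "card {p. normal_point 3 G.f p} = 1" "card {p. normal_point 4 G.f p} = 4"
    unfolding c(2-4) using G_distinct[THEN distinct_card] by (simp_all only: len length_map)
qed

lemma F_G_same_weak_combinatorics: "same_weak_combinatorics F.f G.f"
proof (rule same_weak_combinatoricsI[OF _ F.homogeneous_f G.homogeneous_f])
  show "card (curve_components k F.f) = card (curve_components k G.f)" for k
    unfolding F.card_curve_components G.card_curve_components by (simp add: F_lines_def G_lines_def)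
  show "finite (sing_points F.f)" "finite (sing_points G.f)"
    unfolding F_sing_points G_sing_points by simp_all
  show "\<exists>m\<in>{2, 3, 4}. normal_point m F.f p" if "p \<in> sing_points F.f" for p
    using that F_normal_points2 F_normal_points3 F_normal_points4 unfolding F_sing_points by auto
  show "\<exists>m\<in>{2, 3, 4}. normal_point m G.f p" if "p \<in> sing_points G.f" for p
    using that G_normal_points2 G_normal_points3 G_normal_points4 unfolding G_sing_points by auto
  show "card {p. normal_point m F.f p} = card {p. normal_point m G.f p}" if "m \<in> {2, 3, 4}" for m
    using that F_card_normal G_card_normal by auto
qed

theorem theorem4p1:
  fixes x y z F G :: S
  assumes "x = varx" and "y = vary" and "z = varz"
    and "F = y * (y - x) * (y + x) * (y - x - 2 * z) * (y - x + 2 * z) * (y + x - 2 * z) *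
           (y + x + 2 * z) * (x^2 - y^2 + 4 * cst \<i> * y * z - 4 * z^2)"
    and "G = x * y * z * (x - y) * (2 * x - z) * (y - z) * (2 * x + y - z) *
           (z^2 - y * z - 2 * x * z + (1 - cst \<i>) * x * y)"
  shows "same_weak_combinatorics F G \<and>
         weak_combinatorics F 7 1 8 1 4 \<and>
         weak_combinatorics G 7 1 8 1 4 \<and>
         free_with_exponents F 4 4 \<and>
         mdr G = 3 \<and>
         nearly_free_with_exponents G 3 6 \<and>
         conic_line_arrangement F \<and> ordinary_singularities F \<and> quasi_homogeneous_singularities F \<and>
         conic_line_arrangement G \<and> ordinary_singularities G \<and> quasi_homogeneous_singularities G \<and>
         numerical_terao_counterexample F G \<and>
         \<not> numerical_terao_conjecture"
proof -
  have F: "F = F.f" and G: "G = G.f"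
    unfolding assms by (simp_all add: F_lines_def F_conic_def G_lines_def G_conic_def ac_simps)
  have counterexample: "numerical_terao_counterexample F.f G.f"
    unfolding numerical_terao_counterexample_def numerical_terao_hypotheses_def free_curve_def
    using F.conic_line_arrangement_f G.conic_line_arrangement_f F.smooth_components_f G.smooth_components_f
      F_singularities G_singularities F_G_same_weak_combinatorics F_free G_nearly_free(3)
    unfolding conic_line_arrangement_def free_curve_def by blast
  moreover from this have "\<not> numerical_terao_conjecture"
    unfolding numerical_terao_counterexample_def numerical_terao_conjecture_def by blast
  ultimately show ?thesis
    unfolding F G
    using F_G_same_weak_combinatorics F_weak_combinatorics G_weak_combinatorics F_free G_nearly_free
      F.conic_line_arrangement_f G.conic_line_arrangement_f F_singularities G_singularities
    by blast
qed

end
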